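(* Let $\omega$ be a radial weight and let $\nu\in\widehat{\mathcal{D}}$. Then the following conditions are equivalent: (i) $P_\omega: L^\infty_{\widehat{\nu}}\to \mathcal{B}^\infty_{\widehat{\nu}}$ is bounded; (ii) $\displaystyle \sup_{x\ge 0}\frac{\nu_x}{\omega_{2x}}\left(\frac{\omega}{\widehat{\nu}}\right)_x<\infty$; (iii) $\omega\in\widehat{\mathcal{D}}$ and $\displaystyle \sup_{0\le r<1}\frac{\widehat{\nu}(r)}{\widehat{\omega}(r)}\int_r^1\frac{\omega(s)}{\widehat{\nu}(s)}\,ds<\infty$.
   Context: Let $\mathbb{D}$ be the open unit disc of $\mathbb{C}$, $\mathcal{H}(\mathbb{D})$ the space of analytic functions in $\mathbb{D}$, and $dA(z)=\frac{dx\,dy}{\pi}$ the normalized area measure. A radial weight is a nonnegative function $\omega\in L^1([0,1))$, extended to $\mathbb{D}$ by $\omega(z)=\omega(|z|)$. Write $\widehat{\omega}(z)=\widehat{\omega}(|z|)=\int_{|z|}^1\omega(s)\,ds$; it is assumed throughout that $\widehat{\omega}(z)>0$ for all $z\in\mathbb{D}$. The moments of a nonnegative function $\omega$ on $[0,1)$ are $\omega_x=\int_0^1 r^x\omega(r)\,dr$, $x\ge0$; in particular $\left(\frac{\omega}{\widehat{\nu}}\right)_x=\int_0^1 r^x\frac{\omega(r)}{\widehat{\nu}(r)}\,dr$. A radial weight $\omega$ belongs to $\widehat{\mathcal{D}}$ if there is $C>0$ such that $\widehat{\omega}(r)\le C\,\widehat{\omega}\left(\frac{1+r}{2}\right)$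 as $r\to1^-$ (i.e. for all $r<1$ close enough to $1$). For a radial weight $\omega$, the Bergman projection is $$P_\omega(f)(z)=\int_{\mathbb{D}}f(\zeta)\,\overline{B^\omega_z(\zeta)}\,\omega(\zeta)\,dA(\zeta),\qquad B^\omega_z(\zeta)=\sum_{n=0}^\infty\frac{(\overline{z}\zeta)^n}{2\omega_{2n+1}},$$ where $B^\omega_z$ is the reproducing kernel of the Bergman space $A^2_\omega=L^2(\mathbb{D},\omega\,dA)\cap\mathcal{H}(\mathbb{D})$. For a radial weight $\nu$, $L^\infty_{\widehat{\nu}}$ is the space of measurable $f:\mathbb{D}\to\mathbb{C}$ with $\|f\|_{\infty,\widehat{\nu}}=\operatorname{ess\,sup}_{z\in\mathbb{D}}|f(z)|\widehat{\nu}(z)<\infty$, and the Bloch type space is $\mathcal{B}^\infty_{\widehat{\nu}}=\{f\in\mathcal{H}(\mathbb{D}):\|f\|_{\mathcal{B}^\infty_{\widehat{\nu}}}=\sup_{z\in\mathbb{D}}(1-|z|)\widehat{\nu}(z)|f'(z)|<\infty\}$. Boundedness of $P_\omega:X\to Y$ means that for every $f\in X$ the integral $\int_{\mathbb{D}}f(\zeta)\,\overline{B^\omega_z(\zeta)}\,\omega(\zeta)\,dA(\zeta)$, as a function of $z\in\mathbb{D}$, defines an element of $Y$, and $\|P_\omega f\|_Y\le C\|f\|_X$ with $C$ independent of $f$. *)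

theory Defs
  imports "HOL-Complex_Analysis.Complex_Analysis" "HOL-Probability.Essential_Supremum"
begin

abbreviation unit_disc :: "complex set" where
  "unit_disc \<equiv> ball 0 1"

text \<open>A radial weight is represented by its profile on \<open>[0,1)\<close>; its value at a point \<open>z\<close> of the disc
  is \<open>\<omega> (cmod z)\<close>. Values of the profile outside \<open>[0,1)\<close> are never used.\<close>

definition tail :: "(real \<Rightarrow> real) \<Rightarrow> real \<Rightarrow> real" where
  "tail \<omega> r = (LINT s:{r..<1}|lebesgue. \<omega> s)"

definition radial_weight :: "(real \<Rightarrow> real) \<Rightarrow> bool" where
  "radial_weight \<omega> \<longleftrightarrow>
     set_integrable lebesgue {0..<1} \<omega> \<and> (\<forall>r\<in>{0..<1}. 0 \<le> \<omega> r) \<and> (\<forall>r\<in>{0..<1}. 0 < tail \<omega> r)"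

text \<open>Moments of a nonnegative function on \<open>[0,1)\<close>. They are extended-valued because the moments of
  \<open>\<omega> / tail \<nu>\<close> may be infinite; those of a radial weight are finite. Isabelle's \<open>0 powr 0 = 0\<close>
  only affects the null set \<open>{0}\<close>.\<close>

definition moment :: "(real \<Rightarrow> real) \<Rightarrow> real \<Rightarrow> ennreal" where
  "moment \<omega> x = (\<integral>\<^sup>+r\<in>{0..<1}. ennreal (r powr x * \<omega> r) \<partial>lebesgue)"

definition D_hat :: "(real \<Rightarrow> real) set" where
  "D_hat = {\<omega>. radial_weight \<omega> \<and>
     (\<exists>C>0. \<forall>\<^sub>F r in at_left 1. tail \<omega> r \<le> C * tail \<omega> ((1 + r) / 2))}"

definition bergman_kernel :: "(real \<Rightarrow> real) \<Rightarrow> complex \<Rightarrow> complex \<Rightarrow> complex" where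
  "bergman_kernel \<omega> z \<zeta> =
     (\<Sum>n. (cnj z * \<zeta>) ^ n / of_real (2 * enn2real (moment \<omega> (2 * real n + 1))))"

definition projection_integrand ::
  "(real \<Rightarrow> real) \<Rightarrow> (complex \<Rightarrow> complex) \<Rightarrow> complex \<Rightarrow> complex \<Rightarrow> complex" where
  "projection_integrand \<omega> f z \<zeta> =
     f \<zeta> * cnj (bergman_kernel \<omega> z \<zeta>) * of_real (\<omega> (cmod \<zeta>))"

text \<open>The factor \<open>1/\<pi>\<close> normalizes the area measure, \<open>dA = dx dy / \<pi>\<close>.\<close>

definition bergman_projection ::
  "(real \<Rightarrow> real) \<Rightarrow> (complex \<Rightarrow> complex) \<Rightarrow> complex \<Rightarrow> complex" where
  "bergman_projection \<omega> f z =
     of_real (1 / pi) * (LINT \<zeta>:unit_disc|lebesgue. projection_integrand \<omega> f z \<zeta>)"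

definition Linf_norm :: "(real \<Rightarrow> real) \<Rightarrow> (complex \<Rightarrow> complex) \<Rightarrow> ennreal" where
  "Linf_norm \<nu> f =
     esssup (lebesgue_on unit_disc) (\<lambda>z. ennreal (cmod (f z) * tail \<nu> (cmod z)))"

definition Linf_space :: "(real \<Rightarrow> real) \<Rightarrow> (complex \<Rightarrow> complex) set" where
  "Linf_space \<nu> = {f \<in> borel_measurable (lebesgue_on unit_disc). Linf_norm \<nu> f < \<infinity>}"

definition Bloch_norm :: "(real \<Rightarrow> real) \<Rightarrow> (complex \<Rightarrow> complex) \<Rightarrow> ennreal" where
  "Bloch_norm \<nu> f =
     (SUP z\<in>unit_disc. ennreal ((1 - cmod z) * tail \<nu> (cmod z) * cmod (deriv f z)))"

definition Bloch_space :: "(real \<Rightarrow> real) \<Rightarrow> (complex \<Rightarrow> complex) set" where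
  "Bloch_space \<nu> = {f. f holomorphic_on unit_disc \<and> Bloch_norm \<nu> f < \<infinity>}"

text \<open>Integrability is required explicitly because the Bochner integral of a non-integrable function
  is \<open>0\<close> by convention.\<close>

definition projection_bounded :: "(real \<Rightarrow> real) \<Rightarrow> (real \<Rightarrow> real) \<Rightarrow> bool" where
  "projection_bounded \<omega> \<nu> \<longleftrightarrow>
     (\<forall>f\<in>Linf_space \<nu>.
        (\<forall>z\<in>unit_disc. set_integrable lebesgue unit_disc (projection_integrand \<omega> f z)) \<and>
        bergman_projection \<omega> f \<in> Bloch_space \<nu>) \<and>
     (\<exists>C\<ge>0. \<forall>f\<in>Linf_space \<nu>.
        Bloch_norm \<nu> (bergman_projection \<omega> f) \<le> ennreal C * Linf_norm \<nu> f)"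

end

theory Submission
  imports Defs "HOL-Real_Asymp.Real_Asymp"
begin

text \<open>Write \<open>\<sigma> = \<omega> / tail \<nu>\<close>. For a weight in \<open>D_hat\<close> the moment of order \<open>x\<close> is comparable to the tail at
  \<open>1 - 1 / x\<close>, and membership in \<open>D_hat\<close> amounts to a doubling property of the moments; this turns (ii) and (iii) into
  each other. For (i) implies (ii), the projection of \<open>sgn \<zeta> ^ n / tail \<nu> (cmod \<zeta>)\<close> is a multiple of \<open>z ^ n\<close> by
  orthogonality, the factor being the moment of \<open>\<sigma>\<close> of order \<open>n + 1\<close> divided by the moment of \<open>\<omega>\<close> of order
  \<open>2 * n + 1\<close>; evaluating the Bloch norm at \<open>1 - 1 / n\<close> gives (ii) at \<open>n\<close>.
  For (iii) implies (i), let \<open>K\<close> be the power series with \<open>cnj \<zeta> * K (z * cnj \<zeta>)\<close> the \<open>z\<close>-derivative of the conjugate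
  kernel. The coefficients of \<open>(1 - u) * K u\<close> are \<open>O(1 / \<omega>\<^bsub>2 n + 3\<^esub>)\<close>, so its mean square on the circle of radius
  \<open>\<rho>\<close> is \<open>O(1 / ((1 - \<rho>) * (tail \<omega> \<rho>)\<^sup>2))\<close>, while that of \<open>1 / (1 - u)\<close> is \<open>O(1 / (1 - \<rho>))\<close>. Hence the mean of
  \<open>K\<close> is \<open>O(1 / ((1 - \<rho>) * tail \<omega> \<rho>))\<close>, and it remains to integrate this against \<open>\<sigma>\<close>, splitting the radial integral
  at \<open>cmod z\<close>.\<close>

section \<open>Area measure of the disc: radial functions and rotations\<close>

text \<open>Each of the three conditions forces \<sigma> to be integrable: (i) through the integrand
  at z = 0, (ii) at x = 0, (iii) at r = 0. So \<sigma> is itself a radial weight, and all later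
  comparisons are between real numbers. The factor 1 - u is a summation by parts. Differencing
  removes the factor n, because doubling of the moments of \<omega> makes neighbouring moments
  close. That is why membership of \<omega> in \<open>D_hat\<close> has to be extracted from (ii)
  first; its source is the gap between the orders x on the left and 2 x on the right. In (i) implies
  (ii) doubling of \<omega> is not yet known. There only shifts of the order by a constant occur,
  and these are harmless for every radial weight. Circles enter only through area integrals: the
  pushforward under \<open>cmod\<close> handles radial functions, and rotation invariance gives the
  orthogonality of monomials.\<close>

lemma emeasure_lborel_annulus:
  assumes "0 \<le> x" "x \<le> 1"
  shows "emeasure lborel (unit_disc - cball 0 x) = ennreal (pi - pi * x\<^sup>2)"
proof -
  have "emeasure lborel (unit_disc - ball 0 x) = emeasure lborel unit_disc - emeasure lborel (ball (0::complex) x)"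
    using assms by (intro emeasure_Diff) (auto simp: emeasure_ball)
  also have "\<dots> = ennreal (pi - pi * x\<^sup>2)"
    using assms by (simp add: emeasure_ball ennreal_minus unit_ball_vol_2)
  also have "emeasure lborel (unit_disc - ball 0 x) = emeasure lborel (unit_disc - cball 0 x)"
  proof (rule emeasure_eq_AE)
    have "sphere (0::complex) x \<in> null_sets lborel"
      using negligible_sphere[of "0::complex" x]
      by (auto simp: null_sets_completion_iff negligible_iff_null_sets)
    from AE_not_in[OF this] show "AE z in lborel. z \<in> unit_disc - ball 0 x \<longleftrightarrow> z \<in> unit_disc - cball 0 x"
      by eventually_elim auto
  qed auto
  finally show ?thesis .
qed

text \<open>Measures on the line that are finite on the rays \<open>{x<..}\<close> are determined by
  their values there, and the preimage of such a ray is an annulus of known area. This is all of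
  polar coordinates that radial functions require.\<close>

lemma distr_cmod_lborel:
  "distr (restrict_space lborel unit_disc) borel cmod
    = density lborel (\<lambda>r. ennreal (2 * pi * r) * indicator {0..<1} r)" (is "?M = ?N")
proof (rule measure_eqI_lessThan)
  have M: "emeasure ?M {x<..} = emeasure lborel (unit_disc - cball 0 x)" for x
  proof -
    have "cmod -` {x<..} \<inter> unit_disc = unit_disc - cball 0 x" by auto
    thus ?thesis
      by (subst emeasure_distr)
         (auto simp: emeasure_restrict_space space_restrict_space measurable_restrict_space1)
  qed
  have N: "emeasure ?N {x<..} = ennreal (pi - pi * x\<^sup>2)" if "0 \<le> x" "x \<le> 1" for x
  proof -
    have "emeasure ?N {x<..} = (\<integral>\<^sup>+r. ennreal (2 * pi * r) * indicator {0..<1} r * indicator {x<..} r \<partial>lborel)"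
      by (subst emeasure_density) auto
    also have "\<dots> = (\<integral>\<^sup>+r. ennreal (2 * pi * r) * indicator {x..1} r \<partial>lborel)"
    proof (rule nn_integral_cong_AE)
      show "AE r in lborel. ennreal (2 * pi * r) * indicator {0..<1} r * indicator {x<..} r
          = ennreal (2 * pi * r) * indicator {x..1} r"
        using AE_lborel_singleton[of x] AE_lborel_singleton[of 1] 
        by eventually_elim (use that in \<open>auto simp: indicator_def\<close>)
    qed
    also have "\<dots> = ennreal (pi * 1\<^sup>2 - pi * x\<^sup>2)"
      using that
      by (intro nn_integral_FTC_Icc) (auto intro!: derivative_eq_intros)
    finally show ?thesis by simp
  qed
  have N': "emeasure ?N {x<..} = ennreal pi" if "x < 0" for x
  proof -
    have "AE r in lborel. ennreal (2 * pi * r) * indicator {0..<1} r * indicator {x<..} r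
        = ennreal (2 * pi * r) * indicator {0..<1} r * indicator {0<..} r"
      using AE_lborel_singleton[of 0]
      by eventually_elim (use that in \<open>auto simp: indicator_def\<close>)
    hence "emeasure ?N {x<..} = emeasure ?N {0<..}"
      by (simp add: emeasure_density nn_integral_cong_AE)
    thus ?thesis using N[of 0] by simp
  qed
  have N'': "emeasure ?N {x<..} = 0" if "x > 1" for x
    using that by (subst emeasure_density) (auto simp: indicator_def nn_integral_0_iff_AE)
  show eq: "emeasure ?M {x<..} = emeasure ?N {x<..}" for x
  proof -
    consider "x < 0" | "0 \<le> x" "x \<le> 1" | "x > 1" by linarith
    thus ?thesis
    proof cases
      case 1
      thus ?thesis using N'[of x] by (simp add: M emeasure_ball unit_ball_vol_2)
    next
      case 2
      thus ?thesis by (simp only: M N emeasure_lborel_annulus)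
    next
      case 3
      hence "unit_disc - cball (0::complex) x = {}" by auto
      thus ?thesis using 3 by (simp only: M N'' emeasure_empty)
    qed
  qed
  show "emeasure ?M {x<..} < \<infinity>" for x
    unfolding M
    by (rule le_less_trans[OF emeasure_mono[of _ unit_disc]]) (auto simp: emeasure_ball)
qed auto

text \<open>Weights are only Lebesgue measurable, so composing them with \<open>cmod\<close>
  requires preimages of null sets to be null. The Borel density gives this, as a Lebesgue set is
  Borel up to a subset of a Borel null set.\<close>

lemma cmod_measurable_lebesgue:
  "cmod \<in> measurable (lebesgue_on unit_disc) (lebesgue_on {0..<1})"
  and distr_cmod_lebesgue:
  "distr (lebesgue_on unit_disc) (lebesgue_on {0..<1}) cmod
    = density (lebesgue_on {0..<1}) (\<lambda>r. ennreal (2 * pi * r))"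
proof -
  define E where "E A = emeasure lborel (cmod -` A \<inter> unit_disc)" for A
  have E: "E A = (\<integral>\<^sup>+r. ennreal (2 * pi * r) * indicator {0..<1} r * indicator A r \<partial>lborel)"
    if "A \<in> sets borel" for A
  proof -
    have "emeasure (distr (restrict_space lborel unit_disc) borel cmod) A = E A"
      using that unfolding E_def by (subst emeasure_distr)
         (auto simp: emeasure_restrict_space space_restrict_space measurable_restrict_space1
           sets_restrict_space intro: measurable_sets_borel)
    thus ?thesis unfolding distr_cmod_lborel using that by (subst (asm) emeasure_density) auto
  qed
  have bor: "cmod -` A \<inter> unit_disc \<in> sets borel" if "A \<in> sets borel" for A
    using that by (intro sets.Int measurable_sets_borel[OF _ that]) auto
  have null: "E A = 0" if "A \<in> null_sets lborel" for A
  proof -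
    have "AE r in lborel. ennreal (2 * pi * r) * indicator {0..<1} r * indicator A r = 0"
      using AE_not_in[OF that] by eventually_elim auto
    moreover have "A \<in> sets borel" using that by auto
    ultimately show ?thesis unfolding E[OF \<open>A \<in> sets borel\<close>]
      by (subst nn_integral_0_iff_AE) (use that in auto)
  qed
  have *: "cmod -` A \<inter> unit_disc \<in> sets lebesgue \<and> 
      emeasure lebesgue (cmod -` A \<inter> unit_disc) = (\<integral>\<^sup>+r. ennreal (2 * pi * r) * indicator {0..<1} r * indicator A r \<partial>lebesgue)"
    if "A \<in> sets lebesgue" for A
  proof -
    from sets_completionE[OF that] obtain S N N' where S: "A = S \<union> N" "N \<subseteq> N'" "N' \<in> null_sets lborel"
      "S \<in> sets lborel" by blast
    hence Sb: "S \<in> sets borel" and N'b: "N' \<in> sets borel" by auto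
    have nn: "cmod -` N' \<inter> unit_disc \<in> null_sets lborel"
      using null[OF S(3)] bor[OF N'b] unfolding E_def by (intro null_setsI) auto
    have n2: "cmod -` N \<inter> unit_disc \<in> null_sets lebesgue"
      using null_sets_completion_subset[OF _ null_sets_completionI[OF nn]] S(2)
      by (metis Int_mono order_refl vimage_mono)
    have eq: "cmod -` A \<inter> unit_disc = (cmod -` S \<inter> unit_disc) \<union> (cmod -` N \<inter> unit_disc)"
      using S by auto
    have m: "cmod -` S \<inter> unit_disc \<in> sets lebesgue" using bor[OF Sb] by auto
    have "emeasure lebesgue (cmod -` A \<inter> unit_disc) = E S"
      unfolding eq by (subst emeasure_Un_null_set[OF m n2]) (use bor[OF Sb] in \<open>auto simp: E_def\<close>)
    also have "\<dots> = (\<integral>\<^sup>+r. ennreal (2 * pi * r) * indicator {0..<1} r * indicator S r \<partial>lebesgue)"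
      unfolding E[OF Sb] by (rule nn_integral_completion[symmetric])
    also have "\<dots> = (\<integral>\<^sup>+r. ennreal (2 * pi * r) * indicator {0..<1} r * indicator A r \<partial>lebesgue)"
    proof (rule nn_integral_cong_AE)
      have "AE r in lebesgue. r \<notin> N'" using AE_completion[OF AE_not_in[OF S(3)]] .
      thus "AE r in lebesgue. ennreal (2 * pi * r) * indicator {0..<1} r * indicator S r =
        ennreal (2 * pi * r) * indicator {0..<1} r * indicator A r"
        by eventually_elim (use S in \<open>auto simp: indicator_def\<close>)
    qed
    finally show ?thesis using m n2 unfolding eq by (auto intro!: sets.Un)
  qed
  show meas: "cmod \<in> measurable (lebesgue_on unit_disc) (lebesgue_on {0..<1})"
  proof (rule measurableI)
    fix A assume "A \<in> sets (lebesgue_on {0..<1::real})"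
    hence "A \<in> sets lebesgue" by (auto simp: sets_restrict_space)
    thus "cmod -` A \<inter> space (lebesgue_on unit_disc) \<in> sets (lebesgue_on unit_disc)"
      using *[of A] by (subst sets_restrict_space_iff) (auto simp: space_restrict_space)
  qed (auto simp: space_restrict_space)
  show "distr (lebesgue_on unit_disc) (lebesgue_on {0..<1}) cmod
    = density (lebesgue_on {0..<1}) (\<lambda>r. ennreal (2 * pi * r))"
  proof (rule measure_eqI)
    fix A assume "A \<in> sets (distr (lebesgue_on unit_disc) (lebesgue_on {0..<1::real}) cmod)"
    hence A: "A \<in> sets (lebesgue_on {0..<1::real})" by simp
    hence A': "A \<in> sets lebesgue" by (auto simp: sets_restrict_space)
    have "emeasure (distr (lebesgue_on unit_disc) (lebesgue_on {0..<1::real}) cmod) A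
       = emeasure lebesgue (cmod -` A \<inter> unit_disc)"
      using A by (subst emeasure_distr[OF meas]) (auto simp: emeasure_restrict_space space_restrict_space)
    also have "\<dots> = emeasure (density (lebesgue_on {0..<1}) (\<lambda>r. ennreal (2 * pi * r))) A"
      unfolding conjunct2[OF *[OF A']] using A
      by (subst emeasure_density)
         (auto simp: nn_integral_restrict_space indicator_def
           intro!: nn_integral_cong measurable_restrict_space1 measurable_completion)
    finally show "emeasure (distr (lebesgue_on unit_disc) (lebesgue_on {0..<1::real}) cmod) A
       = emeasure (density (lebesgue_on {0..<1}) (\<lambda>r. ennreal (2 * pi * r))) A" .
  qed auto
qed

section \<open>Invariance of Lebesgue measure under translation, reflection and rotation\<close>

lemma nn_integral_lborel_reflect:
  fixes f :: "'a::euclidean_space \<Rightarrow> ennreal"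
  assumes [measurable]: "f \<in> borel_measurable borel"
  shows "(\<integral>\<^sup>+y. f (t + y) \<partial>lborel) = (\<integral>\<^sup>+y. f y \<partial>lborel)"
    and "(\<integral>\<^sup>+y. f (t - y) \<partial>lborel) = (\<integral>\<^sup>+y. f y \<partial>lborel)"
proof -
  have 1: "lborel = distr lborel borel (\<lambda>x::'a. t + x)"
    using lborel_affine[of 1 t] by (simp add: density_1)
  show "(\<integral>\<^sup>+y. f (t + y) \<partial>lborel) = (\<integral>\<^sup>+y. f y \<partial>lborel)"
    by (subst (2) 1) (simp add: nn_integral_distr)
  have 2: "lborel = distr lborel borel (\<lambda>x::'a. t - x)"
    using lborel_affine[of "-1" t] by (simp add: density_1)
  show "(\<integral>\<^sup>+y. f (t - y) \<partial>lborel) = (\<integral>\<^sup>+y. f y \<partial>lborel)"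
    by (subst (2) 2) (simp add: nn_integral_distr)
qed

lemma nn_integral_lborel_rotate_indicator:
  fixes u :: complex
  assumes u: "cmod u = 1" and [measurable]: "A \<in> sets borel"
  shows "(\<integral>\<^sup>+x. indicator A (u * x) \<partial>lborel) = emeasure lborel A"
proof -
  \<comment> \<open>The disc serves as a rotation-invariant set of finite positive area, by which
    both sides are divided at the end.\<close>
  define D where "D = unit_disc"
  have [measurable]: "D \<in> sets borel" by (simp add: D_def)
  define IA ID :: "complex \<Rightarrow> ennreal" where "IA = indicator A" and "ID = indicator D"
  have [measurable]: "IA \<in> borel_measurable borel" "ID \<in> borel_measurable borel"
    by (auto simp: IA_def ID_def)
  have "u \<noteq> 0" using u by auto
  have ID: "ID (u * x) = ID x" for x
    using u by (simp add: ID_def D_def indicator_def norm_mult)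
  have D: "(\<integral>\<^sup>+y. ID y \<partial>lborel) = emeasure lborel D" by (simp add: ID_def)
  have A: "(\<integral>\<^sup>+y. IA y \<partial>lborel) = emeasure lborel A" by (simp add: IA_def)
  \<comment> \<open>Haar uniqueness: the double integral of \<open>IA (u * x) * ID (u * x + y)\<close> is computed in both orders.\<close>
  have "(\<integral>\<^sup>+x. IA (u * x) \<partial>lborel) * emeasure lborel D
      = (\<integral>\<^sup>+x. IA (u * x) * (\<integral>\<^sup>+y. ID (u * x + y) \<partial>lborel) \<partial>lborel)"
    by (simp add: nn_integral_lborel_reflect D nn_integral_multc)
  also have "\<dots> = (\<integral>\<^sup>+x. (\<integral>\<^sup>+y. IA (u * x) * ID (u * x + y) \<partial>lborel) \<partial>lborel)"
    by (simp add: nn_integral_cmult)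
  also have "\<dots> = (\<integral>\<^sup>+y. (\<integral>\<^sup>+x. IA (u * x) * ID (u * x + y) \<partial>lborel) \<partial>lborel)"
    by (rule lborel_pair.Fubini') measurable
  also have "\<dots> = (\<integral>\<^sup>+y. (\<integral>\<^sup>+x. IA (u * x - y) * ID (u * x) \<partial>lborel) \<partial>lborel)"
  proof (rule nn_integral_cong)
    fix y
    show "(\<integral>\<^sup>+x. IA (u * x) * ID (u * x + y) \<partial>lborel) = (\<integral>\<^sup>+x. IA (u * x - y) * ID (u * x) \<partial>lborel)"
      using \<open>u \<noteq> 0\<close>
      \<comment> \<open>Translating x by - y / u turns \<open>u * x\<close> into
        \<open>u * x - y\<close>.\<close>
      by (subst nn_integral_lborel_reflect(1)[of _ "- (y / u)", symmetric])
         (auto simp: algebra_simps)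
  qed
  also have "\<dots> = (\<integral>\<^sup>+x. (\<integral>\<^sup>+y. IA (u * x - y) * ID (u * x) \<partial>lborel) \<partial>lborel)"
    by (rule lborel_pair.Fubini') measurable
  also have "\<dots> = (\<integral>\<^sup>+x. emeasure lborel A * ID x \<partial>lborel)"
    by (simp add: nn_integral_multc nn_integral_lborel_reflect A ID)
  also have "\<dots> = emeasure lborel A * emeasure lborel D"
    by (simp add: nn_integral_cmult D)
  finally show ?thesis
    using pi_gt_zero
    by (auto simp: D_def emeasure_ball unit_ball_vol_2 IA_def mult_right_ennreal_cancel)
qed

lemma lborel_distr_mult_unit:
  fixes u :: complex
  assumes u: "cmod u = 1"
  shows "distr lborel borel (times u) = lborel"
proof (rule measure_eqI)
  fix A assume "A \<in> sets (distr lborel borel (times u))"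
  hence A[measurable]: "A \<in> sets borel" by simp
  have "emeasure (distr lborel borel (times u)) A = (\<integral>\<^sup>+x. indicator A (u * x) \<partial>lborel)"
    using nn_integral_distr[of "times u" lborel borel "indicator A"] by simp
  thus "emeasure (distr lborel borel (times u)) A = emeasure lborel A"
    using nn_integral_lborel_rotate_indicator[OF u A] by simp
qed simp

text \<open>A map that preserves \<open>lborel\<close> pulls null sets back to null sets, so it is
  measurable for the completion and preserves it too.\<close>

lemma rotate_measurable_lebesgue:
  fixes u :: complex
  assumes u: "cmod u = 1"
  shows "times u \<in> measurable lebesgue lebesgue"
    and "distr lebesgue lebesgue (times u) = lebesgue"
proof -
  have b: "times u \<in> measurable lebesgue lborel"
    by (intro measurable_completion) simp
  have d: "distr lebesgue lborel (times u) = lborel"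
    using lborel_distr_mult_unit[OF u] by (subst distr_completion) (auto cong: distr_cong)
  show "times u \<in> measurable lebesgue lebesgue"
    by (rule completion.measurable_completion2[OF b]) (simp add: d)
  show "distr lebesgue lebesgue (times u) = lebesgue"
    using completion.completion_distr_eq[OF b] by (simp add: d)
qed

text \<open>Stands in for integration over circles: it is the source of
  \<open>integral_disc_monomial_orthogonal\<close>.\<close>

lemma integral_disc_rotate:
  fixes F :: "complex \<Rightarrow> complex"
  assumes u: "cmod u = 1" and F: "F \<in> borel_measurable (lebesgue_on unit_disc)"
  shows "integral\<^sup>L (lebesgue_on unit_disc) (\<lambda>z. F (u * z)) = integral\<^sup>L (lebesgue_on unit_disc) F"
proof -
  define G where "G z = indicator unit_disc z *\<^sub>R F z" for z
  have G: "G \<in> borel_measurable lebesgue"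
    using F unfolding G_def by (subst (asm) borel_measurable_restrict_space_iff) auto
  have "integral\<^sup>L (lebesgue_on unit_disc) (\<lambda>z. F (u * z)) = integral\<^sup>L lebesgue (\<lambda>z. G (u * z))"
    using u by (subst integral_restrict_space) (auto simp: G_def indicator_def norm_mult)
  also have "\<dots> = integral\<^sup>L (distr lebesgue lebesgue (times u)) G"
    using G rotate_measurable_lebesgue(1)[OF u] by (subst integral_distr) auto
  also have "\<dots> = integral\<^sup>L (lebesgue_on unit_disc) F"
    unfolding rotate_measurable_lebesgue(2)[OF u] by (subst integral_restrict_space) (auto simp: G_def cong: Bochner_Integration.integral_cong)
  finally show ?thesis .
qed

section \<open>Moments and tails of radial weights\<close>

text \<open>One finite measure carries both notions: tails are its values on intervals
  \<open>{r..<1}\<close>, moments its integrals of powers. Restricting to \<open>{0..<1}\<close>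
  discards the unspecified values of the profile.\<close>

definition weight_measure :: "(real \<Rightarrow> real) \<Rightarrow> real measure" where
  "weight_measure \<omega> = density (lebesgue_on {0..<1}) (\<lambda>r. ennreal (\<omega> r))"

text \<open>The real-valued counterpart of \<open>moment\<close>; the two agree for radial weights
  and nonnegative orders (\<open>moment_eq_ennreal\<close>).\<close>

definition real_moment :: "(real \<Rightarrow> real) \<Rightarrow> real \<Rightarrow> real" where
  "real_moment \<omega> x = (\<integral>r. r powr x \<partial>weight_measure \<omega>)"

lemma space_weight_measure [simp]: "space (weight_measure \<omega>) = {0..<1}"
  by (simp add: weight_measure_def space_restrict_space)

lemma sets_weight_measure [simp]: "sets (weight_measure \<omega>) = sets (lebesgue_on {0..<1})"
  by (simp add: weight_measure_def)

lemma borel_measurable_lebesgue_on: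
  "h \<in> borel_measurable borel \<Longrightarrow> h \<in> borel_measurable (lebesgue_on S)"
  by (intro measurable_restrict_space1 measurable_completion) simp

lemma borel_measurable_weight_measure:
  "h \<in> borel_measurable borel \<Longrightarrow> h \<in> borel_measurable (weight_measure \<omega>)"
  using borel_measurable_lebesgue_on[of h "{0..<1}"]
  by (simp only: measurable_cong_sets[OF sets_weight_measure refl])

lemma radial_weight_measurable:
  assumes "radial_weight \<omega>"
  shows "\<omega> \<in> borel_measurable (lebesgue_on {0..<1})"
proof -
  have "set_integrable lebesgue {0..<1} \<omega>" using assms by (simp add: radial_weight_def)
  hence "integrable (lebesgue_on {0..<1}) \<omega>"
    by (subst integrable_restrict_space) (auto simp: set_integrable_def)
  thus ?thesis by auto
qed

lemma radial_weight_nonneg: "radial_weight \<omega> \<Longrightarrow> 0 \<le> r \<Longrightarrow> r < 1 \<Longrightarrow> 0 \<le> \<omega> r"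
  by (simp add: radial_weight_def)

lemma tail_pos: "radial_weight \<omega> \<Longrightarrow> 0 \<le> r \<Longrightarrow> r < 1 \<Longrightarrow> 0 < tail \<omega> r"
  by (simp add: radial_weight_def)

lemma nn_integral_weight_measure:
  assumes "radial_weight \<omega>" "h \<in> borel_measurable (lebesgue_on {0..<1})"
  shows "(\<integral>\<^sup>+r. h r \<partial>weight_measure \<omega>) = (\<integral>\<^sup>+r. ennreal (\<omega> r) * h r \<partial>lebesgue_on {0..<1})"
  unfolding weight_measure_def using assms radial_weight_measurable[OF assms(1)]
  by (subst nn_integral_density) auto

lemma nn_integral_subinterval:
  fixes \<omega> :: "real \<Rightarrow> real"
  assumes "0 \<le> r"
  shows "(\<integral>\<^sup>+s\<in>{r..<1}. ennreal (\<omega> s) \<partial>lebesgue) = (\<integral>\<^sup>+s. ennreal (\<omega> s) * indicator {r..<1} s \<partial>lebesgue_on {0..<1})"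
  using assms by (subst nn_integral_restrict_space)
    (auto intro!: nn_integral_cong simp: indicator_def)

lemma ennreal_tail:
  assumes "radial_weight \<omega>" "0 \<le> r" "r < 1"
  shows "ennreal (tail \<omega> r) = (\<integral>\<^sup>+s\<in>{r..<1}. ennreal (\<omega> s) \<partial>lebesgue)"
proof -
  have "set_integrable lebesgue {0..<1} \<omega>" using assms by (simp add: radial_weight_def)
  hence "set_integrable lebesgue {r..<1} \<omega>" by (rule set_integrable_subset) (use assms in auto)
  moreover have "AE s in lebesgue. 0 \<le> indicator {r..<1} s *\<^sub>R \<omega> s"
    using assms by (auto simp: indicator_def radial_weight_def)
  ultimately have "ennreal (tail \<omega> r) = (\<integral>\<^sup>+s. ennreal (indicator {r..<1} s *\<^sub>R \<omega> s) \<partial>lebesgue)"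
    unfolding tail_def set_lebesgue_integral_def set_integrable_def
    by (intro nn_integral_eq_integral[symmetric]) auto
  also have "\<dots> = (\<integral>\<^sup>+s\<in>{r..<1}. ennreal (\<omega> s) \<partial>lebesgue)"
    by (intro nn_integral_cong) (auto simp: indicator_def)
  finally show ?thesis .
qed

lemma emeasure_weight_measure_Ico:
  assumes "radial_weight \<omega>" "0 \<le> r" "r < 1"
  shows "emeasure (weight_measure \<omega>) {r..<1} = ennreal (tail \<omega> r)"
proof -
  have "{r..<1} \<in> sets (lebesgue_on {0..<1})"
    using assms by (subst sets_restrict_space_iff) auto
  thus ?thesis
    unfolding ennreal_tail[OF assms] nn_integral_subinterval[OF assms(2)] weight_measure_def
    using radial_weight_measurable[OF assms(1)] by (subst emeasure_density) auto
qed

lemma finite_measure_weight_measure: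
  "radial_weight \<omega> \<Longrightarrow> finite_measure (weight_measure \<omega>)"
  by (intro finite_measureI) (use emeasure_weight_measure_Ico[of \<omega> 0] in simp)

lemma tail_eq_measure:
  assumes "radial_weight \<omega>" "0 \<le> r" "r < 1"
  shows "tail \<omega> r = measure (weight_measure \<omega>) {r..<1}"
  unfolding measure_def emeasure_weight_measure_Ico[OF assms]
  using tail_pos[OF assms] by (intro enn2real_ennreal[symmetric]) simp

lemma integrable_weight_measure:
  fixes h :: "real \<Rightarrow> real"
  assumes "radial_weight \<omega>" "h \<in> borel_measurable borel" "\<And>r. 0 \<le> r \<Longrightarrow> r < 1 \<Longrightarrow> \<bar>h r\<bar> \<le> B"
  shows "integrable (weight_measure \<omega>) h"
proof -
  interpret finite_measure "weight_measure \<omega>" by (rule finite_measure_weight_measure) fact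
  show ?thesis
    by (rule integrable_const_bound[where B=B])
       (use assms(3) borel_measurable_weight_measure[OF assms(2), of \<omega>] in auto)
qed

lemma integrable_powr:
  "radial_weight \<omega> \<Longrightarrow> 0 \<le> x \<Longrightarrow> integrable (weight_measure \<omega>) (\<lambda>r. r powr x)"
  by (rule integrable_weight_measure[where B=1]) (auto simp: powr_le1)

lemma integrable_indicator_Ico:
  "radial_weight \<omega> \<Longrightarrow> integrable (weight_measure \<omega>) (indicat_real {t..<1})"
  by (rule integrable_weight_measure[where B=1]) (auto simp: indicator_def)

lemma moment_eq_nn_integral:
  assumes "radial_weight \<omega>"
  shows "moment \<omega> x = (\<integral>\<^sup>+r. ennreal (r powr x) \<partial>weight_measure \<omega>)"
proof -
  have "(\<integral>\<^sup>+r. ennreal (r powr x) \<partial>weight_measure \<omega>)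
      = (\<integral>\<^sup>+r. ennreal (\<omega> r) * ennreal (r powr x) \<partial>lebesgue_on {0..<1})"
    by (intro nn_integral_weight_measure assms borel_measurable_lebesgue_on) auto
  also have "\<dots> = moment \<omega> x"
    unfolding moment_def
    by (subst nn_integral_restrict_space)
       (auto intro!: nn_integral_cong simp: indicator_def ennreal_mult' mult.commute radial_weight_nonneg[OF assms])
  finally show ?thesis ..
qed

lemma moment_eq_ennreal:
  assumes "radial_weight \<omega>" "0 \<le> x"
  shows "moment \<omega> x = ennreal (real_moment \<omega> x)"
  unfolding moment_eq_nn_integral[OF assms(1)] real_moment_def
  by (intro nn_integral_eq_integral integrable_powr assms) auto

lemma real_moment_nonneg: "0 \<le> real_moment \<omega> x"
  unfolding real_moment_def by (intro integral_nonneg_AE) auto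

lemma real_moment_antimono:
  assumes "radial_weight \<omega>" "0 \<le> x" "x \<le> y"
  shows "real_moment \<omega> y \<le> real_moment \<omega> x"
  unfolding real_moment_def
  using assms by (intro integral_mono integrable_powr) (auto intro!: powr_mono')

text \<open>Markov's inequality: on \<open>{r..<1}\<close> the integrand \<open>s powr x\<close> is
  at least \<open>r powr x\<close>.\<close>

lemma powr_mult_tail_le_real_moment:
  assumes "radial_weight \<omega>" "0 \<le> x" "0 \<le> r" "r < 1"
  shows "r powr x * tail \<omega> r \<le> real_moment \<omega> x"
proof -
  have le: "r powr x * indicat_real {r..<1} s \<le> s powr x" for s
    using assms by (cases "s \<in> {r..<1}") (simp_all add: powr_mono2)
  have "measure (weight_measure \<omega>) {r..<1} = (\<integral>s. indicator {r..<1} s \<partial>weight_measure \<omega>)"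
    using assms by (simp add: Int_absorb1)
  hence "r powr x * tail \<omega> r = (\<integral>s. r powr x * indicator {r..<1} s \<partial>weight_measure \<omega>)"
    using assms by (simp only: tail_eq_measure integral_mult_right_zero)
  also have "\<dots> \<le> real_moment \<omega> x"
    unfolding real_moment_def using assms le
    by (intro integral_mono integrable_powr integrable_mult_right integrable_indicator_Ico)
  finally show ?thesis .
qed

text \<open>Cut at t: above it \<open>s powr x\<close> is at most 1, below it the part x - y of the
  exponent is spent on the factor \<open>t powr (x - y)\<close>. This factor is exponentially small
  when (1 - t) (x - y) is large, which both arguments about \<open>D_hat\<close> below
  exploit.\<close>

lemma real_moment_le_tail_plus:
  assumes "radial_weight \<omega>" "0 \<le> y" "y \<le> x" "0 \<le> t" "t < 1"
  shows "real_moment \<omega> x \<le> tail \<omega> t + t powr (x - y) * real_moment \<omega> y"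
proof -
  have int: "integrable (weight_measure \<omega>) (\<lambda>s. indicator {t..<1} s :: real)"
    by (rule integrable_indicator_Ico) fact
  have le: "s powr x \<le> indicator {t..<1} s + t powr (x - y) * s powr y" if "0 \<le> s" "s < 1" for s
  proof (cases "t \<le> s")
    case True
    have "s powr x \<le> 1" using that assms by (intro powr_le1) auto
    thus ?thesis using True that by (simp add: add_increasing2)
  next
    case False
    have "s powr x = s powr (x - y) * s powr y" by (simp flip: powr_add)
    also have "\<dots> \<le> t powr (x - y) * s powr y"
      using False that assms by (intro mult_right_mono powr_mono2) auto
    finally show ?thesis using False by simp
  qed
  have "real_moment \<omega> x \<le> (\<integral>s. indicator {t..<1} s + t powr (x - y) * s powr y \<partial>weight_measure \<omega>)"
    unfolding real_moment_def using assms le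
    by (intro integral_mono integrable_powr Bochner_Integration.integrable_add int integrable_mult_right) auto
  also have "\<dots> = (\<integral>s. indicator {t..<1} s \<partial>weight_measure \<omega>) + (\<integral>s. t powr (x - y) * s powr y \<partial>weight_measure \<omega>)"
    using assms by (intro Bochner_Integration.integral_add int integrable_mult_right integrable_powr)
  also have "(\<integral>s. indicator {t..<1} s \<partial>weight_measure \<omega>) = measure (weight_measure \<omega>) {t..<1}"
    using assms by (simp add: Int_absorb1)
  also have "\<dots> = tail \<omega> t" using assms by (simp only: tail_eq_measure)
  finally show ?thesis by (simp only: real_moment_def integral_mult_right_zero)
qed

lemma tail_antimono:
  assumes "radial_weight \<omega>" "0 \<le> r" "r \<le> s" "s < 1"
  shows "tail \<omega> s \<le> tail \<omega> r"
proof -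
  interpret finite_measure "weight_measure \<omega>" by (rule finite_measure_weight_measure) fact
  have "{r..<1} \<in> sets (lebesgue_on {0..<1})"
    using assms by (subst sets_restrict_space_iff) auto
  hence "measure (weight_measure \<omega>) {s..<1} \<le> measure (weight_measure \<omega>) {r..<1}"
    using assms by (intro finite_measure_mono) auto
  thus ?thesis using assms by (simp only: tail_eq_measure[OF assms(1)] order_trans[OF assms(2,3)] le_less_trans[OF assms(3,4)])
qed

lemma real_moment_pos:
  assumes "radial_weight \<omega>" "0 \<le> x"
  shows "0 < real_moment \<omega> x"
proof -
  have "0 < (1/2) powr x * tail \<omega> (1/2)" using tail_pos[OF assms(1), of "1/2"] by simp
  also have "\<dots> \<le> real_moment \<omega> x"
    using assms by (intro powr_mult_tail_le_real_moment) auto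
  finally show ?thesis .
qed

lemma real_moment_le_tail_0:
  assumes "radial_weight \<omega>" "0 \<le> x"
  shows "real_moment \<omega> x \<le> tail \<omega> 0"
  using real_moment_le_tail_plus[of \<omega> x x 0] assms by simp

lemma powr_one_minus_le_exp:
  fixes s y :: real
  assumes "0 \<le> s" "s \<le> 1" "0 \<le> y"
  shows "(1 - s) powr y \<le> exp (- (s * y))"
proof (cases "s = 1")
  case False
  have "y * ln (1 - s) \<le> y * (- s)"
    using False assms ln_le_minus_one[of "1 - s"] by (intro mult_left_mono) auto
  thus ?thesis using False assms by (simp add: powr_def mult.commute)
qed auto

text \<open>The constant comes from ln (1 - s) >= - s - 2 s^2 >= - 2 s with s = 1 / x <= 1 /
  2.\<close>

lemma exp_le_powr_one_minus:
  fixes x :: real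
  assumes "x \<ge> 2"
  shows "exp (- 2) \<le> (1 - 1 / x) powr x"
proof -
  have "- (1/x) - 2 * (1/x)\<^sup>2 \<le> ln (1 - 1/x)"
    using assms by (intro ln_one_minus_pos_lower_bound) auto
  moreover have "2 * (1/x)\<^sup>2 \<le> 1/x"
    using assms by (simp add: power2_eq_square field_simps)
  ultimately have "- 2 / x \<le> ln (1 - 1/x)" by simp
  hence "x * (- 2 / x) \<le> x * ln (1 - 1/x)" using assms by (intro mult_left_mono) auto
  hence "- 2 \<le> x * ln (1 - 1/x)" using assms by simp
  thus ?thesis using assms by (simp add: powr_def)
qed

text \<open>The half of the comparison of moments with tails that holds for every radial weight; the
  other half, \<open>D_hat_real_moment_le_tail\<close>, rests on doubling.\<close>

lemma tail_le_real_moment: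
  assumes "radial_weight \<omega>" "x \<ge> 2"
  shows "tail \<omega> (1 - 1 / x) \<le> exp 2 * real_moment \<omega> x"
proof -
  have T: "0 < tail \<omega> (1 - 1 / x)" using assms by (intro tail_pos) auto
  have "exp (- 2) * tail \<omega> (1 - 1 / x) \<le> (1 - 1 / x) powr x * tail \<omega> (1 - 1 / x)"
    using exp_le_powr_one_minus[OF assms(2)] T by (intro mult_right_mono) auto
  also have "\<dots> \<le> real_moment \<omega> x"
    using assms by (intro powr_mult_tail_le_real_moment) auto
  finally show ?thesis by (simp add: exp_minus field_simps)
qed

section \<open>Doubling of tails and doubling of moments\<close>

lemma D_hat_imp_radial_weight: "\<omega> \<in> D_hat \<Longrightarrow> radial_weight \<omega>"
  by (simp add: D_hat_def)

text \<open>The definition controls only radii near 1. On the remaining interval tails lie between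
  two positive constants, and their ratio is absorbed by enlarging the constant.\<close>

lemma D_hat_doubling:
  assumes "\<omega> \<in> D_hat"
  obtains C where "C \<ge> 1" "\<And>r. 0 \<le> r \<Longrightarrow> r < 1 \<Longrightarrow> tail \<omega> r \<le> C * tail \<omega> ((1 + r) / 2)"
proof -
  have w: "radial_weight \<omega>" using assms by (rule D_hat_imp_radial_weight)
  from assms obtain C where C: "C > 0" "\<forall>\<^sub>F r in at_left 1. tail \<omega> r \<le> C * tail \<omega> ((1 + r) / 2)"
    by (auto simp: D_hat_def)
  then obtain b where b: "b < 1" "\<And>r. b < r \<Longrightarrow> r < 1 \<Longrightarrow> tail \<omega> r \<le> C * tail \<omega> ((1 + r) / 2)"
    unfolding eventually_at_left_field by blast
  define b' where "b' = max b 0"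
  define D where "D = max 1 (max C (tail \<omega> 0 / tail \<omega> ((1 + b') / 2)))"
  have b': "0 \<le> b'" "b' < 1" using b by (auto simp: b'_def)
  have "tail \<omega> r \<le> D * tail \<omega> ((1 + r) / 2)" if r: "0 \<le> r" "r < 1" for r
  proof -
    have pos: "tail \<omega> ((1 + r) / 2) > 0" "tail \<omega> ((1 + b') / 2) > 0"
      using r b' by (auto intro!: tail_pos[OF w])
    show ?thesis
    proof (cases "b < r")
      case True
      have "tail \<omega> r \<le> C * tail \<omega> ((1 + r) / 2)" using b True r by auto
      also have "\<dots> \<le> D * tail \<omega> ((1 + r) / 2)"
        using pos by (intro mult_right_mono) (auto simp: D_def)
      finally show ?thesis .
    next
      case False
      have "tail \<omega> r \<le> tail \<omega> 0" using r by (intro tail_antimono[OF w]) auto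
      also have "\<dots> = (tail \<omega> 0 / tail \<omega> ((1 + b') / 2)) * tail \<omega> ((1 + b') / 2)" using pos by simp
      also have "\<dots> \<le> D * tail \<omega> ((1 + r) / 2)"
        using False r b' pos by (intro mult_mono tail_antimono[OF w]) (auto simp: D_def b'_def)
      finally show ?thesis .
    qed
  qed
  thus ?thesis using that[of D] by (auto simp: D_def)
qed

text \<open>Passing from r to (1 + r) / 2 halves the distance to 1, so n steps bring the distance
  from 2^n / x down to 1 / x.\<close>

lemma tail_doubling_iterate:
  assumes C: "C \<ge> 1" "\<And>r. 0 \<le> r \<Longrightarrow> r < 1 \<Longrightarrow> tail \<omega> r \<le> C * tail \<omega> ((1 + r) / 2)"
  shows "x > 0 \<Longrightarrow> 2 ^ n \<le> x \<Longrightarrow> tail \<omega> (1 - 2 ^ n / x) \<le> C ^ n * tail \<omega> (1 - 1 / x)"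
proof (induction n)
  case (Suc n)
  have "tail \<omega> (1 - 2 ^ Suc n / x) \<le> C * tail \<omega> ((1 + (1 - 2 ^ Suc n / x)) / 2)"
    using Suc.prems by (intro C) auto
  also have "(1 + (1 - 2 ^ Suc n / x)) / 2 = 1 - 2 ^ n / x" by simp
  also have "C * tail \<omega> (1 - 2 ^ n / x) \<le> C * (C ^ n * tail \<omega> (1 - 1 / x))"
    using C(1) Suc by (intro mult_left_mono Suc.IH) auto
  finally show ?case by (simp add: mult_ac)
qed auto

text \<open>With \<open>R x\<close> the quotient of \<open>real_moment \<omega> x\<close> by \<open>tail \<omega> (1 - 1 / x)\<close>, cutting the moment integral at
  \<open>1 - K / x\<close> for a large power \<open>K = 2 ^ j\<close> gives \<open>R x \<le> C ^ j + R (x / 2) / 2\<close>, which bounds \<open>R\<close> by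
  induction on the dyadic scale of \<open>x\<close>.\<close>

lemma D_hat_real_moment_le_tail:
  assumes "\<omega> \<in> D_hat"
  obtains B where "B > 0" "\<And>x. x \<ge> 1 \<Longrightarrow> real_moment \<omega> x \<le> B * tail \<omega> (1 - 1 / x)"
proof -
  have w: "radial_weight \<omega>" using assms by (rule D_hat_imp_radial_weight)
  obtain C where C: "C \<ge> 1" "\<And>r. 0 \<le> r \<Longrightarrow> r < 1 \<Longrightarrow> tail \<omega> r \<le> C * tail \<omega> ((1 + r) / 2)"
    using D_hat_doubling[OF assms] by blast
  \<comment> \<open>K = 2 ^ j must be so large that the gain exp (- K / 2) from the cut outweighs
    the factor C lost when the tail for x / 2 is replaced by the tail for x.\<close>
  have "(\<lambda>j::nat. C * exp (- (2 ^ j / 2))) \<longlonglongrightarrow> 0" by real_asymp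
  hence "\<forall>\<^sub>F j in sequentially. C * exp (- (2 ^ j / 2)) < 1/2" by (rule order_tendstoD) simp
  moreover have "\<forall>\<^sub>F j in sequentially. j \<ge> (1::nat)" by (rule eventually_ge_at_top)
  ultimately have "\<forall>\<^sub>F j in sequentially. C * exp (- (2 ^ j / 2)) < 1/2 \<and> j \<ge> 1"
    by (rule eventually_conj)
  then obtain j :: nat where j: "C * exp (- (2 ^ j / 2)) < 1/2" "j \<ge> 1"
    using eventually_happens'[OF sequentially_bot] by blast
  define K where "K = (2::real) ^ j"
  have K: "K \<ge> 2" using j power_increasing[of 1 j "2::real"] by (simp add: K_def)
  \<comment> \<open>Start of the induction: for x <= K the moment is at most
    \<open>tail \<omega> 0\<close> and the tail at least
    \<open>tail \<omega> (1 - 1 / K)\<close>.\<close>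
  define B0 where "B0 = tail \<omega> 0 / tail \<omega> (1 - 1 / K)"
  define B where "B = max (2 * C ^ j) B0"
  have Tpos: "tail \<omega> (1 - 1 / x) > 0" if "x \<ge> 1" for x using that by (intro tail_pos[OF w]) auto
  have B: "B > 0" "2 * C ^ j \<le> B" "B0 \<le> B" using C by (auto simp: B_def less_max_iff_disj)
  have main: "real_moment \<omega> x \<le> B * tail \<omega> (1 - 1 / x)" if "x \<ge> 1" "x \<le> 2 ^ n * K" for x n
    using that
  proof (induction n arbitrary: x)
    case 0
    have "real_moment \<omega> x \<le> tail \<omega> 0" using 0 by (intro real_moment_le_tail_0[OF w]) auto
    also have "\<dots> = B0 * tail \<omega> (1 - 1 / K)" using Tpos[of K] K by (simp add: B0_def)
    also have "\<dots> \<le> B * tail \<omega> (1 - 1 / x)"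
      using 0 K B Tpos[of K] by (intro mult_mono tail_antimono[OF w]) (auto simp: field_simps)
    finally show ?case .
  next
    case (Suc n)
    show ?case
    proof (cases "x \<le> 2 ^ n * K")
      case True thus ?thesis using Suc by auto
    next
      case False
      have "1 * K \<le> 2 ^ n * K" using K by (intro mult_right_mono) auto
      hence xK: "x \<ge> K" using False by simp
      have "real_moment \<omega> x \<le> tail \<omega> (1 - K / x) + (1 - K / x) powr (x - x / 2) * real_moment \<omega> (x / 2)"
        using xK K by (intro real_moment_le_tail_plus[OF w]) auto
      also have "\<dots> \<le> C ^ j * tail \<omega> (1 - 1 / x) + exp (- (K / 2)) * (B * (C * tail \<omega> (1 - 1 / x)))"
      proof (intro add_mono mult_mono)
        show "tail \<omega> (1 - K / x) \<le> C ^ j * tail \<omega> (1 - 1 / x)"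
          unfolding K_def using xK K by (intro tail_doubling_iterate[OF C]) (auto simp: K_def)
        have "(1 - K / x) powr (x / 2) \<le> exp (- (K / x * (x / 2)))"
          using xK K by (intro powr_one_minus_le_exp) auto
        thus "(1 - K / x) powr (x - x / 2) \<le> exp (- (K / 2))" using xK K by simp
        have "real_moment \<omega> (x / 2) \<le> B * tail \<omega> (1 - 1 / (x / 2))"
          using Suc xK K by (intro Suc.IH) auto
        also have "tail \<omega> (1 - 1 / (x / 2)) \<le> C * tail \<omega> (1 - 1 / x)"
          using tail_doubling_iterate[OF C, of x 1] xK K by simp
        finally show "real_moment \<omega> (x / 2) \<le> B * (C * tail \<omega> (1 - 1 / x))" using B by simp
      qed (auto simp: real_moment_nonneg)
      also have "\<dots> = (C ^ j + C * exp (- (K / 2)) * B) * tail \<omega> (1 - 1 / x)"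
        by (simp add: algebra_simps)
      also have "\<dots> \<le> (B / 2 + 1 / 2 * B) * tail \<omega> (1 - 1 / x)"
        using B j Tpos[of x] xK K by (intro mult_right_mono add_mono) (auto simp: K_def)
      finally show ?thesis by simp
    qed
  qed
  show ?thesis
  proof (rule that[OF B(1)])
    fix x :: real assume "x \<ge> 1"
    obtain n where n: "x < 2 ^ n" using real_arch_pow[of 2 x] by auto
    have "(2::real) ^ n * 1 \<le> 2 ^ n * K" using K by (intro mult_left_mono) auto
    with n main[OF \<open>x \<ge> 1\<close>, of n] show "real_moment \<omega> x \<le> B * tail \<omega> (1 - 1 / x)" by simp
  qed
qed

text \<open>The range up to 4 x + 3 is dictated by \<open>kernel_diff_coeff_square_sum\<close>,
  which compares the orders n / 2 and 2 n + 3; the other uses stay within it.\<close>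

lemma D_hat_real_moment_doubling:
  assumes "\<omega> \<in> D_hat"
  obtains B where "B > 0" "\<And>x y. x \<ge> 0 \<Longrightarrow> 0 \<le> y \<Longrightarrow> y \<le> 4 * x + 3 \<Longrightarrow> real_moment \<omega> x \<le> B * real_moment \<omega> y"
proof -
  have w: "radial_weight \<omega>" using assms by (rule D_hat_imp_radial_weight)
  obtain C where C: "C \<ge> 1" "\<And>r. 0 \<le> r \<Longrightarrow> r < 1 \<Longrightarrow> tail \<omega> r \<le> C * tail \<omega> ((1 + r) / 2)"
    using D_hat_doubling[OF assms] by blast
  obtain B where B: "B > 0" "\<And>x. x \<ge> 1 \<Longrightarrow> real_moment \<omega> x \<le> B * tail \<omega> (1 - 1 / x)"
    using D_hat_real_moment_le_tail[OF assms] by blast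
  have pos: "real_moment \<omega> x > 0" if "x \<ge> 0" for x using real_moment_pos[OF w that] .
  \<comment> \<open>For x >= 1 three doublings lead from 1 - 1 / x to 1 - 1 / (8 x), and 8 x exceeds
    4 x + 3. For x < 1 the order y stays below 7, so a fixed ratio of moments suffices.\<close>
  define D where "D = max (B * (C ^ 3 * exp 2)) (real_moment \<omega> 0 / real_moment \<omega> 7)"
  show ?thesis
  proof (rule that[of D])
    show "D > 0" using B C by (auto simp: D_def less_max_iff_disj intro!: mult_pos_pos)
    fix x y :: real assume x: "x \<ge> 0" and y: "0 \<le> y" "y \<le> 4 * x + 3"
    show "real_moment \<omega> x \<le> D * real_moment \<omega> y"
    proof (cases "x \<ge> 1")
      case True
      have "real_moment \<omega> x \<le> B * tail \<omega> (1 - 1 / x)" using B True by auto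
      also have "tail \<omega> (1 - 1 / x) \<le> C ^ 3 * tail \<omega> (1 - 1 / (8 * x))"
        using tail_doubling_iterate[OF C, of "8 * x" 3] True by simp
      also have "tail \<omega> (1 - 1 / (8 * x)) \<le> exp 2 * real_moment \<omega> (8 * x)"
        using True by (intro tail_le_real_moment[OF w]) auto
      also have "real_moment \<omega> (8 * x) \<le> real_moment \<omega> y"
        using True x y by (intro real_moment_antimono[OF w]) auto
      finally have "real_moment \<omega> x \<le> B * (C ^ 3 * exp 2) * real_moment \<omega> y"
        using B C by (simp add: mult_ac)
      also have "\<dots> \<le> D * real_moment \<omega> y"
        using pos[OF y(1)] by (intro mult_right_mono) (auto simp: D_def)
      finally show ?thesis .
    next
      case False
      have "real_moment \<omega> x \<le> real_moment \<omega> 0" using x by (intro real_moment_antimono[OF w]) auto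
      also have "\<dots> = (real_moment \<omega> 0 / real_moment \<omega> 7) * real_moment \<omega> 7" using pos[of 7] by simp
      also have "\<dots> \<le> D * real_moment \<omega> y"
        using False pos[of 7] y pos[of 0] by (intro mult_mono real_moment_antimono[OF w]) (auto simp: D_def le_max_iff_disj)
      finally show ?thesis .
    qed
  qed
qed

text \<open>After \<open>m\<close> iterations of the hypothesis, the part of the moment below \<open>(1 + r) / 2\<close> is so small that it
  can be absorbed into the left-hand side.\<close>

lemma D_hatI_real_moment:
  assumes w: "radial_weight \<omega>" and C: "\<And>x. x \<ge> 0 \<Longrightarrow> real_moment \<omega> x \<le> C * real_moment \<omega> (3 / 2 * x)"
  shows "\<omega> \<in> D_hat"
proof -
  define D where "D = max C 2"
  have D: "D \<ge> 2" "\<And>x. x \<ge> 0 \<Longrightarrow> real_moment \<omega> x \<le> D * real_moment \<omega> (3 / 2 * x)"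
  proof -
    fix x :: real assume "x \<ge> 0"
    have "real_moment \<omega> x \<le> C * real_moment \<omega> (3 / 2 * x)" using C \<open>x \<ge> 0\<close> .
    also have "\<dots> \<le> D * real_moment \<omega> (3 / 2 * x)"
      by (intro mult_right_mono) (auto simp: D_def real_moment_nonneg)
    finally show "real_moment \<omega> x \<le> D * real_moment \<omega> (3 / 2 * x)" .
  qed (auto simp: D_def)
  have it: "real_moment \<omega> x \<le> D ^ m * real_moment \<omega> ((3 / 2) ^ m * x)" if "x \<ge> 0" for x m
  proof (induction m)
    case (Suc m)
    note Suc.IH
    also have "D ^ m * real_moment \<omega> ((3 / 2) ^ m * x) \<le> D ^ m * (D * real_moment \<omega> (3 / 2 * ((3 / 2) ^ m * x)))"
      using D that by (intro mult_left_mono D) auto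
    finally show ?case by (simp add: mult_ac)
  qed auto
  \<comment> \<open>The exponent (3 / 2) ^ m grows geometrically in m, so the exponential beats D ^
    m for every value of D.\<close>
  have "(\<lambda>m::nat. D ^ m * exp (- (((3 / 2) ^ m - 1) / 2))) \<longlonglongrightarrow> 0" using D(1) by real_asymp
  hence "\<forall>\<^sub>F m in sequentially. D ^ m * exp (- (((3 / 2) ^ m - 1) / 2)) < 1/2" by (rule order_tendstoD) simp
  then obtain m :: nat where m: "D ^ m * exp (- (((3 / 2) ^ m - 1) / 2)) < 1/2"
    by (auto simp: eventually_sequentially)
  have ge1: "1 \<le> (3 / 2 :: real) ^ m" by simp
  have bound: "tail \<omega> r \<le> exp 2 * (2 * D ^ m) * tail \<omega> ((1 + r) / 2)" if r: "1/2 < r" "r < 1" for r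
  proof -
    \<comment> \<open>Then r = 1 - 1 / x, and the cut point (1 + r) / 2 is 1 - 1 / (2 x); r > 1 / 2
      provides the x >= 2 asked for by \<open>tail_le_real_moment\<close>.\<close>
    define x where "x = 1 / (1 - r)"
    have x: "x \<ge> 2" "r = 1 - 1 / x" using r by (auto simp: x_def field_simps)
    have r01: "0 \<le> (1 + r) / 2" "(1 + r) / 2 < 1" using r by auto
    have t: "(1 + r) / 2 = 1 - 1 / (2 * x)" using x by (simp add: field_simps)
    have le: "x \<le> (3 / 2) ^ m * x" using ge1 x mult_right_mono[of 1 "(3 / 2) ^ m" x] by simp
    have M: "real_moment \<omega> x > 0" using x by (intro real_moment_pos[OF w]) auto
    have "real_moment \<omega> x \<le> D ^ m * real_moment \<omega> ((3 / 2) ^ m * x)" using it x by auto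
    also have "real_moment \<omega> ((3 / 2) ^ m * x) \<le> tail \<omega> ((1 + r) / 2) +
      ((1 + r) / 2) powr ((3 / 2) ^ m * x - x) * real_moment \<omega> x"
      using x(1) r01 le by (intro real_moment_le_tail_plus[OF w]) auto
    also have "((1 + r) / 2) powr ((3 / 2) ^ m * x - x) \<le> exp (- (1 / (2 * x) * ((3 / 2) ^ m * x - x)))"
      unfolding t using x le by (intro powr_one_minus_le_exp) auto
    also have "1 / (2 * x) * ((3 / 2) ^ m * x - x) = ((3 / 2) ^ m - 1) / 2"
      using x by (simp add: field_simps)
    finally have "real_moment \<omega> x \<le> D ^ m * (tail \<omega> ((1 + r) / 2)
        + exp (- (((3 / 2) ^ m - 1) / 2)) * real_moment \<omega> x)"
      using D M by simp
    also have "\<dots> = D ^ m * tail \<omega> ((1 + r) / 2) + (D ^ m * exp (- (((3 / 2) ^ m - 1) / 2))) * real_moment \<omega> x"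
      by (simp add: algebra_simps)
    also have "\<dots> \<le> D ^ m * tail \<omega> ((1 + r) / 2) + 1/2 * real_moment \<omega> x"
      using m M by (intro add_left_mono mult_right_mono) auto
    finally have *: "real_moment \<omega> x \<le> 2 * D ^ m * tail \<omega> ((1 + r) / 2)" by simp
    have "tail \<omega> r \<le> exp 2 * real_moment \<omega> x"
      using tail_le_real_moment[OF w x(1)] x(2) by simp
    also note *
    finally show ?thesis by (simp add: mult_ac)
  qed
  have "\<forall>\<^sub>F r in at_left 1. tail \<omega> r \<le> exp 2 * (2 * D ^ m) * tail \<omega> ((1 + r) / 2)"
    unfolding eventually_at_left_field using bound by (intro exI[of _ "1/2"]) auto
  moreover have "exp 2 * (2 * D ^ m) > 0" using D by auto
  ultimately show ?thesis using w unfolding D_hat_def by blast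
qed

section \<open>The moment condition and the tail condition\<close>

abbreviation (input) weight_quotient :: "(real \<Rightarrow> real) \<Rightarrow> (real \<Rightarrow> real) \<Rightarrow> real \<Rightarrow> real" where
  "weight_quotient \<omega> \<nu> \<equiv> \<lambda>r. \<omega> r / tail \<nu> r"

text \<open>For r < 0 the tail involves unspecified values of the profile. Truncating at 0 leaves a
  function that is monotone on the whole line, hence Borel, and can be composed with scalings such
  as r to a r.\<close>

lemma tail_borel:
  assumes "radial_weight \<nu>"
  obtains T where "T \<in> borel_measurable borel" "\<And>r. 0 \<le> r \<Longrightarrow> r < 1 \<Longrightarrow> tail \<nu> r = T r"
proof -
  interpret finite_measure "weight_measure \<nu>" by (rule finite_measure_weight_measure) fact
  define T where "T r = - measure (weight_measure \<nu>) {max r 0..<1}" for r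
  have "mono T"
  proof (rule monoI)
    fix r s :: real assume rs: "r \<le> s"
    have "{max r 0..<1} \<in> sets (lebesgue_on {0..<1})"
      by (subst sets_restrict_space_iff) auto
    thus "T r \<le> T s"
      unfolding T_def using rs by (intro le_imp_neg_le finite_measure_mono) auto
  qed
  hence "T \<in> borel_measurable borel" by (rule borel_measurable_mono)
  hence "(\<lambda>r. - T r) \<in> borel_measurable borel" by simp
  moreover have "tail \<nu> r = - T r" if "0 \<le> r" "r < 1" for r
    using tail_eq_measure[OF assms that] that by (simp add: T_def)
  ultimately show ?thesis by (rule that)
qed

lemma tail_measurable:
  assumes "radial_weight \<nu>"
  shows "tail \<nu> \<in> borel_measurable (lebesgue_on {0..<1})"
proof -
  obtain T where "T \<in> borel_measurable borel" "\<And>r. 0 \<le> r \<Longrightarrow> r < 1 \<Longrightarrow> tail \<nu> r = T r"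
    using tail_borel[OF assms] by blast
  thus ?thesis
    by (subst measurable_cong[of _ _ T]) (auto simp: space_restrict_space intro: borel_measurable_lebesgue_on)
qed

lemma weight_quotient_measurable:
  assumes "radial_weight \<omega>" "radial_weight \<nu>"
  shows "weight_quotient \<omega> \<nu> \<in> borel_measurable (lebesgue_on {0..<1})"
  using radial_weight_measurable[OF assms(1)] tail_measurable[OF assms(2)]
  by (intro borel_measurable_divide)

lemma weight_quotient_nonneg:
  assumes "radial_weight \<omega>" "radial_weight \<nu>" "0 \<le> r" "r < 1"
  shows "0 \<le> \<omega> r / tail \<nu> r"
  using radial_weight_nonneg[OF assms(1,3,4)] tail_pos[OF assms(2-4)] by simp

lemma set_integrable_weight_quotient_iff:
  assumes "radial_weight \<omega>" "radial_weight \<nu>"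
  shows "set_integrable lebesgue {0..<1} (weight_quotient \<omega> \<nu>) \<longleftrightarrow>
    (\<integral>\<^sup>+s\<in>{0..<1}. ennreal (\<omega> s / tail \<nu> s) \<partial>lebesgue) < \<infinity>"
proof -
  let ?q = "weight_quotient \<omega> \<nu>"
  have m: "?q \<in> borel_measurable (lebesgue_on {0..<1})"
    by (rule weight_quotient_measurable[OF assms])
  have "set_integrable lebesgue {0..<1} ?q \<longleftrightarrow> integrable (lebesgue_on {0..<1}) ?q"
    by (subst integrable_restrict_space) (auto simp: set_integrable_def)
  also have "\<dots> \<longleftrightarrow> (\<integral>\<^sup>+s. ennreal (norm (?q s)) \<partial>lebesgue_on {0..<1}) < \<infinity>"
    using m by (simp add: integrable_iff_bounded)
  also have "(\<integral>\<^sup>+s. ennreal (norm (?q s)) \<partial>lebesgue_on {0..<1}) = (\<integral>\<^sup>+s. ennreal (?q s) \<partial>lebesgue_on {0..<1})"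
    by (intro nn_integral_cong arg_cong[where f=ennreal] real_norm_def[THEN trans] abs_of_nonneg)
       (simp add: weight_quotient_nonneg[OF assms] space_restrict_space)
  also have "\<dots> = (\<integral>\<^sup>+s\<in>{0..<1}. ennreal (\<omega> s / tail \<nu> s) \<partial>lebesgue)"
    by (subst nn_integral_restrict_space) auto
  finally show ?thesis .
qed

text \<open>\<open>1 / tail \<nu>\<close> increases, so its value at r bounds it from below on
  \<open>{r..<1}\<close>. Together with the tail condition, which is the converse up to a constant,
  this makes \<open>tail \<sigma>\<close> comparable to
  \<open>tail \<omega> / tail \<nu>\<close>.\<close>

lemma weight_quotient_tail_ge:
  assumes w: "radial_weight \<omega>" "radial_weight \<nu>" and i: "set_integrable lebesgue {0..<1} (weight_quotient \<omega> \<nu>)"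
    and r: "0 \<le> r" "r < 1"
  shows "tail \<omega> r / tail \<nu> r \<le> tail (weight_quotient \<omega> \<nu>) r"
proof -
  have "set_integrable lebesgue {0..<1} \<omega>" using w by (simp add: radial_weight_def)
  hence i1: "set_integrable lebesgue {r..<1} \<omega>" by (rule set_integrable_subset) (use r in auto)
  have i2: "set_integrable lebesgue {r..<1} (weight_quotient \<omega> \<nu>)"
    by (rule set_integrable_subset[OF i]) (use r in auto)
  have "(LINT s:{r..<1}|lebesgue. \<omega> s / tail \<nu> r) \<le> (LINT s:{r..<1}|lebesgue. \<omega> s / tail \<nu> s)"
  proof (rule set_integral_mono)
    show "set_integrable lebesgue {r..<1} (\<lambda>s. \<omega> s / tail \<nu> r)"
      using i1 by simp
    fix s assume "s \<in> {r..<1}"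
    hence s: "r \<le> s" "s < 1" by auto
    show "\<omega> s / tail \<nu> r \<le> \<omega> s / tail \<nu> s"
      using s r radial_weight_nonneg[OF w(1), of s] tail_pos[OF w(2), of s] tail_antimono[OF w(2) r(1) s(1,2)]
      by (intro divide_left_mono) (auto intro!: mult_pos_pos)
  qed (fact i2)
  also have "(LINT s:{r..<1}|lebesgue. \<omega> s / tail \<nu> r) = tail \<omega> r / tail \<nu> r"
    by (simp add: tail_def)
  finally show ?thesis by (simp add: tail_def)
qed

text \<open>Once the quotient is integrable its tails are positive by
  \<open>weight_quotient_tail_ge\<close>, so finiteness of the integral is all that is at
  stake.\<close>

lemma radial_weight_quotient_iff:
  assumes "radial_weight \<omega>" "radial_weight \<nu>"
  shows "radial_weight (weight_quotient \<omega> \<nu>) \<longleftrightarrow>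
    (\<integral>\<^sup>+s\<in>{0..<1}. ennreal (\<omega> s / tail \<nu> s) \<partial>lebesgue) < \<infinity>"
proof
  assume "(\<integral>\<^sup>+s\<in>{0..<1}. ennreal (\<omega> s / tail \<nu> s) \<partial>lebesgue) < \<infinity>"
  hence i: "set_integrable lebesgue {0..<1} (weight_quotient \<omega> \<nu>)"
    using set_integrable_weight_quotient_iff[OF assms] by simp
  have "0 < tail (weight_quotient \<omega> \<nu>) r" if r: "0 \<le> r" "r < 1" for r
    using weight_quotient_tail_ge[OF assms i r] tail_pos[OF assms(1) r] tail_pos[OF assms(2) r]
    by (meson divide_pos_pos less_le_trans)
  thus "radial_weight (weight_quotient \<omega> \<nu>)"
    using i weight_quotient_nonneg[OF assms] by (simp add: radial_weight_def)
next
  assume "radial_weight (weight_quotient \<omega> \<nu>)"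
  thus "(\<integral>\<^sup>+s\<in>{0..<1}. ennreal (\<omega> s / tail \<nu> s) \<partial>lebesgue) < \<infinity>"
    using set_integrable_weight_quotient_iff[OF assms] by (simp add: radial_weight_def)
qed

text \<open>Since \<omega> = \<open>tail \<nu>\<close> times \<sigma>, a pointwise bound on
  \<open>r powr x * tail \<nu> r\<close> passes to the moments.\<close>

lemma real_moment_le_quotient:
  assumes w: "radial_weight \<omega>" "radial_weight \<nu>" "radial_weight (weight_quotient \<omega> \<nu>)"
    and xy: "0 \<le> x" "0 \<le> y" "0 \<le> A"
    and le: "\<And>r. 0 \<le> r \<Longrightarrow> r < 1 \<Longrightarrow> r powr x * tail \<nu> r \<le> A * r powr y"
  shows "real_moment \<omega> x \<le> A * real_moment (weight_quotient \<omega> \<nu>) y"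
proof -
  have "ennreal (real_moment \<omega> x) = moment \<omega> x" using moment_eq_ennreal[OF w(1) xy(1)] by simp
  also have "\<dots> \<le> (\<integral>\<^sup>+r. ennreal A * (ennreal (r powr y * (\<omega> r / tail \<nu> r)) * indicator {0..<1} r) \<partial>lebesgue)"
    unfolding moment_def
  proof (rule nn_integral_mono)
    fix r :: real
    show "ennreal (r powr x * \<omega> r) * indicator {0..<1} r
       \<le> ennreal A * (ennreal (r powr y * (\<omega> r / tail \<nu> r)) * indicator {0..<1} r)"
    proof (cases "r \<in> {0..<1}")
      case True
      hence r: "0 \<le> r" "r < 1" by auto
      have q: "0 \<le> \<omega> r / tail \<nu> r" using weight_quotient_nonneg[OF w(1,2) r] .
      have "r powr x * \<omega> r = (r powr x * tail \<nu> r) * (\<omega> r / tail \<nu> r)"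
        using tail_pos[OF w(2) r] by simp
      also have "\<dots> \<le> (A * r powr y) * (\<omega> r / tail \<nu> r)"
        by (rule mult_right_mono[OF le[OF r] q])
      finally show ?thesis using True xy(3) by (simp add: ennreal_mult'[symmetric] ennreal_leI mult.assoc)
    qed simp
  qed
  also have "\<dots> = ennreal A * moment (weight_quotient \<omega> \<nu>) y"
    unfolding moment_def
  proof (rule nn_integral_cmult)
    have "(\<lambda>r. ennreal (r powr y * (\<omega> r / tail \<nu> r))) \<in> borel_measurable (lebesgue_on {0..<1})"
      by (intro measurable_compose[OF _ measurable_ennreal] borel_measurable_times weight_quotient_measurable[OF w(1,2)])
         (auto intro: borel_measurable_lebesgue_on)
    thus "(\<lambda>r. ennreal (r powr y * (\<omega> r / tail \<nu> r)) * indicator {0..<1} r) \<in> borel_measurable lebesgue"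
      by (subst (asm) borel_measurable_restrict_space_iff_ennreal) auto
  qed
  also have "\<dots> = ennreal (A * real_moment (weight_quotient \<omega> \<nu>) y)"
    using moment_eq_ennreal[OF w(3) xy(2)] xy(3) by (simp add: ennreal_mult')
  finally show ?thesis
    using real_moment_nonneg xy(3) by (subst (asm) ennreal_le_iff) auto
qed

section \<open>The conditions (ii) and (iii) in real numbers\<close>

lemma SUP_less_infinity_iff:
  fixes f :: "'a \<Rightarrow> ennreal"
  shows "(SUP x\<in>A. f x) < \<infinity> \<longleftrightarrow> (\<exists>C\<ge>0. \<forall>x\<in>A. f x \<le> ennreal C)"
proof
  assume *: "(SUP x\<in>A. f x) < \<infinity>"
  then obtain C where C: "C \<ge> 0" "(SUP x\<in>A. f x) = ennreal C"
    by (cases "SUP x\<in>A. f x") auto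
  have "f x \<le> ennreal C" if "x \<in> A" for x
    unfolding C(2)[symmetric] using that by (rule SUP_upper)
  thus "\<exists>C\<ge>0. \<forall>x\<in>A. f x \<le> ennreal C" using C(1) by blast
next
  assume "\<exists>C\<ge>0. \<forall>x\<in>A. f x \<le> ennreal C"
  then obtain C where C: "\<forall>x\<in>A. f x \<le> ennreal C" by blast
  have "(SUP x\<in>A. f x) \<le> ennreal C" using C by (intro SUP_least) auto
  thus "(SUP x\<in>A. f x) < \<infinity>" by (rule le_less_trans) simp
qed

text \<open>Real form of (ii): finiteness of the moments of the quotient is the first conjunct, and
  cross-multiplication avoids division in \<open>ennreal\<close>.\<close>

definition moment_condition :: "(real \<Rightarrow> real) \<Rightarrow> (real \<Rightarrow> real) \<Rightarrow> bool" where
  "moment_condition \<omega> \<nu> \<longleftrightarrow> radial_weight (weight_quotient \<omega> \<nu>) \<and>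
     (\<exists>C\<ge>0. \<forall>x\<ge>0. real_moment \<nu> x * real_moment (weight_quotient \<omega> \<nu>) x \<le> C * real_moment \<omega> (2 * x))"

text \<open>The supremum in (iii), encoded in the same way; membership of \<omega> in
  \<open>D_hat\<close> is kept apart.\<close>

definition tail_condition :: "(real \<Rightarrow> real) \<Rightarrow> (real \<Rightarrow> real) \<Rightarrow> bool" where
  "tail_condition \<omega> \<nu> \<longleftrightarrow> radial_weight (weight_quotient \<omega> \<nu>) \<and>
     (\<exists>C\<ge>0. \<forall>r. 0 \<le> r \<longrightarrow> r < 1 \<longrightarrow> tail \<nu> r * tail (weight_quotient \<omega> \<nu>) r \<le> C * tail \<omega> r)"

text \<open>As \<open>0 powr 0 = 0\<close>, the integrands may differ at the single point 0.\<close>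

lemma moment_0:
  "moment \<omega> 0 = (\<integral>\<^sup>+s\<in>{0..<1}. ennreal (\<omega> s) \<partial>lebesgue)"
  unfolding moment_def
proof (rule nn_integral_cong_AE)
  have "AE r in lebesgue. r \<noteq> (0::real)" by (rule AE_completion[OF AE_lborel_singleton])
  thus "AE r in lebesgue. ennreal (r powr 0 * \<omega> r) * indicator {0..<1} r = ennreal (\<omega> r) * indicator {0..<1} r"
    by eventually_elim simp
qed

lemma moment_condition_iff:
  assumes "radial_weight \<omega>" "radial_weight \<nu>"
  shows "(SUP x\<in>{0..}. moment \<nu> x / moment \<omega> (2 * x) * moment (weight_quotient \<omega> \<nu>) x) < \<infinity>
    \<longleftrightarrow> moment_condition \<omega> \<nu>" (is "?L \<longleftrightarrow> _")
proof -
  let ?q = "weight_quotient \<omega> \<nu>"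
  have eq: "moment \<nu> x / moment \<omega> (2 * x) * moment ?q x
      = ennreal (real_moment \<nu> x / real_moment \<omega> (2 * x) * real_moment ?q x)"
    if "radial_weight ?q" "0 \<le> x" for x
    using that real_moment_pos[OF assms(1), of "2 * x"] real_moment_nonneg
    by (subst ennreal_mult) (simp_all add: moment_eq_ennreal assms divide_ennreal)
  have le: "real_moment \<nu> x / real_moment \<omega> (2 * x) * real_moment ?q x \<le> C
     \<longleftrightarrow> real_moment \<nu> x * real_moment ?q x \<le> C * real_moment \<omega> (2 * x)" if "0 \<le> x" for x C
    using real_moment_pos[OF assms(1), of "2 * x"] that by (simp add: field_simps)
  have le': "moment \<nu> x / moment \<omega> (2 * x) * moment ?q x \<le> ennreal C
     \<longleftrightarrow> real_moment \<nu> x * real_moment ?q x \<le> C * real_moment \<omega> (2 * x)"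
    if "radial_weight ?q" "0 \<le> x" "0 \<le> C" for x C
    using eq[OF that(1,2)] le[OF that(2), of C] that(3) by (simp only: ennreal_le_iff)
  have "radial_weight ?q" if ?L
  proof -
    \<comment> \<open>The term x = 0 of the supremum: its first factor is positive, so the zeroth
      moment of the quotient must be finite.\<close>
    have "moment \<nu> 0 / moment \<omega> (2 * 0) * moment ?q 0 < \<infinity>"
      by (rule le_less_trans[OF _ that]) (rule SUP_upper2[of 0], auto)
    moreover have "moment \<nu> 0 / moment \<omega> (2 * 0) = ennreal (real_moment \<nu> 0 / real_moment \<omega> 0)"
      using real_moment_pos[OF assms(1), of 0] real_moment_nonneg
      by (simp add: moment_eq_ennreal assms divide_ennreal)
    moreover have "real_moment \<nu> 0 / real_moment \<omega> 0 > 0"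
      using real_moment_pos[OF assms(1), of 0] real_moment_pos[OF assms(2), of 0] by simp
    ultimately have "moment ?q 0 < \<infinity>"
      by (auto simp: ennreal_mult_less_top)
    thus ?thesis using radial_weight_quotient_iff[OF assms] by (simp add: moment_0)
  qed
  moreover have "?L \<longleftrightarrow> moment_condition \<omega> \<nu>" if "radial_weight ?q"
    unfolding SUP_less_infinity_iff moment_condition_def using that le' by (auto simp only: atLeast_iff)
  ultimately show ?thesis by (auto simp: moment_condition_def)
qed

lemma tail_condition_iff:
  assumes "radial_weight \<omega>" "radial_weight \<nu>"
  shows "(SUP r\<in>{0..<1}. ennreal (tail \<nu> r / tail \<omega> r)
                * (\<integral>\<^sup>+s\<in>{r..<1}. ennreal (\<omega> s / tail \<nu> s) \<partial>lebesgue)) < \<infinity>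
    \<longleftrightarrow> tail_condition \<omega> \<nu>" (is "?L \<longleftrightarrow> _")
proof -
  let ?q = "weight_quotient \<omega> \<nu>"
  have eq: "ennreal (tail \<nu> r / tail \<omega> r) * (\<integral>\<^sup>+s\<in>{r..<1}. ennreal (\<omega> s / tail \<nu> s) \<partial>lebesgue)
      = ennreal (tail \<nu> r / tail \<omega> r * tail ?q r)"
    if "radial_weight ?q" "0 \<le> r" "r < 1" for r
    using ennreal_tail[OF that] tail_pos[OF that] tail_pos[OF assms(1) that(2,3)] tail_pos[OF assms(2) that(2,3)]
    by (subst ennreal_mult) simp_all
  have le: "tail \<nu> r / tail \<omega> r * tail ?q r \<le> C \<longleftrightarrow> tail \<nu> r * tail ?q r \<le> C * tail \<omega> r"
    if "0 \<le> r" "r < 1" for r C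
    using tail_pos[OF assms(1) that] by (simp add: field_simps)
  have le': "ennreal (tail \<nu> r / tail \<omega> r) * (\<integral>\<^sup>+s\<in>{r..<1}. ennreal (\<omega> s / tail \<nu> s) \<partial>lebesgue) \<le> ennreal C
     \<longleftrightarrow> tail \<nu> r * tail ?q r \<le> C * tail \<omega> r"
    if "radial_weight ?q" "0 \<le> r" "r < 1" "0 \<le> C" for r C
    using eq[OF that(1-3)] le[OF that(2,3), of C] that(4) by (simp only: ennreal_le_iff)
  have "radial_weight ?q" if ?L
  proof -
    have "ennreal (tail \<nu> 0 / tail \<omega> 0) * (\<integral>\<^sup>+s\<in>{0..<1}. ennreal (\<omega> s / tail \<nu> s) \<partial>lebesgue) < \<infinity>"
      by (rule le_less_trans[OF _ that]) (rule SUP_upper2[of 0], auto)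
    moreover have "tail \<nu> 0 / tail \<omega> 0 > 0"
      using tail_pos[OF assms(1), of 0] tail_pos[OF assms(2), of 0] by simp
    ultimately have "(\<integral>\<^sup>+s\<in>{0..<1}. ennreal (\<omega> s / tail \<nu> s) \<partial>lebesgue) < \<infinity>"
      by (auto simp: ennreal_mult_less_top)
    thus ?thesis using radial_weight_quotient_iff[OF assms] by simp
  qed
  moreover have "?L \<longleftrightarrow> tail_condition \<omega> \<nu>" if "radial_weight ?q"
    unfolding SUP_less_infinity_iff tail_condition_def
    using that le' unfolding Ball_def atLeastLessThan_iff by (simp only: simp_thms) blast
  ultimately show ?thesis by (auto simp: tail_condition_def)
qed

text \<open>The key point is \<open>r powr (x / 4) * tail \<nu> r \<le> real_moment \<nu> (x / 4)\<close>: as the moments of \<open>\<nu>\<close> are doubling,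
  the weight \<open>\<omega> = tail \<nu> * (\<omega> / tail \<nu>)\<close> has \<open>x\<close>-th moment at most a constant times the product of the moments
  of order \<open>3 / 4 * x\<close> of \<open>\<nu>\<close> and \<open>\<omega> / tail \<nu>\<close>, and these are controlled by the hypothesis.\<close>

lemma moment_condition_imp_D_hat:
  assumes w: "radial_weight \<omega>" and v: "\<nu> \<in> D_hat" and mc: "moment_condition \<omega> \<nu>"
  shows "\<omega> \<in> D_hat"
proof -
  let ?q = "weight_quotient \<omega> \<nu>"
  have v': "radial_weight \<nu>" using v by (rule D_hat_imp_radial_weight)
  from mc obtain C where q: "radial_weight ?q" and C: "C \<ge> 0"
    "\<And>x. x \<ge> 0 \<Longrightarrow> real_moment \<nu> x * real_moment ?q x \<le> C * real_moment \<omega> (2 * x)"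
    unfolding moment_condition_def by blast
  obtain B where B: "B > 0" "\<And>x y. x \<ge> 0 \<Longrightarrow> 0 \<le> y \<Longrightarrow> y \<le> 4 * x + 3 \<Longrightarrow> real_moment \<nu> x \<le> B * real_moment \<nu> y"
    using D_hat_real_moment_doubling[OF v] by blast
  show ?thesis
  proof (rule D_hatI_real_moment[OF w])
    fix x :: real assume x: "x \<ge> 0"
    \<comment> \<open>An order strictly between x / 2 and x: the remainder x - \<open>?y\<close> = x
      / 4 converts the tail of \<nu> into a moment, while 2 \<open>?y\<close> = 3 / 2 x still
      exceeds x, as \<open>D_hatI_real_moment\<close> demands.\<close>
    let ?y = "3 / 4 * x"
    have "real_moment \<omega> x \<le> (B * real_moment \<nu> ?y) * real_moment ?q ?y"
    proof (rule real_moment_le_quotient[OF w v' q])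
      fix r :: real assume r: "0 \<le> r" "r < 1"
      have "r powr (x / 4) * tail \<nu> r \<le> real_moment \<nu> (x / 4)"
        using x r by (intro powr_mult_tail_le_real_moment[OF v']) auto
      also have "\<dots> \<le> B * real_moment \<nu> ?y" using x by (intro B) auto
      finally have "r powr ?y * (r powr (x / 4) * tail \<nu> r) \<le> r powr ?y * (B * real_moment \<nu> ?y)"
        by (intro mult_left_mono) auto
      moreover have "r powr x * tail \<nu> r = r powr ?y * (r powr (x / 4) * tail \<nu> r)"
        by (simp add: powr_add[symmetric])
      ultimately show "r powr x * tail \<nu> r \<le> B * real_moment \<nu> ?y * r powr ?y"
        by (simp only: mult.commute[of _ "r powr ?y"])
    qed (use x B real_moment_nonneg in auto)
    also have "\<dots> = B * (real_moment \<nu> ?y * real_moment ?q ?y)" by (simp add: mult_ac)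
    also have "\<dots> \<le> B * (C * real_moment \<omega> (2 * ?y))"
      using B x by (intro mult_left_mono C) auto
    also have "2 * ?y = 3 / 2 * x" by simp
    finally show "real_moment \<omega> x \<le> (B * C) * real_moment \<omega> (3 / 2 * x)" by (simp add: mult_ac)
  qed
qed

text \<open>At r = 1 - 1 / x both tails on the left are bounded by moments for any weight. Only the
  way back from the moment of \<omega> to its tail uses doubling, which
  \<open>moment_condition_imp_D_hat\<close> supplies.\<close>

lemma moment_condition_imp_tail_condition:
  assumes w: "radial_weight \<omega>" and v: "\<nu> \<in> D_hat" and mc: "moment_condition \<omega> \<nu>"
  shows "tail_condition \<omega> \<nu>"
proof -
  let ?q = "weight_quotient \<omega> \<nu>"
  have v': "radial_weight \<nu>" using v by (rule D_hat_imp_radial_weight)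
  from mc obtain C where q: "radial_weight ?q" and C: "C \<ge> 0"
    "\<And>x. x \<ge> 0 \<Longrightarrow> real_moment \<nu> x * real_moment ?q x \<le> C * real_moment \<omega> (2 * x)"
    unfolding moment_condition_def by blast
  obtain B where B: "B > 0" "\<And>x. x \<ge> 1 \<Longrightarrow> real_moment \<omega> x \<le> B * tail \<omega> (1 - 1 / x)"
    using D_hat_real_moment_le_tail[OF moment_condition_imp_D_hat[OF assms]] by blast
  define D where "D = max (exp 4 * C * B) (tail \<nu> 0 * tail ?q 0 / tail \<omega> (1/2))"
  have D0: "D \<ge> 0" using C B by (auto simp: D_def le_max_iff_disj)
  have "tail \<nu> r * tail ?q r \<le> D * tail \<omega> r" if r: "0 \<le> r" "r < 1" for r
  proof (cases "r \<ge> 1/2")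
    case True
    define x where "x = 1 / (1 - r)"
    have x: "x \<ge> 2" "r = 1 - 1 / x" using True r by (auto simp: x_def field_simps)
    have "tail \<nu> r * tail ?q r \<le> (exp 2 * real_moment \<nu> x) * (exp 2 * real_moment ?q x)"
      unfolding x(2) using x(1) tail_pos[OF q, of "1 - 1 / x"]
      by (intro mult_mono tail_le_real_moment v' q) (auto simp: real_moment_nonneg)
    also have "\<dots> = exp 4 * (real_moment \<nu> x * real_moment ?q x)"
      using exp_add[of "2::real" 2] by (simp add: mult_ac)
    also have "\<dots> \<le> exp 4 * (C * real_moment \<omega> (2 * x))" using x by (intro mult_left_mono C) auto
    also have "\<dots> \<le> exp 4 * (C * real_moment \<omega> x)"
      using x C by (intro mult_left_mono real_moment_antimono[OF w]) auto
    also have "\<dots> \<le> exp 4 * (C * (B * tail \<omega> r))"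
      unfolding x(2) using x(1) C by (intro mult_left_mono B) auto
    also have "\<dots> \<le> D * tail \<omega> r"
      using mult_right_mono[of "exp 4 * C * B" D "tail \<omega> r"] tail_pos[OF w r] by (simp add: D_def mult_ac)
    finally show ?thesis .
  next
    case False
    have "tail \<nu> r * tail ?q r \<le> tail \<nu> 0 * tail ?q 0"
      using r tail_pos[OF v', of 0] tail_pos[OF q, of r] by (intro mult_mono tail_antimono v' q) auto
    also have "\<dots> = (tail \<nu> 0 * tail ?q 0 / tail \<omega> (1/2)) * tail \<omega> (1/2)"
      using tail_pos[OF w, of "1/2"] by simp
    also have "\<dots> \<le> D * tail \<omega> r"
      using r False D0 tail_pos[OF w, of "1/2"] by (intro mult_mono tail_antimono w) (auto simp: D_def)
    finally show ?thesis .
  qed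
  thus ?thesis unfolding tail_condition_def using q D0 by blast
qed

text \<open>\<open>tail \<sigma>\<close> is comparable to \<open>tail \<omega> / tail \<nu>\<close>.
  Moving from r to the midpoint (1 + r) / 2 costs the doubling constant of \<omega> in the
  numerator, and shrinking the denominator only helps.\<close>

lemma tail_condition_imp_quotient_D_hat:
  assumes w: "\<omega> \<in> D_hat" and v: "radial_weight \<nu>" and tc: "tail_condition \<omega> \<nu>"
  shows "weight_quotient \<omega> \<nu> \<in> D_hat"
proof -
  let ?q = "weight_quotient \<omega> \<nu>"
  have w': "radial_weight \<omega>" using w by (rule D_hat_imp_radial_weight)
  from tc obtain C where q: "radial_weight ?q" and C: "C \<ge> 0"
    "\<And>r. 0 \<le> r \<Longrightarrow> r < 1 \<Longrightarrow> tail \<nu> r * tail ?q r \<le> C * tail \<omega> r"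
    unfolding tail_condition_def by blast
  obtain D where D: "D \<ge> 1" "\<And>r. 0 \<le> r \<Longrightarrow> r < 1 \<Longrightarrow> tail \<omega> r \<le> D * tail \<omega> ((1 + r) / 2)"
    using D_hat_doubling[OF w] by blast
  \<comment> \<open>The summand 1 keeps the constant positive even if C = 0, as the definition of
    \<open>D_hat\<close> demands.\<close>
  have "tail ?q r \<le> (C * D + 1) * tail ?q ((1 + r) / 2)" if r: "0 \<le> r" "r < 1" for r
  proof -
    let ?s = "(1 + r) / 2"
    have s: "0 \<le> ?s" "?s < 1" using r by auto
    have V: "0 < tail \<nu> r" "0 < tail \<nu> ?s" "tail \<nu> ?s \<le> tail \<nu> r"
      using r by (auto intro!: tail_pos[OF v] tail_antimono[OF v])
    have i: "set_integrable lebesgue {0..<1} ?q" using q by (simp add: radial_weight_def)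
    have "tail \<nu> r * tail ?q r \<le> C * (D * tail \<omega> ?s)"
      by (rule order_trans[OF C(2)[OF r] mult_left_mono[OF D(2)[OF r] C(1)]])
    also have "\<dots> = C * D * (tail \<nu> ?s * (tail \<omega> ?s / tail \<nu> ?s))" using V by simp
    also have "\<dots> \<le> C * D * (tail \<nu> r * tail ?q ?s)"
      using C(1) D(1) V weight_quotient_tail_ge[OF w' v i s] tail_pos[OF w' s]
      by (intro mult_left_mono mult_mono) auto
    finally have "tail \<nu> r * tail ?q r \<le> tail \<nu> r * (C * D * tail ?q ?s)" by (simp add: mult_ac)
    hence "tail ?q r \<le> C * D * tail ?q ?s" using V by simp
    also have "\<dots> \<le> (C * D + 1) * tail ?q ?s"
      using tail_pos[OF q s] by (intro mult_right_mono) auto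
    finally show ?thesis .
  qed
  moreover have "C * D + 1 > 0" using C(1) D(1) by (simp add: add_nonneg_pos)
  moreover have "\<forall>\<^sub>F r in at_left 1. r \<in> {0<..<1::real}"
    by (rule eventually_at_left_real) simp
  ultimately have "\<exists>C>0. \<forall>\<^sub>F r in at_left 1. tail ?q r \<le> C * tail ?q ((1 + r) / 2)"
    by (intro exI[of _ "C * D + 1"] conjI) (auto elim!: eventually_mono)
  thus ?thesis using q by (simp add: D_hat_def)
qed

text \<open>\<nu> and \<sigma> both lie in \<open>D_hat\<close>, so their moments of order x are
  bounded by tails at 1 - 1 / x, where the tail condition applies; doubling of \<omega> then raises
  the order on the right from x to 2 x.\<close>

lemma tail_condition_imp_moment_condition:
  assumes w: "\<omega> \<in> D_hat" and v: "\<nu> \<in> D_hat" and tc: "tail_condition \<omega> \<nu>"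
  shows "moment_condition \<omega> \<nu>"
proof -
  let ?q = "weight_quotient \<omega> \<nu>"
  have w': "radial_weight \<omega>" using w by (rule D_hat_imp_radial_weight)
  have v': "radial_weight \<nu>" using v by (rule D_hat_imp_radial_weight)
  from tc obtain C where q: "radial_weight ?q" and C: "C \<ge> 0"
    "\<And>r. 0 \<le> r \<Longrightarrow> r < 1 \<Longrightarrow> tail \<nu> r * tail ?q r \<le> C * tail \<omega> r"
    unfolding tail_condition_def by blast
  have q': "?q \<in> D_hat" using tail_condition_imp_quotient_D_hat[OF w v' tc] .
  obtain B1 where B1: "B1 > 0" "\<And>x. x \<ge> 1 \<Longrightarrow> real_moment \<nu> x \<le> B1 * tail \<nu> (1 - 1 / x)"
    using D_hat_real_moment_le_tail[OF v] by blast
  obtain B2 where B2: "B2 > 0" "\<And>x. x \<ge> 1 \<Longrightarrow> real_moment ?q x \<le> B2 * tail ?q (1 - 1 / x)"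
    using D_hat_real_moment_le_tail[OF q'] by blast
  obtain B3 where B3: "B3 > 0" "\<And>x y. x \<ge> 0 \<Longrightarrow> 0 \<le> y \<Longrightarrow> y \<le> 4 * x + 3 \<Longrightarrow> real_moment \<omega> x \<le> B3 * real_moment \<omega> y"
    using D_hat_real_moment_doubling[OF w] by blast
  define D where "D = max (B1 * B2 * C * exp 2 * B3) (real_moment \<nu> 0 * real_moment ?q 0 / real_moment \<omega> 4)"
  have D0: "D \<ge> 0" using C B1 B2 B3 by (auto simp: D_def le_max_iff_disj)
  have "real_moment \<nu> x * real_moment ?q x \<le> D * real_moment \<omega> (2 * x)" if x0: "x \<ge> 0" for x
  proof (cases "x \<ge> 2")
    case True
    let ?t = "1 - 1 / x"
    have t: "0 \<le> ?t" "?t < 1" using True by auto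
    have "real_moment \<nu> x * real_moment ?q x \<le> (B1 * tail \<nu> ?t) * (B2 * tail ?q ?t)"
      using True B1 B2 tail_pos[OF v' t] by (intro mult_mono B1 B2) (auto simp: real_moment_nonneg)
    also have "\<dots> = B1 * B2 * (tail \<nu> ?t * tail ?q ?t)" by (simp add: mult_ac)
    also have "\<dots> \<le> B1 * B2 * (C * tail \<omega> ?t)" using B1 B2 t by (intro mult_left_mono C) auto
    also have "\<dots> \<le> B1 * B2 * (C * (exp 2 * real_moment \<omega> x))"
      using B1 B2 C True by (intro mult_left_mono tail_le_real_moment[OF w']) auto
    also have "\<dots> \<le> B1 * B2 * (C * (exp 2 * (B3 * real_moment \<omega> (2 * x))))"
      using B1 B2 C True by (intro mult_left_mono B3) auto
    also have "\<dots> = (B1 * B2 * C * exp 2 * B3) * real_moment \<omega> (2 * x)" by (simp add: mult_ac)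
    also have "\<dots> \<le> D * real_moment \<omega> (2 * x)"
      by (intro mult_right_mono) (auto simp: D_def real_moment_nonneg)
    finally show ?thesis .
  next
    case False
    have "real_moment \<nu> x * real_moment ?q x \<le> real_moment \<nu> 0 * real_moment ?q 0"
      using x0 by (intro mult_mono real_moment_antimono v' q) (auto simp: real_moment_nonneg)
    also have "\<dots> = (real_moment \<nu> 0 * real_moment ?q 0 / real_moment \<omega> 4) * real_moment \<omega> 4"
      using real_moment_pos[OF w', of 4] by simp
    also have "\<dots> \<le> D * real_moment \<omega> (2 * x)"
      using x0 False D0 by (intro mult_mono real_moment_antimono w') (auto simp: D_def real_moment_nonneg)
    finally show ?thesis .
  qed
  thus ?thesis unfolding moment_condition_def using q D0 by blast
qed

section \<open>Mean squares of power series on the disc\<close>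

lemma nn_integral_disc_radial:
  assumes g: "g \<in> borel_measurable (lebesgue_on {0..<1})"
  shows "(\<integral>\<^sup>+\<zeta>. g (cmod \<zeta>) \<partial>lebesgue_on unit_disc) = (\<integral>\<^sup>+r. ennreal (2 * pi * r) * g r \<partial>lebesgue_on {0..<1})"
proof -
  have "(\<integral>\<^sup>+\<zeta>. g (cmod \<zeta>) \<partial>lebesgue_on unit_disc)
      = (\<integral>\<^sup>+r. g r \<partial>distr (lebesgue_on unit_disc) (lebesgue_on {0..<1}) cmod)"
    using g by (subst nn_integral_distr[OF cmod_measurable_lebesgue]) simp_all
  also have "\<dots> = (\<integral>\<^sup>+r. ennreal (2 * pi * r) * g r \<partial>lebesgue_on {0..<1})"
    unfolding distr_cmod_lebesgue
    by (intro nn_integral_density g measurable_compose[OF _ measurable_ennreal] borel_measurable_lebesgue_on) simp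
  finally show ?thesis .
qed

lemma radial_weight_cmod_measurable:
  assumes "radial_weight \<mu>"
  shows "(\<lambda>\<zeta>. \<mu> (cmod \<zeta>)) \<in> borel_measurable (lebesgue_on unit_disc)"
  by (rule measurable_compose[OF cmod_measurable_lebesgue radial_weight_measurable[OF assms]])

lemma borel_cmod_measurable:
  assumes "h \<in> borel_measurable borel"
  shows "(\<lambda>\<zeta>. h (cmod \<zeta>)) \<in> borel_measurable (lebesgue_on S)"
  by (intro borel_measurable_lebesgue_on measurable_compose[OF _ assms]) simp

lemma nn_integral_disc_weight:
  fixes h :: "real \<Rightarrow> ennreal"
  assumes w: "radial_weight \<mu>" and h: "h \<in> borel_measurable borel"
  shows "(\<integral>\<^sup>+\<zeta>. ennreal (\<mu> (cmod \<zeta>)) * h (cmod \<zeta>) \<partial>lebesgue_on unit_disc)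
     = (\<integral>\<^sup>+r. ennreal (2 * pi * r) * h r \<partial>weight_measure \<mu>)"
proof -
  have h': "h \<in> borel_measurable (lebesgue_on {0..<1})" using h by (rule borel_measurable_lebesgue_on)
  have r: "(\<lambda>r. ennreal (2 * pi * r)) \<in> borel_measurable (lebesgue_on {0..<1})"
    by (intro measurable_compose[OF _ measurable_ennreal] borel_measurable_lebesgue_on) simp
  have m: "(\<lambda>r. ennreal (\<mu> r)) \<in> borel_measurable (lebesgue_on {0..<1})"
    by (rule measurable_compose[OF radial_weight_measurable[OF w] measurable_ennreal])
  have "(\<integral>\<^sup>+\<zeta>. ennreal (\<mu> (cmod \<zeta>)) * h (cmod \<zeta>) \<partial>lebesgue_on unit_disc)
     = (\<integral>\<^sup>+r. ennreal (2 * pi * r) * (ennreal (\<mu> r) * h r) \<partial>lebesgue_on {0..<1})"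
    by (intro nn_integral_disc_radial borel_measurable_times_ennreal m h')
  also have "\<dots> = (\<integral>\<^sup>+r. ennreal (\<mu> r) * (ennreal (2 * pi * r) * h r) \<partial>lebesgue_on {0..<1})"
    by (simp only: mult.left_commute)
  also have "\<dots> = (\<integral>\<^sup>+r. ennreal (2 * pi * r) * h r \<partial>weight_measure \<mu>)"
    by (intro nn_integral_weight_measure[symmetric] w borel_measurable_times_ennreal r h')
  finally show ?thesis .
qed

lemma nn_integral_disc_weight_le:
  fixes h :: "real \<Rightarrow> ennreal"
  assumes w: "radial_weight \<mu>" and h: "h \<in> borel_measurable borel"
  shows "(\<integral>\<^sup>+\<zeta>. ennreal (\<mu> (cmod \<zeta>)) * h (cmod \<zeta>) \<partial>lebesgue_on unit_disc)
     \<le> ennreal (2 * pi) * (\<integral>\<^sup>+r. h r \<partial>weight_measure \<mu>)"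
proof -
  have "(\<integral>\<^sup>+\<zeta>. ennreal (\<mu> (cmod \<zeta>)) * h (cmod \<zeta>) \<partial>lebesgue_on unit_disc)
     = (\<integral>\<^sup>+r. ennreal (2 * pi * r) * h r \<partial>weight_measure \<mu>)"
    by (rule nn_integral_disc_weight[OF assms])
  also have "\<dots> \<le> (\<integral>\<^sup>+r. ennreal (2 * pi) * h r \<partial>weight_measure \<mu>)"
    by (intro nn_integral_mono mult_right_mono ennreal_leI) auto
  also have "\<dots> = ennreal (2 * pi) * (\<integral>\<^sup>+r. h r \<partial>weight_measure \<mu>)"
    by (intro nn_integral_cmult borel_measurable_weight_measure h)
  finally show ?thesis .
qed

lemma integrable_disc_weight:
  assumes w: "radial_weight \<mu>"
  shows "integrable (lebesgue_on unit_disc) (\<lambda>\<zeta>. \<mu> (cmod \<zeta>))"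
proof -
  have "(\<integral>\<^sup>+\<zeta>. ennreal (norm (\<mu> (cmod \<zeta>))) \<partial>lebesgue_on unit_disc)
     = (\<integral>\<^sup>+\<zeta>. ennreal (\<mu> (cmod \<zeta>)) * 1 \<partial>lebesgue_on unit_disc)"
    by (intro nn_integral_cong) (simp add: space_restrict_space radial_weight_nonneg[OF w])
  also have "\<dots> \<le> ennreal (2 * pi) * (\<integral>\<^sup>+r. 1 \<partial>weight_measure \<mu>)"
    by (rule nn_integral_disc_weight_le[OF w]) simp
  also have "\<dots> = ennreal (2 * pi) * ennreal (tail \<mu> 0)"
    using emeasure_weight_measure_Ico[OF w, of 0] by simp
  also have "\<dots> < \<infinity>" by (simp add: ennreal_mult_less_top)
  finally show ?thesis
    using radial_weight_cmod_measurable[OF w] by (simp add: integrable_iff_bounded)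
qed

lemma integrable_bounded_times:
  fixes F :: "'a \<Rightarrow> 'b::{banach, second_countable_topology, real_normed_algebra}" and G :: "'a \<Rightarrow> 'b"
  assumes G: "integrable M G" and F: "F \<in> borel_measurable M" and B: "\<And>z. z \<in> space M \<Longrightarrow> norm (F z) \<le> B"
  shows "integrable M (\<lambda>z. F z * G z)"
proof (rule Bochner_Integration.integrable_bound)
  show "integrable M (\<lambda>z. B * norm (G z))" using G by simp
  show "(\<lambda>z. F z * G z) \<in> borel_measurable M" using G F by (intro borel_measurable_times) auto
  show "AE z in M. norm (F z * G z) \<le> norm (B * norm (G z))"
  proof (rule AE_I2)
    fix z assume z: "z \<in> space M"
    have "norm (F z * G z) \<le> norm (F z) * norm (G z)" by (rule norm_mult_ineq)
    also have "\<dots> \<le> B * norm (G z)" using B[OF z] by (intro mult_right_mono) auto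
    also have "\<dots> \<le> norm (B * norm (G z))" by simp
    finally show "norm (F z * G z) \<le> norm (B * norm (G z))" .
  qed
qed

text \<open>Rotating by a unit u with \<open>u ^ n * cnj u ^ m = -1\<close> shows that the integral
  equals its negative.\<close>

lemma integral_disc_monomial_orthogonal:
  fixes g :: "real \<Rightarrow> real"
  assumes g: "(\<lambda>\<zeta>. g (cmod \<zeta>)) \<in> borel_measurable (lebesgue_on unit_disc)" and nm: "n \<noteq> m"
  shows "(\<integral>\<zeta>. \<zeta> ^ n * cnj \<zeta> ^ m * of_real (g (cmod \<zeta>)) \<partial>lebesgue_on unit_disc) = 0" (is "integral\<^sup>L ?M ?F = 0")
proof -
  define t where "t = pi / (real n - real m)"
  define u where "u = cis t"
  have u: "cmod u = 1" by (simp add: u_def)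
  have "u ^ n * cnj u ^ m = cis (real n * t) * cis (- (real m * t))"
    by (simp add: u_def cis_cnj Complex.DeMoivre)
  also have "\<dots> = cis ((real n - real m) * t)" by (simp add: cis_mult algebra_simps)
  also have "(real n - real m) * t = pi" using nm by (simp add: t_def)
  finally have uu: "u ^ n * cnj u ^ m = -1" by simp
  have "(\<lambda>\<zeta>. \<zeta> ^ n * cnj \<zeta> ^ m) \<in> borel_measurable (lebesgue_on unit_disc)"
    by (intro borel_measurable_lebesgue_on borel_measurable_continuous_onI continuous_intros)
  hence F: "?F \<in> borel_measurable ?M"
    by (rule borel_measurable_times) (use g in simp)
  have "integral\<^sup>L ?M ?F = integral\<^sup>L ?M (\<lambda>\<zeta>. ?F (u * \<zeta>))"
    by (rule integral_disc_rotate[OF u F, symmetric])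
  also have "(\<lambda>\<zeta>. ?F (u * \<zeta>)) = (\<lambda>\<zeta>. (u ^ n * cnj u ^ m) * ?F \<zeta>)"
    using u by (simp add: fun_eq_iff norm_mult power_mult_distrib mult_ac)
  also have "\<dots> = (\<lambda>\<zeta>. - ?F \<zeta>)" unfolding uu by simp
  finally have "integral\<^sup>L ?M ?F = - integral\<^sup>L ?M ?F" by simp
  thus ?thesis by (simp add: eq_neg_iff_add_eq_0)
qed

lemma of_real_norm_sum_sq:
  fixes d :: "nat \<Rightarrow> complex"
  shows "complex_of_real ((cmod (\<Sum>n<N. d n * \<zeta> ^ n))\<^sup>2)
    = (\<Sum>n<N. \<Sum>m<N. (d n * cnj (d m)) * (\<zeta> ^ n * cnj \<zeta> ^ m))"
  unfolding complex_norm_square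
  by (simp add: cnj_sum sum_product mult_ac)

text \<open>Parseval's identity on circles, integrated against a radial weight: expanding the
  square, only the diagonal terms survive orthogonality.\<close>

lemma integral_disc_polynomial_square:
  fixes d :: "nat \<Rightarrow> complex" and g :: "real \<Rightarrow> real"
  assumes g: "integrable (lebesgue_on unit_disc) (\<lambda>\<zeta>. g (cmod \<zeta>))"
  shows "(\<integral>\<zeta>. (cmod (\<Sum>n<N. d n * \<zeta> ^ n))\<^sup>2 * g (cmod \<zeta>) \<partial>lebesgue_on unit_disc)
     = (\<integral>\<zeta>. (\<Sum>n<N. (cmod (d n))\<^sup>2 * cmod \<zeta> ^ (2 * n)) * g (cmod \<zeta>) \<partial>lebesgue_on unit_disc)"
    (is "integral\<^sup>L ?M ?A = integral\<^sup>L ?M ?B")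
proof -
  let ?e = "\<lambda>n m \<zeta>. \<zeta> ^ n * cnj \<zeta> ^ m * complex_of_real (g (cmod \<zeta>))"
  have int: "integrable ?M (?e n m)" for n m
  proof (rule integrable_bounded_times[where B=1])
    show "(\<lambda>\<zeta>. \<zeta> ^ n * cnj \<zeta> ^ m) \<in> borel_measurable ?M"
      by (intro borel_measurable_lebesgue_on borel_measurable_continuous_onI continuous_intros)
    show "norm (\<zeta> ^ n * cnj \<zeta> ^ m) \<le> 1" if "\<zeta> \<in> space ?M" for \<zeta>
      using that by (auto simp: norm_mult norm_power space_restrict_space intro!: mult_le_one power_le_one)
  qed (use g in simp)
  have "complex_of_real (integral\<^sup>L ?M ?A) = (\<integral>\<zeta>. complex_of_real (?A \<zeta>) \<partial>?M)"
    by (rule integral_complex_of_real[symmetric])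
  also have "(\<lambda>\<zeta>. complex_of_real (?A \<zeta>)) = (\<lambda>\<zeta>. \<Sum>n<N. \<Sum>m<N. (d n * cnj (d m)) * ?e n m \<zeta>)"
    unfolding of_real_mult of_real_norm_sum_sq by (simp add: sum_distrib_right mult.assoc)
  also have "integral\<^sup>L ?M \<dots> = (\<Sum>n<N. \<Sum>m<N. (d n * cnj (d m)) * integral\<^sup>L ?M (?e n m))"
    using int by (simp add: Bochner_Integration.integral_sum)
  also have "\<dots> = (\<Sum>n<N. \<Sum>m<N. if m = n then (d n * cnj (d n)) * integral\<^sup>L ?M (?e n n) else 0)"
    using integral_disc_monomial_orthogonal[OF borel_measurable_integrable[OF g]]
    by (intro sum.cong) auto
  also have "\<dots> = (\<Sum>n<N. (d n * cnj (d n)) * integral\<^sup>L ?M (?e n n))" by simp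
  also have "\<dots> = (\<integral>\<zeta>. (\<Sum>n<N. (d n * cnj (d n)) * ?e n n \<zeta>) \<partial>?M)"
    using int by (simp add: Bochner_Integration.integral_sum)
  also have "(\<lambda>\<zeta>. \<Sum>n<N. (d n * cnj (d n)) * ?e n n \<zeta>) = (\<lambda>\<zeta>. complex_of_real (?B \<zeta>))"
    by (simp add: fun_eq_iff sum_distrib_right complex_norm_square[symmetric] power_mult_distrib[symmetric]
        power_mult mult.assoc[symmetric])
  also have "integral\<^sup>L ?M \<dots> = complex_of_real (integral\<^sup>L ?M ?B)"
    by (rule integral_complex_of_real)
  finally show ?thesis by (simp only: of_real_eq_iff)
qed

text \<open>The partial sums obey Parseval's identity, and Fatou's lemma passes to the limit; hence
  an inequality, with S majorizing the mean squares of all partial sums.\<close>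

lemma nn_integral_disc_power_series_square:
  fixes d :: "nat \<Rightarrow> complex" and g S :: "real \<Rightarrow> real"
  assumes g: "integrable (lebesgue_on unit_disc) (\<lambda>\<zeta>. g (cmod \<zeta>))" and g0: "\<And>r. 0 \<le> r \<Longrightarrow> r < 1 \<Longrightarrow> 0 \<le> g r"
    and d: "\<And>\<zeta>. cmod \<zeta> < 1 \<Longrightarrow> summable (\<lambda>n. d n * \<zeta> ^ n)"
    and S: "\<And>r N. 0 \<le> r \<Longrightarrow> r < 1 \<Longrightarrow> (\<Sum>n<N. (cmod (d n))\<^sup>2 * r ^ (2 * n)) \<le> S r"
  shows "(\<integral>\<^sup>+\<zeta>. ennreal ((cmod (\<Sum>n. d n * \<zeta> ^ n))\<^sup>2 * g (cmod \<zeta>)) \<partial>lebesgue_on unit_disc)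
    \<le> (\<integral>\<^sup>+\<zeta>. ennreal (S (cmod \<zeta>) * g (cmod \<zeta>)) \<partial>lebesgue_on unit_disc)" (is "_ \<le> ?R")
proof -
  let ?M = "lebesgue_on unit_disc"
  have gm: "(\<lambda>\<zeta>. g (cmod \<zeta>)) \<in> borel_measurable ?M" by (rule borel_measurable_integrable[OF g])
  define p where "p N \<zeta> = (\<Sum>n<N. d n * \<zeta> ^ n)" for N \<zeta>
  define q where "q N \<zeta> = (\<Sum>n<N. (cmod (d n))\<^sup>2 * cmod \<zeta> ^ (2 * n))" for N \<zeta>
  have pm: "(\<lambda>\<zeta>. (cmod (p N \<zeta>))\<^sup>2) \<in> borel_measurable ?M" for N
    unfolding p_def by (intro borel_measurable_lebesgue_on borel_measurable_continuous_onI continuous_intros)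
  have qm: "q N \<in> borel_measurable ?M" for N
    unfolding q_def by (intro borel_measurable_lebesgue_on borel_measurable_continuous_onI continuous_intros)
  have pow: "cmod \<zeta> ^ k \<le> 1" if "\<zeta> \<in> space ?M" for \<zeta> k
    using that by (auto simp: space_restrict_space intro!: power_le_one)
  have pi: "integrable ?M (\<lambda>\<zeta>. (cmod (p N \<zeta>))\<^sup>2 * g (cmod \<zeta>))" for N
  proof (rule integrable_bounded_times[OF g pm, where B="(\<Sum>n<N. cmod (d n))\<^sup>2"])
    fix \<zeta> assume z: "\<zeta> \<in> space ?M"
    have "cmod (p N \<zeta>) \<le> (\<Sum>n<N. cmod (d n * \<zeta> ^ n))" unfolding p_def by (rule norm_sum)
    also have "\<dots> \<le> (\<Sum>n<N. cmod (d n))"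
      using pow[OF z] by (intro sum_mono) (simp add: norm_mult norm_power mult_left_le)
    finally show "norm ((cmod (p N \<zeta>))\<^sup>2) \<le> (\<Sum>n<N. cmod (d n))\<^sup>2" by (simp add: power_mono)
  qed
  have qi: "integrable ?M (\<lambda>\<zeta>. q N \<zeta> * g (cmod \<zeta>))" for N
  proof (rule integrable_bounded_times[OF g qm, where B="\<Sum>n<N. (cmod (d n))\<^sup>2"])
    fix \<zeta> assume z: "\<zeta> \<in> space ?M"
    have "q N \<zeta> \<le> (\<Sum>n<N. (cmod (d n))\<^sup>2)"
      unfolding q_def using pow[OF z] by (intro sum_mono) (simp add: mult_left_le)
    moreover have "q N \<zeta> \<ge> 0" unfolding q_def by (intro sum_nonneg) auto
    ultimately show "norm (q N \<zeta>) \<le> (\<Sum>n<N. (cmod (d n))\<^sup>2)" by simp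
  qed
  have g0': "0 \<le> g (cmod \<zeta>)" if "\<zeta> \<in> space ?M" for \<zeta>
    using that by (intro g0) (auto simp: space_restrict_space)
  have q0: "0 \<le> q N \<zeta>" for N \<zeta> unfolding q_def by (intro sum_nonneg) auto
  have bound: "(\<integral>\<^sup>+\<zeta>. ennreal ((cmod (p N \<zeta>))\<^sup>2 * g (cmod \<zeta>)) \<partial>?M) \<le> ?R" for N
  proof -
    have "(\<integral>\<^sup>+\<zeta>. ennreal ((cmod (p N \<zeta>))\<^sup>2 * g (cmod \<zeta>)) \<partial>?M) = ennreal (\<integral>\<zeta>. (cmod (p N \<zeta>))\<^sup>2 * g (cmod \<zeta>) \<partial>?M)"
      by (intro nn_integral_eq_integral pi AE_I2 mult_nonneg_nonneg g0') auto
    also have "\<dots> = ennreal (\<integral>\<zeta>. q N \<zeta> * g (cmod \<zeta>) \<partial>?M)"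
      unfolding p_def q_def integral_disc_polynomial_square[OF g] ..
    also have "\<dots> = (\<integral>\<^sup>+\<zeta>. ennreal (q N \<zeta> * g (cmod \<zeta>)) \<partial>?M)"
      by (intro nn_integral_eq_integral[symmetric] qi AE_I2 mult_nonneg_nonneg g0' q0)
    also have "\<dots> \<le> ?R"
      using g0' by (intro nn_integral_mono ennreal_leI mult_right_mono)
        (auto simp: q_def space_restrict_space intro!: S)
    finally show ?thesis .
  qed
  have lim: "ennreal ((cmod (\<Sum>n. d n * \<zeta> ^ n))\<^sup>2 * g (cmod \<zeta>))
      = liminf (\<lambda>N. ennreal ((cmod (p N \<zeta>))\<^sup>2 * g (cmod \<zeta>)))" if "\<zeta> \<in> space ?M" for \<zeta>
  proof -
    have "cmod \<zeta> < 1" using that by (simp add: space_restrict_space)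
    hence "(\<lambda>N. p N \<zeta>) \<longlonglongrightarrow> (\<Sum>n. d n * \<zeta> ^ n)"
      unfolding p_def using summable_LIMSEQ[OF d] by simp
    hence "(\<lambda>N. ennreal ((cmod (p N \<zeta>))\<^sup>2 * g (cmod \<zeta>))) \<longlonglongrightarrow> ennreal ((cmod (\<Sum>n. d n * \<zeta> ^ n))\<^sup>2 * g (cmod \<zeta>))"
      by (intro tendsto_ennrealI tendsto_intros)
    thus ?thesis by (intro lim_imp_Liminf[symmetric]) auto
  qed
  have "(\<integral>\<^sup>+\<zeta>. ennreal ((cmod (\<Sum>n. d n * \<zeta> ^ n))\<^sup>2 * g (cmod \<zeta>)) \<partial>?M)
     = (\<integral>\<^sup>+\<zeta>. liminf (\<lambda>N. ennreal ((cmod (p N \<zeta>))\<^sup>2 * g (cmod \<zeta>))) \<partial>?M)"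
    by (rule nn_integral_cong) (rule lim)
  also have "\<dots> \<le> liminf (\<lambda>N. \<integral>\<^sup>+\<zeta>. ennreal ((cmod (p N \<zeta>))\<^sup>2 * g (cmod \<zeta>)) \<partial>?M)"
    using pm gm by (intro nn_integral_liminf) auto
  also have "\<dots> \<le> ?R"
    by (rule Liminf_le) (use bound in auto)
  finally show ?thesis .
qed

section \<open>Power series of the Bergman projection\<close>

text \<open>The reciprocal of the squared norm of the monomial of degree n in the Bergman space of
  \<omega>.\<close>

definition kernel_coeff :: "(real \<Rightarrow> real) \<Rightarrow> nat \<Rightarrow> real" where
  "kernel_coeff \<omega> n = 1 / (2 * real_moment \<omega> (2 * real n + 1))"

text \<open>The derivative of \<open>cnj (bergman_kernel \<omega> z \<zeta>)\<close> with respect to \<open>z\<close> is \<open>cnj \<zeta> * kernel_deriv \<omega> (z * cnj \<zeta>)\<close>.\<close>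

definition kernel_deriv :: "(real \<Rightarrow> real) \<Rightarrow> complex \<Rightarrow> complex" where
  "kernel_deriv \<omega> w = (\<Sum>n. diffs (\<lambda>n. complex_of_real (kernel_coeff \<omega> n)) n * w ^ n)"

lemma kernel_coeff_pos:
  assumes "radial_weight \<omega>"
  shows "kernel_coeff \<omega> n > 0"
  using real_moment_pos[OF assms, of "2 * real n + 1"] by (simp add: kernel_coeff_def)

text \<open>For every t < 1 the moments are at least a multiple of \<open>t ^ (2 * n + 1)\<close>,
  so they decay more slowly than any geometric sequence. Taking \<open>t\<^sup>2\<close> halfway
  between \<open>cmod w\<close> and 1 leaves a convergent geometric majorant.\<close>

lemma summable_kernel_coeff:
  assumes w: "radial_weight \<omega>" and z: "cmod w < 1"
  shows "summable (\<lambda>n. complex_of_real (kernel_coeff \<omega> n) * w ^ n)"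
proof -
  define t where "t = sqrt ((1 + cmod w) / 2)"
  have t2: "t\<^sup>2 = (1 + cmod w) / 2" by (simp add: t_def)
  have t: "0 < t" "t < 1" using z by (auto simp: t_def add_pos_nonneg)
  have "cmod w < t\<^sup>2" using t2 z by simp
  hence q: "cmod w / t\<^sup>2 < 1" using t by simp
  have T: "0 < tail \<omega> t" using t by (intro tail_pos[OF w]) auto
  show ?thesis
  proof (rule summable_comparison_test')
    show "summable (\<lambda>n. 1 / (2 * (t * tail \<omega> t)) * (cmod w / t\<^sup>2) ^ n)"
      using q by (intro summable_mult summable_geometric) auto
    fix n :: nat
    have "t powr (2 * real n + 1) * tail \<omega> t \<le> real_moment \<omega> (2 * real n + 1)"
      using t by (intro powr_mult_tail_le_real_moment[OF w]) auto
    also have "t powr (2 * real n + 1) = t powr real (2 * n + 1)" by (simp add: add.commute)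
    also have "\<dots> = t ^ (2 * n + 1)" by (rule powr_realpow[OF t(1)])
    also have "\<dots> = (t\<^sup>2) ^ n * t" by (simp only: power_add power_mult power_one_right)
    finally have le: "(t\<^sup>2) ^ n * t * tail \<omega> t \<le> real_moment \<omega> (2 * real n + 1)" .
    have pos: "0 < (t\<^sup>2) ^ n * t * tail \<omega> t" using t T by simp
    have "kernel_coeff \<omega> n \<le> 1 / (2 * ((t\<^sup>2) ^ n * t * tail \<omega> t))"
      unfolding kernel_coeff_def using le pos by (intro frac_le) auto
    hence "kernel_coeff \<omega> n * cmod w ^ n \<le> 1 / (2 * ((t\<^sup>2) ^ n * t * tail \<omega> t)) * cmod w ^ n"
      by (intro mult_right_mono) auto
    also have "\<dots> = 1 / (2 * (t * tail \<omega> t)) * (cmod w / t\<^sup>2) ^ n"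
      by (simp add: power_divide)
    finally show "norm (complex_of_real (kernel_coeff \<omega> n) * w ^ n) \<le> 1 / (2 * (t * tail \<omega> t)) * (cmod w / t\<^sup>2) ^ n"
      using kernel_coeff_pos[OF w, of n] by (simp add: norm_mult norm_power)
  qed
qed

lemma cnj_bergman_kernel:
  assumes w: "radial_weight \<omega>" and z: "cmod z < 1" "cmod \<zeta> < 1"
  shows "cnj (bergman_kernel \<omega> z \<zeta>) = (\<Sum>n. complex_of_real (kernel_coeff \<omega> n) * (z * cnj \<zeta>) ^ n)"
proof -
  have n: "cmod (cnj z * \<zeta>) < 1"
    using norm_mult_less[of "cnj z" 1 \<zeta> 1] z by simp
  have "bergman_kernel \<omega> z \<zeta> = (\<Sum>n. complex_of_real (kernel_coeff \<omega> n) * (cnj z * \<zeta>) ^ n)"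
    unfolding bergman_kernel_def
  proof (rule suminf_cong)
    fix n
    have "enn2real (moment \<omega> (2 * real n + 1)) = real_moment \<omega> (2 * real n + 1)"
      by (subst moment_eq_ennreal[OF w]) (auto simp: real_moment_nonneg)
    thus "(cnj z * \<zeta>) ^ n / complex_of_real (2 * enn2real (moment \<omega> (2 * real n + 1)))
        = complex_of_real (kernel_coeff \<omega> n) * (cnj z * \<zeta>) ^ n"
      by (simp only: kernel_coeff_def) simp
  qed
  also have "(\<lambda>n. complex_of_real (kernel_coeff \<omega> n) * (cnj z * \<zeta>) ^ n) sums \<dots>"
    by (rule summable_sums[OF summable_kernel_coeff[OF w n]])
  hence "(\<lambda>n. cnj (complex_of_real (kernel_coeff \<omega> n) * (cnj z * \<zeta>) ^ n)) sums
      cnj (\<Sum>n. complex_of_real (kernel_coeff \<omega> n) * (cnj z * \<zeta>) ^ n)"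
    by (simp only: sums_cnj)
  finally show ?thesis by (simp add: sums_iff)
qed

text \<open>Sum and integral may be interchanged because powers of \<open>cnj \<zeta>\<close> are
  bounded by 1 on the disc: the terms are dominated by
  \<open>norm (e n * z ^ n) * norm (G \<zeta>)\<close>, whose first factor is summable.\<close>

lemma
  fixes e :: "nat \<Rightarrow> complex" and G :: "complex \<Rightarrow> complex"
  assumes G: "integrable (lebesgue_on unit_disc) G"
    and e: "\<And>w. cmod w < 1 \<Longrightarrow> summable (\<lambda>n. e n * w ^ n)" and z: "cmod z < 1"
  shows integrable_disc_power_series:
      "integrable (lebesgue_on unit_disc) (\<lambda>\<zeta>. G \<zeta> * (\<Sum>n. e n * (z * cnj \<zeta>) ^ n))"
    and sums_integral_disc_power_series:
      "(\<lambda>n. (e n * (\<integral>\<zeta>. G \<zeta> * cnj \<zeta> ^ n \<partial>lebesgue_on unit_disc)) * z ^ n) sums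
        (\<integral>\<zeta>. G \<zeta> * (\<Sum>n. e n * (z * cnj \<zeta>) ^ n) \<partial>lebesgue_on unit_disc)"
proof -
  let ?M = "lebesgue_on unit_disc"
  have m: "(\<lambda>\<zeta>. cnj \<zeta> ^ n) \<in> borel_measurable ?M" for n
    by (intro borel_measurable_lebesgue_on borel_measurable_continuous_onI continuous_intros)
  have pow: "norm (cnj \<zeta> ^ n) \<le> 1" if "\<zeta> \<in> space ?M" for \<zeta> n
    using that by (auto simp: space_restrict_space norm_power intro!: power_le_one)
  have Gi: "integrable ?M (\<lambda>\<zeta>. G \<zeta> * cnj \<zeta> ^ n)" for n
    using integrable_bounded_times[OF G m pow] by (simp add: mult.commute)
  define f where "f n \<zeta> = (e n * z ^ n) * (G \<zeta> * cnj \<zeta> ^ n)" for n \<zeta>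
  have fi: "integrable ?M (f n)" for n unfolding f_def using Gi by simp
  have abs: "summable (\<lambda>n. norm (e n * z ^ n))"
  proof -
    define x where "x = complex_of_real ((1 + cmod z) / 2)"
    have "cmod x = (1 + cmod z) / 2" unfolding x_def norm_of_real by simp
    hence x: "cmod z < cmod x" "cmod x < 1" using z by simp_all
    show ?thesis by (rule powser_insidea[OF e[OF x(2)] x(1)])
  qed
  have fle: "norm (f n \<zeta>) \<le> norm (e n * z ^ n) * norm (G \<zeta>)" if "\<zeta> \<in> space ?M" for n \<zeta>
    unfolding f_def norm_mult[of "e n * z ^ n"]
    using pow[OF that, of n] by (intro mult_left_mono) (auto simp: norm_mult mult_left_le)
  have s1: "summable (\<lambda>n. norm (f n \<zeta>))" if "\<zeta> \<in> space ?M" for \<zeta>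
    by (rule summable_comparison_test'[OF summable_mult2[OF abs]]) (use fle[OF that] in simp)
  have s2: "summable (\<lambda>n. \<integral>\<zeta>. norm (f n \<zeta>) \<partial>?M)"
  proof (rule summable_comparison_test'[OF summable_mult2[OF abs]])
    fix n
    have "(\<integral>\<zeta>. norm (f n \<zeta>) \<partial>?M) \<le> (\<integral>\<zeta>. norm (e n * z ^ n) * norm (G \<zeta>) \<partial>?M)"
      using fi G fle by (intro integral_mono) auto
    thus "norm (\<integral>\<zeta>. norm (f n \<zeta>) \<partial>?M) \<le> norm (e n * z ^ n) * (\<integral>\<zeta>. norm (G \<zeta>) \<partial>?M)"
      by simp
  qed
  have eq: "(\<Sum>n. f n \<zeta>) = G \<zeta> * (\<Sum>n. e n * (z * cnj \<zeta>) ^ n)" if "\<zeta> \<in> space ?M" for \<zeta>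
  proof -
    have "cmod \<zeta> < 1" using that by (simp add: space_restrict_space)
    hence "cmod (z * cnj \<zeta>) < 1"
      using norm_mult_less[of z 1 "cnj \<zeta>" 1] z by simp
    from suminf_mult[OF e[OF this], of "G \<zeta>"] show ?thesis
      by (simp add: f_def power_mult_distrib mult_ac)
  qed
  have "integrable ?M (\<lambda>\<zeta>. \<Sum>n. f n \<zeta>)"
    using fi s1 s2 by (intro integrable_suminf) auto
  thus "integrable ?M (\<lambda>\<zeta>. G \<zeta> * (\<Sum>n. e n * (z * cnj \<zeta>) ^ n))"
    by (subst Bochner_Integration.integrable_cong[OF refl eq[symmetric]])
  have "(\<lambda>n. integral\<^sup>L ?M (f n)) sums (\<integral>\<zeta>. (\<Sum>n. f n \<zeta>) \<partial>?M)"
    using fi s1 s2 by (intro sums_integral) auto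
  also have "(\<lambda>n. integral\<^sup>L ?M (f n)) = (\<lambda>n. (e n * (\<integral>\<zeta>. G \<zeta> * cnj \<zeta> ^ n \<partial>?M)) * z ^ n)"
    unfolding f_def integral_mult_right_zero by (simp only: mult_ac)
  also have "(\<integral>\<zeta>. (\<Sum>n. f n \<zeta>) \<partial>?M) = (\<integral>\<zeta>. G \<zeta> * (\<Sum>n. e n * (z * cnj \<zeta>) ^ n) \<partial>?M)"
    by (rule Bochner_Integration.integral_cong[OF refl eq])
  finally show "(\<lambda>n. (e n * (\<integral>\<zeta>. G \<zeta> * cnj \<zeta> ^ n \<partial>?M)) * z ^ n) sums
        (\<integral>\<zeta>. G \<zeta> * (\<Sum>n. e n * (z * cnj \<zeta>) ^ n) \<partial>?M)" .
qed

section \<open>Taylor coefficients and derivative of the projection\<close>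

definition projection_coeff :: "(real \<Rightarrow> real) \<Rightarrow> (complex \<Rightarrow> complex) \<Rightarrow> nat \<Rightarrow> complex" where
  "projection_coeff \<omega> f n = of_real (1 / pi) * (of_real (kernel_coeff \<omega> n) *
     (\<integral>\<zeta>. f \<zeta> * of_real (\<omega> (cmod \<zeta>)) * cnj \<zeta> ^ n \<partial>lebesgue_on unit_disc))"

lemma set_integral_disc: 
  fixes F :: "complex \<Rightarrow> complex"
  shows "set_lebesgue_integral lebesgue unit_disc F = integral\<^sup>L (lebesgue_on unit_disc) F"
    and "set_integrable lebesgue unit_disc F \<longleftrightarrow> integrable (lebesgue_on unit_disc) F"
  by (simp_all add: set_lebesgue_integral_def set_integrable_def integral_restrict_space integrable_restrict_space)

context
  fixes \<omega> :: "real \<Rightarrow> real" and f :: "complex \<Rightarrow> complex"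
  assumes w: "radial_weight \<omega>"
    and G: "integrable (lebesgue_on unit_disc) (\<lambda>\<zeta>. f \<zeta> * of_real (\<omega> (cmod \<zeta>)))"
begin

lemma projection_integrand_eq:
  assumes "cmod z < 1" "\<zeta> \<in> space (lebesgue_on unit_disc)"
  shows "projection_integrand \<omega> f z \<zeta> =
     (f \<zeta> * of_real (\<omega> (cmod \<zeta>))) * (\<Sum>n. complex_of_real (kernel_coeff \<omega> n) * (z * cnj \<zeta>) ^ n)"
proof -
  have "cmod \<zeta> < 1" using assms by (simp add: space_restrict_space)
  from cnj_bergman_kernel[OF w assms(1) this] show ?thesis
    by (simp add: projection_integrand_def mult_ac)
qed

lemma projection_integrand_integrable:
  assumes "cmod z < 1"
  shows "set_integrable lebesgue unit_disc (projection_integrand \<omega> f z)"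
  unfolding set_integral_disc
  using integrable_disc_power_series[OF G summable_kernel_coeff[OF w] assms]
  by (subst Bochner_Integration.integrable_cong[OF refl projection_integrand_eq[OF assms]])

lemma bergman_projection_sums:
  assumes "cmod z < 1"
  shows "(\<lambda>n. projection_coeff \<omega> f n * z ^ n) sums bergman_projection \<omega> f z"
proof -
  have "(\<lambda>n. of_real (1 / pi) * ((of_real (kernel_coeff \<omega> n) *
     (\<integral>\<zeta>. f \<zeta> * of_real (\<omega> (cmod \<zeta>)) * cnj \<zeta> ^ n \<partial>lebesgue_on unit_disc)) * z ^ n)) sums
     (of_real (1 / pi) * integral\<^sup>L (lebesgue_on unit_disc) (projection_integrand \<omega> f z))"
    by (subst Bochner_Integration.integral_cong[OF refl projection_integrand_eq[OF assms]], assumption)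
       (rule sums_mult[OF sums_integral_disc_power_series[OF G summable_kernel_coeff[OF w] assms]])
  thus ?thesis
    unfolding bergman_projection_def set_integral_disc projection_coeff_def by (simp only: mult.assoc)
qed

lemma bergman_projection_has_derivative:
  assumes "cmod z < 1"
  shows "(bergman_projection \<omega> f has_field_derivative (\<Sum>n. diffs (projection_coeff \<omega> f) n * z ^ n)) (at z)"
proof (rule has_field_derivative_transform_within_open)
  show "((\<lambda>z. \<Sum>n. projection_coeff \<omega> f n * z ^ n) has_field_derivative
      (\<Sum>n. diffs (projection_coeff \<omega> f) n * z ^ n)) (at z)"
    by (rule termdiffs_strong'[OF _ assms]) (rule sums_summable[OF bergman_projection_sums])
  show "open unit_disc" "z \<in> unit_disc" using assms by auto
  show "(\<Sum>n. projection_coeff \<omega> f n * x ^ n) = bergman_projection \<omega> f x" if "x \<in> unit_disc" for x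
    using that bergman_projection_sums[of x] by (simp add: sums_iff)
qed

lemma bergman_projection_holomorphic: "bergman_projection \<omega> f holomorphic_on unit_disc"
proof -
  have "\<exists>f'. (bergman_projection \<omega> f has_field_derivative f') (at z)" if "z \<in> unit_disc" for z
    using bergman_projection_has_derivative[of z] that by auto
  thus ?thesis by (simp add: holomorphic_on_open)
qed

text \<open>Differentiation under the integral sign by comparing power series: the extra factor
  \<open>cnj \<zeta>\<close> shifts the power in the coefficient integrals by one, just as
  \<open>diffs\<close> shifts the coefficients.\<close>

lemma deriv_bergman_projection:
  assumes "cmod z < 1"
  shows "deriv (bergman_projection \<omega> f) z = of_real (1 / pi) *
     (\<integral>\<zeta>. f \<zeta> * of_real (\<omega> (cmod \<zeta>)) * cnj \<zeta> * kernel_deriv \<omega> (z * cnj \<zeta>) \<partial>lebesgue_on unit_disc)"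
proof -
  let ?M = "lebesgue_on unit_disc"
  let ?c = "\<lambda>n. complex_of_real (kernel_coeff \<omega> n)"
  have m: "cnj \<in> borel_measurable ?M"
    by (intro borel_measurable_lebesgue_on borel_measurable_continuous_onI continuous_intros)
  have G': "integrable ?M (\<lambda>\<zeta>. f \<zeta> * of_real (\<omega> (cmod \<zeta>)) * cnj \<zeta>)"
    using integrable_bounded_times[OF G m, of 1] by (simp add: space_restrict_space mult.commute)
  have dc: "summable (\<lambda>n. diffs ?c n * w ^ n)" if "cmod w < 1" for w
    using that by (intro termdiff_converges[of w 1] summable_kernel_coeff[OF w])
  have "(\<lambda>n. of_real (1 / pi) * ((diffs ?c n * (\<integral>\<zeta>. f \<zeta> * of_real (\<omega> (cmod \<zeta>)) * cnj \<zeta> * cnj \<zeta> ^ n \<partial>?M)) * z ^ n)) sums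
      (of_real (1 / pi) * (\<integral>\<zeta>. f \<zeta> * of_real (\<omega> (cmod \<zeta>)) * cnj \<zeta> * (\<Sum>n. diffs ?c n * (z * cnj \<zeta>) ^ n) \<partial>?M))"
    by (rule sums_mult[OF sums_integral_disc_power_series[OF G' dc assms]])
  also have "(\<lambda>n. of_real (1 / pi) * ((diffs ?c n * (\<integral>\<zeta>. f \<zeta> * of_real (\<omega> (cmod \<zeta>)) * cnj \<zeta> * cnj \<zeta> ^ n \<partial>?M)) * z ^ n))
     = (\<lambda>n. diffs (projection_coeff \<omega> f) n * z ^ n)"
    by (simp add: fun_eq_iff diffs_def projection_coeff_def mult_ac)
  finally show ?thesis
    using DERIV_imp_deriv[OF bergman_projection_has_derivative[OF assms]]
    by (simp add: sums_iff kernel_deriv_def)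
qed

end

section \<open>Mean of the kernel derivative\<close>

text \<open>Powers of r decrease, so n copies of r^n are at most the geometric sum of the first n
  powers.\<close>

lemma nat_times_power_le:
  fixes r :: real
  assumes "0 \<le> r" "r \<le> 1"
  shows "real n * r ^ n * (1 - r) \<le> 1"
proof -
  have "real n * r ^ n = (\<Sum>i<n. r ^ n)" by simp
  also have "\<dots> \<le> (\<Sum>i<n. r ^ i)" using assms by (intro sum_mono power_decreasing) auto
  finally have "real n * r ^ n * (1 - r) \<le> (\<Sum>i<n. r ^ i) * (1 - r)"
    using assms by (intro mult_right_mono) auto
  also have "\<dots> = 1 - r ^ n" by (simp add: one_diff_power_eq mult.commute)
  also have "\<dots> \<le> 1" using assms by simp
  finally show ?thesis .
qed

text \<open>Factor the difference as r^(n+1) times r^n (1 - r) (1 + r). The last two factors of the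
  order, spent on n r^n (1 - r) <= 1, absorb the n; the price is that the order drops from 2 n + 1
  to n + 1.\<close>

lemma real_moment_difference_le:
  assumes w: "radial_weight \<omega>"
  shows "real n * (real_moment \<omega> (2 * real n + 1) - real_moment \<omega> (2 * real n + 3)) \<le> 2 * real_moment \<omega> (real n + 1)"
proof -
  have "real n * (r powr (2 * real n + 1) - r powr (2 * real n + 3)) \<le> 2 * r powr (real n + 1)"
    if r: "0 \<le> r" "r < 1" for r
  proof (cases "r = 0")
    case False
    hence r0: "r > 0" using r by simp
    have p1: "r powr (2 * real n + 1) = r powr (real n + 1) * r ^ n"
      using r0 by (simp add: powr_add[symmetric] powr_realpow[symmetric])
    have "r powr (2 * real n + 3) = r powr (real n + 1) * r powr real n * r powr real 2"
      unfolding powr_add[symmetric] by (rule arg_cong[where f="(powr) r"]) simp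
    hence p2: "r powr (2 * real n + 3) = r powr (real n + 1) * r ^ n * r ^ 2"
      by (simp only: powr_realpow[OF r0])
    have "real n * (r powr (2 * real n + 1) - r powr (2 * real n + 3))
        = r powr (real n + 1) * ((real n * r ^ n * (1 - r)) * (1 + r))"
      unfolding p1 p2 by (simp add: algebra_simps power2_eq_square)
    also have "\<dots> \<le> r powr (real n + 1) * (1 * 2)"
      using nat_times_power_le[of r n] r by (intro mult_left_mono mult_mono) auto
    finally show ?thesis by simp
  qed simp
  hence "(\<integral>r. real n * (r powr (2 * real n + 1) - r powr (2 * real n + 3)) \<partial>weight_measure \<omega>)
      \<le> (\<integral>r. 2 * r powr (real n + 1) \<partial>weight_measure \<omega>)"
    by (intro integral_mono integrable_mult_right Bochner_Integration.integrable_diff integrable_powr[OF w]) auto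
  thus ?thesis
    unfolding real_moment_def
    by (subst (asm) integral_mult_right_zero, subst (asm) Bochner_Integration.integral_diff)
       (auto intro!: integrable_powr[OF w])
qed

text \<open>The coefficient of u^n in \<open>(1 - u) * kernel_deriv \<omega> u\<close>, by
  \<open>kernel_deriv_times_one_minus\<close>.\<close>

definition kernel_diff_coeff :: "(real \<Rightarrow> real) \<Rightarrow> nat \<Rightarrow> real" where
  "kernel_diff_coeff \<omega> n = real (Suc n) * kernel_coeff \<omega> (Suc n) - real n * kernel_coeff \<omega> n"

text \<open>Let p and q be the moments of orders 2 n + 1 and 2 n + 3. The factor n survives only in
  n (p - q) / p, and n (p - q) is at most twice the moment of order n + 1, which doubling bounds by
  a multiple of p.\<close>

lemma kernel_diff_coeff_bound:
  assumes "\<omega> \<in> D_hat"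
  obtains D where "D > 0" "\<And>n. \<bar>kernel_diff_coeff \<omega> n\<bar> \<le> D / real_moment \<omega> (2 * real n + 3)"
proof -
  have w: "radial_weight \<omega>" using assms by (rule D_hat_imp_radial_weight)
  obtain B where B: "B > 0" "\<And>x y. x \<ge> 0 \<Longrightarrow> 0 \<le> y \<Longrightarrow> y \<le> 4 * x + 3 \<Longrightarrow> real_moment \<omega> x \<le> B * real_moment \<omega> y"
    using D_hat_real_moment_doubling[OF assms] by blast
  show ?thesis
  proof (rule that[of "1 / 2 + B"])
    show "1 / 2 + B > 0" using B by simp
    fix n
    define p q where "p = real_moment \<omega> (2 * real n + 1)" and "q = real_moment \<omega> (2 * real n + 3)"
    have pq: "0 < p" "0 < q" "q \<le> p"
      unfolding p_def q_def by (auto intro!: real_moment_pos[OF w] real_moment_antimono[OF w])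
    have "real n * (p - q) \<le> 2 * real_moment \<omega> (real n + 1)"
      unfolding p_def q_def by (rule real_moment_difference_le[OF w])
    also have "\<dots> \<le> 2 * (B * p)" unfolding p_def by (intro mult_left_mono B) auto
    finally have le: "real n * (p - q) \<le> 2 * B * p" by simp
    have "kernel_diff_coeff \<omega> n = real (Suc n) * (1 / (2 * q)) - real n * (1 / (2 * p))"
      by (simp add: kernel_diff_coeff_def kernel_coeff_def p_def q_def algebra_simps)
    also have "\<dots> = (1 / 2 + real n * (p - q) / (2 * p)) / q"
      using pq by (simp add: field_simps)
    finally have eq: "kernel_diff_coeff \<omega> n = (1 / 2 + real n * (p - q) / (2 * p)) / q" .
    have "0 \<le> real n * (p - q) / (2 * p)" "real n * (p - q) / (2 * p) \<le> B"
      using pq le by (auto simp: pos_divide_le_eq mult_ac)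
    hence "\<bar>1 / 2 + real n * (p - q) / (2 * p)\<bar> \<le> 1 / 2 + B" by simp
    thus "\<bar>kernel_diff_coeff \<omega> n\<bar> \<le> (1 / 2 + B) / real_moment \<omega> (2 * real n + 3)"
      unfolding eq q_def[symmetric] using pq by (simp add: abs_divide divide_right_mono)
  qed
qed

lemma kernel_deriv_times_one_minus:
  assumes w: "radial_weight \<omega>" and u: "cmod u < 1"
  shows "(\<lambda>n. complex_of_real (kernel_diff_coeff \<omega> n) * u ^ n) sums ((1 - u) * kernel_deriv \<omega> u)"
proof -
  let ?c = "\<lambda>n. complex_of_real (kernel_coeff \<omega> n)"
  have "summable (\<lambda>n. diffs ?c n * u ^ n)"
    using u by (intro termdiff_converges[of u 1] summable_kernel_coeff[OF w])
  hence 1: "(\<lambda>n. diffs ?c n * u ^ n) sums kernel_deriv \<omega> u"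
    unfolding kernel_deriv_def by (rule summable_sums)
  hence "(\<lambda>n. u * (diffs ?c n * u ^ n)) sums (u * kernel_deriv \<omega> u)" by (rule sums_mult)
  hence "(\<lambda>n. of_nat (Suc n) * ?c (Suc n) * u ^ Suc n) sums (u * kernel_deriv \<omega> u)"
    by (simp add: diffs_def mult_ac)
  hence 2: "(\<lambda>n. of_nat n * ?c n * u ^ n) sums (u * kernel_deriv \<omega> u)"
    by (subst (asm) sums_Suc_iff) simp
  from sums_diff[OF 1 2] show ?thesis
    by (simp add: diffs_def kernel_diff_coeff_def algebra_simps)
qed

lemma real_moment_0:
  assumes "radial_weight \<omega>"
  shows "real_moment \<omega> 0 = tail \<omega> 0"
proof -
  have "ennreal (real_moment \<omega> 0) = ennreal (tail \<omega> 0)"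
    using moment_eq_ennreal[OF assms, of 0] moment_0[of \<omega>] ennreal_tail[OF assms, of 0] by simp
  thus ?thesis using tail_pos[OF assms, of 0] real_moment_nonneg by (simp add: ennreal_inj less_imp_le)
qed

lemma power_mult_tail_sq_le:
  assumes w: "radial_weight \<omega>" and r: "0 \<le> r" "r < 1"
  shows "r ^ n * (tail \<omega> r)\<^sup>2 \<le> (real_moment \<omega> (real n / 2))\<^sup>2"
\<comment> \<open>The exponent n / 2 uses \<open>powr\<close>, and \<open>0 powr 0 = 0\<close>
  differs from \<open>0 ^ 0 = 1\<close>, so r = 0 is settled directly.\<close>
proof (cases "r = 0")
  case True
  have "(tail \<omega> 0)\<^sup>2 = (real_moment \<omega> (real 0 / 2))\<^sup>2" using real_moment_0[OF w] by simp
  thus ?thesis using True by (cases n) auto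
next
  case False
  hence r0: "0 < r" using r by simp
  have "r powr (real n / 2) * tail \<omega> r \<le> real_moment \<omega> (real n / 2)"
    using r by (intro powr_mult_tail_le_real_moment[OF w]) auto
  hence "(r powr (real n / 2) * tail \<omega> r)\<^sup>2 \<le> (real_moment \<omega> (real n / 2))\<^sup>2"
    using tail_pos[OF w r] by (intro power_mono) auto
  moreover have "(r powr (real n / 2))\<^sup>2 = r ^ n"
    using r0 by (simp add: power2_eq_square powr_add[symmetric] powr_realpow)
  ultimately show ?thesis by (simp add: power_mult_distrib)
qed

lemma sum_power_le_inverse:
  fixes r :: real
  assumes "0 \<le> r" "r < 1"
  shows "(\<Sum>n<N. r ^ n) \<le> 1 / (1 - r)"
proof -
  have "(1 - r) * (\<Sum>n<N. r ^ n) = 1 - r ^ N" by (simp add: one_diff_power_eq)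
  also have "\<dots> \<le> 1" using assms by simp
  finally show ?thesis using assms by (simp add: field_simps)
qed

text \<open>Half of \<open>r ^ (2 * n)\<close> absorbs the moment: r^n divided by the squared moment
  of order 2 n + 3 is bounded by a multiple of \<open>1 / (tail \<omega> r)\<^sup>2\<close>, by
  \<open>power_mult_tail_sq_le\<close> and doubling. The other half sums to at most 1 / (1 -
  r).\<close>

lemma kernel_diff_coeff_square_sum:
  assumes "\<omega> \<in> D_hat"
  obtains D where "D > 0"
    "\<And>r N. 0 \<le> r \<Longrightarrow> r < 1 \<Longrightarrow> (\<Sum>n<N. (kernel_diff_coeff \<omega> n)\<^sup>2 * r ^ (2 * n)) \<le> D / ((1 - r) * (tail \<omega> r)\<^sup>2)"
proof -
  have w: "radial_weight \<omega>" using assms by (rule D_hat_imp_radial_weight)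
  obtain D where D: "D > 0" "\<And>n. \<bar>kernel_diff_coeff \<omega> n\<bar> \<le> D / real_moment \<omega> (2 * real n + 3)"
    using kernel_diff_coeff_bound[OF assms] by blast
  obtain B where B: "B > 0" "\<And>x y. x \<ge> 0 \<Longrightarrow> 0 \<le> y \<Longrightarrow> y \<le> 4 * x + 3 \<Longrightarrow> real_moment \<omega> x \<le> B * real_moment \<omega> y"
    using D_hat_real_moment_doubling[OF assms] by blast
  show ?thesis
  proof (rule that[of "D\<^sup>2 * B\<^sup>2"])
    show "D\<^sup>2 * B\<^sup>2 > 0" using D B by simp
    fix r :: real and N assume r: "0 \<le> r" "r < 1"
    have T: "0 < tail \<omega> r" using tail_pos[OF w r] .
    have "(kernel_diff_coeff \<omega> n)\<^sup>2 * r ^ (2 * n) \<le> D\<^sup>2 * B\<^sup>2 / (tail \<omega> r)\<^sup>2 * r ^ n" for n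
    proof -
      define q where "q = real_moment \<omega> (2 * real n + 3)"
      have q: "0 < q" unfolding q_def by (rule real_moment_pos[OF w]) simp
      have "r ^ n * (tail \<omega> r)\<^sup>2 \<le> (real_moment \<omega> (real n / 2))\<^sup>2"
        by (rule power_mult_tail_sq_le[OF w r])
      also have "\<dots> \<le> (B * q)\<^sup>2"
        unfolding q_def by (intro power_mono B) (auto simp: real_moment_nonneg)
      finally have "r ^ n / q\<^sup>2 \<le> B\<^sup>2 / (tail \<omega> r)\<^sup>2"
        using q T by (simp add: field_simps)
      hence le: "D\<^sup>2 * (r ^ n / q\<^sup>2) * r ^ n \<le> D\<^sup>2 * (B\<^sup>2 / (tail \<omega> r)\<^sup>2) * r ^ n"
        using r by (intro mult_right_mono mult_left_mono) auto
      have "(kernel_diff_coeff \<omega> n)\<^sup>2 \<le> (D / q)\<^sup>2"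
        using D(2)[of n] power_mono[of "\<bar>kernel_diff_coeff \<omega> n\<bar>" "D / q" 2] by (simp add: q_def)
      hence "(kernel_diff_coeff \<omega> n)\<^sup>2 * r ^ (2 * n) \<le> (D / q)\<^sup>2 * r ^ (2 * n)"
        using r by (intro mult_right_mono) auto
      also have "(D / q)\<^sup>2 * r ^ (2 * n) = D\<^sup>2 * (r ^ n / q\<^sup>2) * r ^ n"
        by (simp add: power_divide mult_2 power_add)
      also note le
      finally show ?thesis by simp
    qed
    hence "(\<Sum>n<N. (kernel_diff_coeff \<omega> n)\<^sup>2 * r ^ (2 * n)) \<le> (\<Sum>n<N. D\<^sup>2 * B\<^sup>2 / (tail \<omega> r)\<^sup>2 * r ^ n)"
      by (intro sum_mono)
    also have "\<dots> = D\<^sup>2 * B\<^sup>2 / (tail \<omega> r)\<^sup>2 * (\<Sum>n<N. r ^ n)" by (simp only: sum_distrib_left)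
    also have "\<dots> \<le> D\<^sup>2 * B\<^sup>2 / (tail \<omega> r)\<^sup>2 * (1 / (1 - r))"
      by (intro mult_left_mono sum_power_le_inverse r) auto
    finally show "(\<Sum>n<N. (kernel_diff_coeff \<omega> n)\<^sup>2 * r ^ (2 * n)) \<le> D\<^sup>2 * B\<^sup>2 / ((1 - r) * (tail \<omega> r)\<^sup>2)"
      by (simp add: mult.commute)
  qed
qed

text \<open>AM-GM in place of the Cauchy-Schwarz inequality on circles, so that no polar coordinates are needed;
  it is applied with \<open>l = tail \<omega> (cmod u)\<close>, which balances the two mean squares.\<close>

lemma kernel_deriv_pointwise:
  assumes u: "cmod u < 1" and l: "0 < l"
  shows "cmod (kernel_deriv \<omega> u) \<le> ((cmod ((1 - u) * kernel_deriv \<omega> u))\<^sup>2 * l + (cmod (1 / (1 - u)))\<^sup>2 * (1 / l)) / 2"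
proof -
  define x y where "x = cmod ((1 - u) * kernel_deriv \<omega> u)" and "y = cmod (1 / (1 - u))"
  have "u \<noteq> 1" using u by auto
  hence "cmod (kernel_deriv \<omega> u) = x * y" by (simp add: x_def y_def norm_mult norm_divide)
  moreover have "2 * (x * y) \<le> x\<^sup>2 * l + y\<^sup>2 * (1 / l)"
  proof -
    have "0 \<le> (x * l - y)\<^sup>2 / l" using l by simp
    also have "\<dots> = x\<^sup>2 * l + y\<^sup>2 * (1 / l) - 2 * (x * y)"
      using l by (simp add: power2_eq_square field_simps)
    finally show ?thesis by simp
  qed
  ultimately show ?thesis by (simp add: x_def y_def)
qed

text \<open>The mean square bounds integrated against a weight \<mu>, later \<sigma>, with a
  constant independent of z. T is a Borel version of \<open>tail \<omega>\<close>, so that the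
  integrand with the scaled argument is measurable.\<close>

lemma kernel_deriv_disc_integral:
  assumes w: "\<omega> \<in> D_hat" and m: "radial_weight \<mu>"
  obtains D where "D > 0" 
    "\<And>z T. cmod z < 1 \<Longrightarrow> T \<in> borel_measurable borel \<Longrightarrow> (\<And>r. 0 \<le> r \<Longrightarrow> r < 1 \<Longrightarrow> tail \<omega> r = T r) \<Longrightarrow>
      (\<integral>\<^sup>+\<zeta>. ennreal (cmod (kernel_deriv \<omega> (z * cnj \<zeta>)) * \<mu> (cmod \<zeta>)) \<partial>lebesgue_on unit_disc)
       \<le> ennreal D * (\<integral>\<^sup>+r. ennreal (1 / ((1 - cmod z * r) * T (cmod z * r))) \<partial>weight_measure \<mu>)"
proof -
  have w': "radial_weight \<omega>" using w by (rule D_hat_imp_radial_weight)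
  obtain D where D: "D > 0"
    "\<And>r N. 0 \<le> r \<Longrightarrow> r < 1 \<Longrightarrow> (\<Sum>n<N. (kernel_diff_coeff \<omega> n)\<^sup>2 * r ^ (2 * n)) \<le> D / ((1 - r) * (tail \<omega> r)\<^sup>2)"
    using kernel_diff_coeff_square_sum[OF w] by blast
  show ?thesis
  proof (rule that[of "2 * pi * ((D + 1) / 2)"])
    show "2 * pi * ((D + 1) / 2) > 0" using D by simp
    fix z :: complex and T :: "real \<Rightarrow> real"
    assume z: "cmod z < 1" and T: "T \<in> borel_measurable borel"
      and tT: "\<And>r. 0 \<le> r \<Longrightarrow> r < 1 \<Longrightarrow> tail \<omega> r = T r"
    let ?M = "lebesgue_on unit_disc"
    define a where "a = cmod z"
    define U where "U r = T (a * r)" for r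
    have a: "0 \<le> a" "a < 1" using z by (auto simp: a_def)
    have ar: "0 \<le> a * r" "a * r \<le> a" "a * r < 1" if "0 \<le> r" "r < 1" for r
      using a that mult_left_mono[of r 1 a] by auto
    have Um: "U \<in> borel_measurable borel" unfolding U_def by (intro measurable_compose[OF _ T]) simp
    have U: "tail \<omega> a \<le> U r" "U r \<le> tail \<omega> 0" "0 < U r" "U r = tail \<omega> (a * r)" if r: "0 \<le> r" "r < 1" for r
    proof -
      show eq: "U r = tail \<omega> (a * r)" unfolding U_def using tT[OF ar(1,3)[OF r]] by simp
      show "tail \<omega> a \<le> U r" "U r \<le> tail \<omega> 0" "0 < U r"
        unfolding eq using ar[OF r] a by (auto intro!: tail_antimono[OF w'] tail_pos[OF w'])
    qed
    have sp: "0 \<le> cmod \<zeta>" "cmod \<zeta> < 1" if "\<zeta> \<in> space ?M" for \<zeta> using that by (auto simp: space_restrict_space)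
    have nz: "cmod (z * cnj \<zeta>) < 1" if "\<zeta> \<in> space ?M" for \<zeta>
      using ar(3)[OF sp[OF that]] by (simp add: norm_mult a_def)
    \<comment> \<open>The AM-GM parameter and its inverse are absorbed into the radial weight. Both
      products stay integrable because U lies between the positive constants
      \<open>tail \<omega> a\<close> and \<open>tail \<omega> 0\<close>.\<close>
    define g1 where "g1 r = U r * \<mu> r" for r
    define g2 where "g2 r = 1 / U r * \<mu> r" for r
    have mu: "integrable ?M (\<lambda>\<zeta>. \<mu> (cmod \<zeta>))" by (rule integrable_disc_weight[OF m])
    have mu0: "0 \<le> \<mu> r" if "0 \<le> r" "r < 1" for r using radial_weight_nonneg[OF m that] .
    have g1: "integrable ?M (\<lambda>\<zeta>. g1 (cmod \<zeta>))"
      unfolding g1_def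
    proof (rule integrable_bounded_times[OF mu borel_cmod_measurable[OF Um]])
      show "norm (U (cmod \<zeta>)) \<le> tail \<omega> 0" if "\<zeta> \<in> space ?M" for \<zeta>
        using U[OF sp[OF that]] by simp
    qed
    have Um': "(\<lambda>r. 1 / U r) \<in> borel_measurable borel" using Um by simp
    have g2: "integrable ?M (\<lambda>\<zeta>. g2 (cmod \<zeta>))"
      unfolding g2_def
    proof (rule integrable_bounded_times[OF mu borel_cmod_measurable[OF Um']])
      show "norm (1 / U (cmod \<zeta>)) \<le> 1 / tail \<omega> a" if "\<zeta> \<in> space ?M" for \<zeta>
        using U[OF sp[OF that]] tail_pos[OF w' a] by (simp add: frac_le)
    qed
    have g10: "0 \<le> g1 r" and g20: "0 \<le> g2 r" if "0 \<le> r" "r < 1" for r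
      using mu0[OF that] U[OF that] by (auto simp: g1_def g2_def)
    \<comment> \<open>The series is in powers of \<open>z * cnj \<zeta>\<close>; its conjugate is a
      power series in \<zeta> with the same modulus, as Parseval's inequality expects.\<close>
    define d1 where "d1 n = complex_of_real (kernel_diff_coeff \<omega> n) * cnj z ^ n" for n
    define S1 where "S1 r = D / ((1 - a * r) * (U r)\<^sup>2)" for r
    define S2 where "S2 r = 1 / (1 - a * r)" for r
    have L: "(\<lambda>n. d1 n * \<zeta> ^ n) sums cnj ((1 - z * cnj \<zeta>) * kernel_deriv \<omega> (z * cnj \<zeta>))" if "\<zeta> \<in> space ?M" for \<zeta>
    proof -
      have "(\<lambda>n. cnj (complex_of_real (kernel_diff_coeff \<omega> n) * (z * cnj \<zeta>) ^ n)) sums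
        cnj ((1 - z * cnj \<zeta>) * kernel_deriv \<omega> (z * cnj \<zeta>))"
        unfolding sums_cnj by (rule kernel_deriv_times_one_minus[OF w' nz[OF that]])
      thus ?thesis by (simp add: d1_def power_mult_distrib mult_ac)
    qed
    have Q: "(\<lambda>n. cnj z ^ n * \<zeta> ^ n) sums cnj (1 / (1 - z * cnj \<zeta>))" if "\<zeta> \<in> space ?M" for \<zeta>
      using geometric_sums[of "cnj z * \<zeta>"] nz[OF that] by (simp add: power_mult_distrib norm_mult)
    have I1: "(\<integral>\<^sup>+\<zeta>. ennreal ((cmod ((1 - z * cnj \<zeta>) * kernel_deriv \<omega> (z * cnj \<zeta>)))\<^sup>2 * g1 (cmod \<zeta>)) \<partial>?M)
        \<le> (\<integral>\<^sup>+\<zeta>. ennreal (S1 (cmod \<zeta>) * g1 (cmod \<zeta>)) \<partial>?M)"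
    proof -
      have "(\<integral>\<^sup>+\<zeta>. ennreal ((cmod (\<Sum>n. d1 n * \<zeta> ^ n))\<^sup>2 * g1 (cmod \<zeta>)) \<partial>?M)
        \<le> (\<integral>\<^sup>+\<zeta>. ennreal (S1 (cmod \<zeta>) * g1 (cmod \<zeta>)) \<partial>?M)"
      proof (rule nn_integral_disc_power_series_square[OF g1 g10])
        show "summable (\<lambda>n. d1 n * \<zeta> ^ n)" if "cmod \<zeta> < 1" for \<zeta>
          using L[of \<zeta>] that by (auto simp: space_restrict_space sums_iff)
        show "(\<Sum>n<N. (cmod (d1 n))\<^sup>2 * r ^ (2 * n)) \<le> S1 r" if r: "0 \<le> r" "r < 1" for r N
          using D(2)[OF ar(1,3)[OF r], of N]
          by (simp add: S1_def U(4)[OF r] d1_def norm_mult norm_power a_def power_mult_distrib power_mult[symmetric] mult.commute mult.left_commute)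
      qed
      also have "(\<integral>\<^sup>+\<zeta>. ennreal ((cmod (\<Sum>n. d1 n * \<zeta> ^ n))\<^sup>2 * g1 (cmod \<zeta>)) \<partial>?M)
        = (\<integral>\<^sup>+\<zeta>. ennreal ((cmod ((1 - z * cnj \<zeta>) * kernel_deriv \<omega> (z * cnj \<zeta>)))\<^sup>2 * g1 (cmod \<zeta>)) \<partial>?M)"
        by (rule nn_integral_cong) (simp only: sums_unique[OF L, symmetric] complex_mod_cnj)
      finally show ?thesis .
    qed
    have I2: "(\<integral>\<^sup>+\<zeta>. ennreal ((cmod (1 / (1 - z * cnj \<zeta>)))\<^sup>2 * g2 (cmod \<zeta>)) \<partial>?M)
        \<le> (\<integral>\<^sup>+\<zeta>. ennreal (S2 (cmod \<zeta>) * g2 (cmod \<zeta>)) \<partial>?M)"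
    proof -
      have "(\<integral>\<^sup>+\<zeta>. ennreal ((cmod (\<Sum>n. cnj z ^ n * \<zeta> ^ n))\<^sup>2 * g2 (cmod \<zeta>)) \<partial>?M)
        \<le> (\<integral>\<^sup>+\<zeta>. ennreal (S2 (cmod \<zeta>) * g2 (cmod \<zeta>)) \<partial>?M)"
      proof (rule nn_integral_disc_power_series_square[OF g2 g20])
        show "summable (\<lambda>n. cnj z ^ n * \<zeta> ^ n)" if "cmod \<zeta> < 1" for \<zeta>
          using Q[of \<zeta>] that by (auto simp: space_restrict_space sums_iff)
        show "(\<Sum>n<N. (cmod (cnj z ^ n))\<^sup>2 * r ^ (2 * n)) \<le> S2 r" if r: "0 \<le> r" "r < 1" for r N
        proof -
          have "(\<Sum>n<N. (cmod (cnj z ^ n))\<^sup>2 * r ^ (2 * n)) = (\<Sum>n<N. (a * r) ^ (2 * n))"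
            by (simp add: norm_power a_def power_mult_distrib power_mult[symmetric] mult.commute)
          also have "\<dots> \<le> (\<Sum>n<N. (a * r) ^ n)"
            using ar[OF r] by (intro sum_mono power_decreasing) auto
          also have "\<dots> \<le> S2 r" unfolding S2_def by (rule sum_power_le_inverse[OF ar(1,3)[OF r]])
          finally show ?thesis .
        qed
      qed
      also have "(\<integral>\<^sup>+\<zeta>. ennreal ((cmod (\<Sum>n. cnj z ^ n * \<zeta> ^ n))\<^sup>2 * g2 (cmod \<zeta>)) \<partial>?M)
        = (\<integral>\<^sup>+\<zeta>. ennreal ((cmod (1 / (1 - z * cnj \<zeta>)))\<^sup>2 * g2 (cmod \<zeta>)) \<partial>?M)"
        by (rule nn_integral_cong) (simp only: sums_unique[OF Q, symmetric] complex_mod_cnj)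
      finally show ?thesis .
    qed
    \<comment> \<open>\<open>S1 r * g1 r\<close> and \<open>S2 r * g2 r\<close> both equal
      \<open>h r * \<mu> r\<close> up to the factor D: this is the balance behind the choice of
      U.\<close>
    define h where "h r = 1 / ((1 - a * r) * U r)" for r
    have hm: "(\<lambda>r. ennreal (h r)) \<in> borel_measurable borel"
      unfolding h_def using Um by (intro measurable_compose[OF _ measurable_ennreal]) simp
    have h0: "0 \<le> h r" if "0 \<le> r" "r < 1" for r
      using U(3)[OF that] ar(3)[OF that] by (simp add: h_def)
    define X where "X = (\<integral>\<^sup>+\<zeta>. ennreal (\<mu> (cmod \<zeta>)) * ennreal (h (cmod \<zeta>)) \<partial>?M)"
    have hm': "(\<lambda>\<zeta>. ennreal (\<mu> (cmod \<zeta>)) * ennreal (h (cmod \<zeta>))) \<in> borel_measurable ?M"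
      by (intro borel_measurable_times_ennreal borel_cmod_measurable[OF hm]
          measurable_compose[OF radial_weight_cmod_measurable[OF m] measurable_ennreal])
    have J1: "(\<integral>\<^sup>+\<zeta>. ennreal (S1 (cmod \<zeta>) * g1 (cmod \<zeta>)) \<partial>?M) = ennreal D * X"
    proof -
      have "(\<integral>\<^sup>+\<zeta>. ennreal (S1 (cmod \<zeta>) * g1 (cmod \<zeta>)) \<partial>?M)
        = (\<integral>\<^sup>+\<zeta>. ennreal D * (ennreal (\<mu> (cmod \<zeta>)) * ennreal (h (cmod \<zeta>))) \<partial>?M)"
      proof (rule nn_integral_cong)
        fix \<zeta> assume "\<zeta> \<in> space ?M"
        note r = sp[OF this]
        have "S1 (cmod \<zeta>) * g1 (cmod \<zeta>) = D * (\<mu> (cmod \<zeta>) * h (cmod \<zeta>))"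
          using U(3)[OF r] by (simp add: S1_def g1_def h_def power2_eq_square)
        thus "ennreal (S1 (cmod \<zeta>) * g1 (cmod \<zeta>)) = ennreal D * (ennreal (\<mu> (cmod \<zeta>)) * ennreal (h (cmod \<zeta>)))"
          using D(1) mu0[OF r] h0[OF r] by (simp only: ennreal_mult mult_nonneg_nonneg less_imp_le)
      qed
      also have "\<dots> = ennreal D * X" unfolding X_def by (rule nn_integral_cmult[OF hm'])
      finally show ?thesis .
    qed
    have J2: "(\<integral>\<^sup>+\<zeta>. ennreal (S2 (cmod \<zeta>) * g2 (cmod \<zeta>)) \<partial>?M) = X"
      unfolding X_def
    proof (rule nn_integral_cong)
      fix \<zeta> assume "\<zeta> \<in> space ?M"
      note r = sp[OF this]
      have "S2 (cmod \<zeta>) * g2 (cmod \<zeta>) = \<mu> (cmod \<zeta>) * h (cmod \<zeta>)"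
        by (simp add: S2_def g2_def h_def)
      thus "ennreal (S2 (cmod \<zeta>) * g2 (cmod \<zeta>)) = ennreal (\<mu> (cmod \<zeta>)) * ennreal (h (cmod \<zeta>))"
        using mu0[OF r] h0[OF r] by (simp only: ennreal_mult)
    qed
    define X1 where "X1 \<zeta> = (cmod ((1 - z * cnj \<zeta>) * kernel_deriv \<omega> (z * cnj \<zeta>)))\<^sup>2 * g1 (cmod \<zeta>)" for \<zeta>
    define X2 where "X2 \<zeta> = (cmod (1 / (1 - z * cnj \<zeta>)))\<^sup>2 * g2 (cmod \<zeta>)" for \<zeta>
    have "(\<lambda>\<zeta>. \<Sum>n. d1 n * \<zeta> ^ n) \<in> borel_measurable borel" by measurable
    hence "(\<lambda>\<zeta>. (cmod (\<Sum>n. d1 n * \<zeta> ^ n))\<^sup>2) \<in> borel_measurable borel" by simp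
    hence "(\<lambda>\<zeta>. (cmod (\<Sum>n. d1 n * \<zeta> ^ n))\<^sup>2 * g1 (cmod \<zeta>)) \<in> borel_measurable ?M"
      by (intro borel_measurable_times[OF borel_measurable_lebesgue_on borel_measurable_integrable[OF g1]])
    also have "?this \<longleftrightarrow> X1 \<in> borel_measurable ?M"
      unfolding X1_def by (rule measurable_cong) (simp only: sums_unique[OF L, symmetric] complex_mod_cnj)
    finally have X1: "X1 \<in> borel_measurable ?M" .
    have "(\<lambda>\<zeta>. \<Sum>n. cnj z ^ n * \<zeta> ^ n) \<in> borel_measurable borel" by measurable
    hence "(\<lambda>\<zeta>. (cmod (\<Sum>n. cnj z ^ n * \<zeta> ^ n))\<^sup>2) \<in> borel_measurable borel" by simp
    hence "(\<lambda>\<zeta>. (cmod (\<Sum>n. cnj z ^ n * \<zeta> ^ n))\<^sup>2 * g2 (cmod \<zeta>)) \<in> borel_measurable ?M"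
      by (intro borel_measurable_times[OF borel_measurable_lebesgue_on borel_measurable_integrable[OF g2]])
    also have "?this \<longleftrightarrow> X2 \<in> borel_measurable ?M"
      unfolding X2_def by (rule measurable_cong) (simp only: sums_unique[OF Q, symmetric] complex_mod_cnj)
    finally have X2: "X2 \<in> borel_measurable ?M" .
    have "(\<integral>\<^sup>+\<zeta>. ennreal (cmod (kernel_deriv \<omega> (z * cnj \<zeta>)) * \<mu> (cmod \<zeta>)) \<partial>?M)
      \<le> (\<integral>\<^sup>+\<zeta>. ennreal (1 / 2) * (ennreal (X1 \<zeta>) + ennreal (X2 \<zeta>)) \<partial>?M)"
    proof (rule nn_integral_mono)
      have alg: "(x * u + y * (1 / u)) / 2 * m = 1 / 2 * (x * (u * m) + y * (1 / u * m))" for x y u m :: real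
        by (simp add: algebra_simps)
      fix \<zeta> assume \<zeta>: "\<zeta> \<in> space ?M"
      note r = sp[OF this]
      have "cmod (kernel_deriv \<omega> (z * cnj \<zeta>)) * \<mu> (cmod \<zeta>) \<le>
        (((cmod ((1 - z * cnj \<zeta>) * kernel_deriv \<omega> (z * cnj \<zeta>)))\<^sup>2 * U (cmod \<zeta>) +
          (cmod (1 / (1 - z * cnj \<zeta>)))\<^sup>2 * (1 / U (cmod \<zeta>))) / 2) * \<mu> (cmod \<zeta>)"
        by (rule mult_right_mono[OF kernel_deriv_pointwise[OF nz[OF \<zeta>] U(3)[OF r]] mu0[OF r]])
      also have "\<dots> = 1 / 2 * (X1 \<zeta> + X2 \<zeta>)"
        unfolding X1_def X2_def g1_def g2_def by (rule alg)
      finally have "ennreal (cmod (kernel_deriv \<omega> (z * cnj \<zeta>)) * \<mu> (cmod \<zeta>)) \<le> ennreal (1 / 2 * (X1 \<zeta> + X2 \<zeta>))"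
        by (rule ennreal_leI)
      also have "0 \<le> X1 \<zeta>" "0 \<le> X2 \<zeta>" using g10[OF r] g20[OF r] by (auto simp: X1_def X2_def)
      hence "ennreal (1 / 2 * (X1 \<zeta> + X2 \<zeta>)) = ennreal (1 / 2) * (ennreal (X1 \<zeta>) + ennreal (X2 \<zeta>))"
        by (simp only: ennreal_mult' ennreal_plus) 
      finally show "ennreal (cmod (kernel_deriv \<omega> (z * cnj \<zeta>)) * \<mu> (cmod \<zeta>))
        \<le> ennreal (1 / 2) * (ennreal (X1 \<zeta>) + ennreal (X2 \<zeta>))" .
    qed
    also have "\<dots> = ennreal (1 / 2) * ((\<integral>\<^sup>+\<zeta>. ennreal (X1 \<zeta>) \<partial>?M) + (\<integral>\<^sup>+\<zeta>. ennreal (X2 \<zeta>) \<partial>?M))"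
      using X1 X2 by (simp add: nn_integral_cmult nn_integral_add)
    also have "\<dots> \<le> ennreal (1 / 2) * (ennreal D * X + X)"
      using I1 I2 unfolding J1 J2 X1_def[symmetric] X2_def[symmetric] by (intro mult_left_mono add_mono) auto
    also have "\<dots> = ennreal ((D + 1) / 2) * X"
    proof -
      have "ennreal ((D + 1) / 2) = ennreal (1 / 2 * (D + 1))" by simp
      also have "\<dots> = ennreal (1 / 2) * ennreal (D + 1)" using D(1) by (intro ennreal_mult) auto
      also have "ennreal (D + 1) = ennreal D + 1" using D(1) by (simp add: ennreal_plus)
      finally have "ennreal ((D + 1) / 2) = ennreal (1 / 2) * (ennreal D + 1)" .
      thus ?thesis by (simp add: distrib_right mult.assoc)
    qed
    also have "\<dots> \<le> ennreal ((D + 1) / 2) * (ennreal (2 * pi) * (\<integral>\<^sup>+r. ennreal (h r) \<partial>weight_measure \<mu>))"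
      unfolding X_def by (intro mult_left_mono nn_integral_disc_weight_le[OF m hm]) auto
    also have "\<dots> = ennreal (2 * pi * ((D + 1) / 2)) * (\<integral>\<^sup>+r. ennreal (h r) \<partial>weight_measure \<mu>)"
      using D(1) by (simp only: ennreal_mult' mult.assoc mult.left_commute pi_ge_zero)
    finally show "(\<integral>\<^sup>+\<zeta>. ennreal (cmod (kernel_deriv \<omega> (z * cnj \<zeta>)) * \<mu> (cmod \<zeta>)) \<partial>?M)
       \<le> ennreal (2 * pi * ((D + 1) / 2)) * (\<integral>\<^sup>+r. ennreal (1 / ((1 - cmod z * r) * T (cmod z * r))) \<partial>weight_measure \<mu>)"
      by (simp only: h_def U_def a_def)
  qed
qed

section \<open>Radial integral of the kernel bound\<close>

lemma emeasure_weight_measure_Ico_le: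
  assumes w: "radial_weight \<omega>" and r: "0 \<le> r" "r < 1"
  shows "emeasure (weight_measure \<omega>) {r..<s} \<le> ennreal (tail \<omega> r)"
proof (cases "s \<le> 1")
  case True
  have "{r..<1} \<in> sets (weight_measure \<omega>)"
    unfolding sets_weight_measure using r by (subst sets_restrict_space_iff) auto
  hence "emeasure (weight_measure \<omega>) {r..<s} \<le> emeasure (weight_measure \<omega>) {r..<1}"
    using True by (intro emeasure_mono) auto
  thus ?thesis using emeasure_weight_measure_Ico[OF w r] by simp
next
  \<comment> \<open>For s > 1 the interval leaves the underlying space, so it is not measurable and
    has measure 0 by convention.\<close>
  case False
  hence "1 \<in> {r..<s}" using r by simp
  hence "{r..<s} \<notin> sets (weight_measure \<omega>)"
    using sets.sets_into_space[of "{r..<s}" "weight_measure \<omega>"] by auto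
  thus ?thesis by (simp add: emeasure_notin_sets)
qed

text \<open>On a block from 2 b - 1 to b the integrand is at most
  \<open>1 / ((1 - b) * tail \<omega> b)\<close>, and the mass is at most
  \<open>tail \<omega> (2 * b - 1)\<close>, hence by doubling at most
  \<open>D * tail \<omega> b\<close>. The block contributes at most D / (1 - b); as these bounds
  double from block to block, their sum is at most twice the last one.\<close>

lemma nn_integral_inverse_tail:
  assumes w: "\<omega> \<in> D_hat"
  obtains C where "C > 0" "\<And>a T. 0 \<le> a \<Longrightarrow> a < 1 \<Longrightarrow> T \<in> borel_measurable borel \<Longrightarrow>
      (\<And>r. 0 \<le> r \<Longrightarrow> r < 1 \<Longrightarrow> tail \<omega> r = T r) \<Longrightarrow>
      (\<integral>\<^sup>+r. ennreal (1 / ((1 - r) * T r)) * indicator {0..<a} r \<partial>weight_measure \<omega>) \<le> ennreal (C / (1 - a))"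
proof -
  have w': "radial_weight \<omega>" using w by (rule D_hat_imp_radial_weight)
  obtain D where D: "D \<ge> 1" "\<And>r. 0 \<le> r \<Longrightarrow> r < 1 \<Longrightarrow> tail \<omega> r \<le> D * tail \<omega> ((1 + r) / 2)"
    using D_hat_doubling[OF w] by blast
  show ?thesis
  proof (rule that[of "2 * D"])
    show "2 * D > 0" using D by simp
    fix a :: real and T :: "real \<Rightarrow> real"
    assume a01: "0 \<le> a" "a < 1" and T: "T \<in> borel_measurable borel"
      and tT: "\<And>r. 0 \<le> r \<Longrightarrow> r < 1 \<Longrightarrow> tail \<omega> r = T r"
    define I where "I a = (\<integral>\<^sup>+r. ennreal (1 / ((1 - r) * T r)) * indicator {0..<a} r \<partial>weight_measure \<omega>)" for a
    have step: "I b \<le> I c + ennreal (tail \<omega> c / ((1 - b) * tail \<omega> b))"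
      if cb: "0 \<le> c" "c \<le> b" "b < 1" for b c
    proof -
      have m: "(\<lambda>r. ennreal (1 / ((1 - r) * T r)) * indicator {0..<c} r) \<in> borel_measurable borel"
        "(\<lambda>r. ennreal (1 / ((1 - b) * tail \<omega> b)) * indicator {c..<b} r) \<in> borel_measurable borel"
        using T by auto
      have Ib: "{c..<b} \<in> sets (weight_measure \<omega>)"
        unfolding sets_weight_measure using cb by (subst sets_restrict_space_iff) auto
      have "I b \<le> (\<integral>\<^sup>+r. ennreal (1 / ((1 - r) * T r)) * indicator {0..<c} r
          + ennreal (1 / ((1 - b) * tail \<omega> b)) * indicator {c..<b} r \<partial>weight_measure \<omega>)"
        unfolding I_def
      proof (rule nn_integral_mono)
        fix r assume "r \<in> space (weight_measure \<omega>)"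
        hence r: "0 \<le> r" "r < 1" by auto
        consider "r < c" | "c \<le> r" "r < b" | "r \<ge> b" by linarith
        thus "ennreal (1 / ((1 - r) * T r)) * indicator {0..<b} r \<le> ennreal (1 / ((1 - r) * T r)) * indicator {0..<c} r
          + ennreal (1 / ((1 - b) * tail \<omega> b)) * indicator {c..<b} r"
        proof cases
          case 2
          have "1 / ((1 - r) * T r) \<le> 1 / ((1 - b) * tail \<omega> b)"
            unfolding tT[OF r, symmetric] using 2 cb r tail_pos[OF w', of b]
            by (intro frac_le mult_mono tail_antimono[OF w']) (auto intro!: mult_pos_pos less_imp_le[OF tail_pos[OF w']])
          thus ?thesis using 2 r by (simp add: ennreal_leI)
        qed (use cb r in auto)
      qed
      also have "\<dots> = I c + ennreal (1 / ((1 - b) * tail \<omega> b)) * emeasure (weight_measure \<omega>) {c..<b}"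
        unfolding I_def
        by (subst nn_integral_add[OF m[THEN borel_measurable_weight_measure]])
           (simp only: nn_integral_cmult_indicator[OF Ib])
      also have "\<dots> \<le> I c + ennreal (1 / ((1 - b) * tail \<omega> b)) * ennreal (tail \<omega> c)"
        using cb by (intro add_left_mono mult_left_mono emeasure_weight_measure_Ico_le[OF w']) auto
      also have "ennreal (1 / ((1 - b) * tail \<omega> b)) * ennreal (tail \<omega> c) = ennreal (tail \<omega> c / ((1 - b) * tail \<omega> b))"
        using cb tail_pos[OF w', of c] by (subst ennreal_mult''[symmetric]) auto
      finally show ?thesis .
    qed
    have I0: "I 0 = 0" by (simp add: I_def)
    have "I b \<le> ennreal (2 * D / (1 - b))" if "0 \<le> b" "b < 1" "1 / 2 ^ n \<le> 1 - b" for b n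
      using that
    proof (induction n arbitrary: b)
      case 0
      hence "b = 0" by simp
      thus ?case using I0 by simp
    next
      case (Suc n)
      \<comment> \<open>\<open>b\<close> is the midpoint of \<open>2 * b - 1\<close> and \<open>1\<close>, so doubling applies and the distance to \<open>1\<close> is halved.\<close>
      define c where "c = max 0 (2 * b - 1)"
      have c: "0 \<le> c" "c \<le> b" "c < 1" using Suc.prems by (auto simp: c_def)
      have "tail \<omega> c \<le> D * tail \<omega> ((1 + c) / 2)" using c by (intro D) auto
      also have "\<dots> \<le> D * tail \<omega> b"
        using Suc.prems c D by (intro mult_left_mono tail_antimono[OF w']) (auto simp: c_def)
      finally have "tail \<omega> c / ((1 - b) * tail \<omega> b) \<le> D * tail \<omega> b / ((1 - b) * tail \<omega> b)"
        using Suc.prems tail_pos[OF w', of b] by (intro divide_right_mono) auto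
      also have "\<dots> = D / (1 - b)" using Suc.prems tail_pos[OF w', of b] by simp
      finally have t: "tail \<omega> c / ((1 - b) * tail \<omega> b) \<le> D / (1 - b)" .
      have Ic: "I c \<le> ennreal (D / (1 - b))"
      proof (cases "2 * b - 1 \<le> 0")
        case True
        thus ?thesis using I0 by (simp add: c_def)
      next
        case False
        hence ceq: "c = 2 * b - 1" by (simp add: c_def)
        have "I c \<le> ennreal (2 * D / (1 - c))"
          using Suc.prems c by (intro Suc.IH) (auto simp: ceq field_simps)
        also have "2 * D / (1 - c) = D / (1 - b)" using Suc.prems by (simp add: ceq field_simps)
        finally show ?thesis .
      qed
      have "I b \<le> I c + ennreal (tail \<omega> c / ((1 - b) * tail \<omega> b))" using c Suc.prems by (intro step) auto
      also have "\<dots> \<le> ennreal (D / (1 - b)) + ennreal (D / (1 - b))"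
        using Ic t by (intro add_mono ennreal_leI)
      also have "\<dots> = ennreal (2 * D / (1 - b))"
        using D Suc.prems by (subst ennreal_plus[symmetric]) auto
      finally show ?case .
    qed
    moreover obtain n where "1 / 2 ^ n \<le> 1 - a"
      using real_arch_pow_inv[of "1 - a" "1/2"] a01 by (auto simp: power_one_over intro: less_imp_le)
    ultimately show "(\<integral>\<^sup>+r. ennreal (1 / ((1 - r) * T r)) * indicator {0..<a} r \<partial>weight_measure \<omega>) \<le> ennreal (2 * D / (1 - a))"
      using a01 unfolding I_def by blast
  qed
qed

text \<open>a r is at most a and at most r, so 1 - a r and \<open>tail \<omega> (a * r)\<close> may
  be replaced by their values at either point. For r >= a take the values at a and use the tail
  condition; for r < a take those at r and pull out \<open>1 / tail \<nu> a\<close>, which leaves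
  the integral against \<omega> of \<open>nn_integral_inverse_tail\<close>.\<close>

lemma nn_integral_quotient_kernel:
  assumes w: "\<omega> \<in> D_hat" and v: "radial_weight \<nu>" and tc: "tail_condition \<omega> \<nu>"
  obtains C where "C > 0" "\<And>a T. 0 \<le> a \<Longrightarrow> a < 1 \<Longrightarrow> T \<in> borel_measurable borel \<Longrightarrow>
      (\<And>r. 0 \<le> r \<Longrightarrow> r < 1 \<Longrightarrow> tail \<omega> r = T r) \<Longrightarrow>
      (\<integral>\<^sup>+r. ennreal (1 / ((1 - a * r) * T (a * r))) \<partial>weight_measure (weight_quotient \<omega> \<nu>))
        \<le> ennreal (C / ((1 - a) * tail \<nu> a))"
proof -
  let ?q = "weight_quotient \<omega> \<nu>"
  have w': "radial_weight \<omega>" using w by (rule D_hat_imp_radial_weight)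
  from tc obtain A where q: "radial_weight ?q" and A: "A \<ge> 0"
    "\<And>r. 0 \<le> r \<Longrightarrow> r < 1 \<Longrightarrow> tail \<nu> r * tail ?q r \<le> A * tail \<omega> r"
    unfolding tail_condition_def by blast
  obtain B where B: "B > 0" "\<And>a T. 0 \<le> a \<Longrightarrow> a < 1 \<Longrightarrow> T \<in> borel_measurable borel \<Longrightarrow>
      (\<And>r. 0 \<le> r \<Longrightarrow> r < 1 \<Longrightarrow> tail \<omega> r = T r) \<Longrightarrow>
      (\<integral>\<^sup>+r. ennreal (1 / ((1 - r) * T r)) * indicator {0..<a} r \<partial>weight_measure \<omega>) \<le> ennreal (B / (1 - a))"
    using nn_integral_inverse_tail[OF w] by blast
  show ?thesis
  proof (rule that[of "A + B"])
    show "A + B > 0" using A B by simp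
    fix a :: real and T :: "real \<Rightarrow> real"
    assume a: "0 \<le> a" "a < 1" and T: "T \<in> borel_measurable borel"
      and tT: "\<And>r. 0 \<le> r \<Longrightarrow> r < 1 \<Longrightarrow> tail \<omega> r = T r"
    have W: "0 < tail \<omega> a" and V: "0 < tail \<nu> a" using a w' v by (auto intro: tail_pos)
    define k1 k2 where "k1 r = ennreal (1 / ((1 - a) * tail \<omega> a)) * indicator {a..<1} r"
      and "k2 r = ennreal (1 / ((1 - r) * T r)) * indicator {0..<a} r" for r
    have k: "k1 \<in> borel_measurable borel" "k2 \<in> borel_measurable borel"
      unfolding k1_def k2_def using T by auto
    have "(\<integral>\<^sup>+r. ennreal (1 / ((1 - a * r) * T (a * r))) \<partial>weight_measure ?q)
      \<le> (\<integral>\<^sup>+r. k1 r + k2 r \<partial>weight_measure ?q)"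
    proof (rule nn_integral_mono)
      fix r assume "r \<in> space (weight_measure ?q)"
      hence r: "0 \<le> r" "r < 1" by auto
      have ar: "0 \<le> a * r" "a * r \<le> a" "a * r \<le> r" "a * r < 1"
        using a r mult_left_mono[of r 1 a] mult_right_mono[of a 1 r] by auto
      show "ennreal (1 / ((1 - a * r) * T (a * r))) \<le> k1 r + k2 r"
      proof (cases "a \<le> r")
        case True
        have "1 / ((1 - a * r) * T (a * r)) \<le> 1 / ((1 - a) * tail \<omega> a)"
          unfolding tT[OF ar(1,4), symmetric] using a ar W
          by (intro frac_le mult_mono tail_antimono[OF w']) auto
        thus ?thesis using True r by (simp add: k1_def k2_def ennreal_leI)
      next
        case False
        have "1 / ((1 - a * r) * T (a * r)) \<le> 1 / ((1 - r) * T r)"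
          unfolding tT[OF ar(1,4), symmetric] tT[OF r, symmetric] using r ar tail_pos[OF w' r]
          by (intro frac_le mult_mono tail_antimono[OF w']) auto
        thus ?thesis using False r by (simp add: k1_def k2_def ennreal_leI)
      qed
    qed
    also have "\<dots> = (\<integral>\<^sup>+r. k1 r \<partial>weight_measure ?q) + (\<integral>\<^sup>+r. k2 r \<partial>weight_measure ?q)"
      by (intro nn_integral_add borel_measurable_weight_measure k)
    also have "\<dots> \<le> ennreal (A / ((1 - a) * tail \<nu> a)) + ennreal (B / ((1 - a) * tail \<nu> a))"
    proof (rule add_mono)
      have Ib: "{a..<1} \<in> sets (weight_measure ?q)"
        unfolding sets_weight_measure using a by (subst sets_restrict_space_iff) auto
      have "(\<integral>\<^sup>+r. k1 r \<partial>weight_measure ?q) = ennreal (1 / ((1 - a) * tail \<omega> a)) * ennreal (tail ?q a)"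
        unfolding k1_def nn_integral_cmult_indicator[OF Ib] emeasure_weight_measure_Ico[OF q a] ..
      also have "\<dots> = ennreal (1 / ((1 - a) * tail \<omega> a) * tail ?q a)"
        using tail_pos[OF q a] by (intro ennreal_mult''[symmetric]) simp
      also have "\<dots> \<le> ennreal (A / ((1 - a) * tail \<nu> a))"
      proof (rule ennreal_leI)
        have "tail ?q a / tail \<omega> a \<le> A / tail \<nu> a"
          using A(2)[OF a] W V by (simp add: field_simps)
        hence "tail ?q a / tail \<omega> a / (1 - a) \<le> A / tail \<nu> a / (1 - a)"
          using a by (intro divide_right_mono) auto
        thus "1 / ((1 - a) * tail \<omega> a) * tail ?q a \<le> A / ((1 - a) * tail \<nu> a)"
          by (simp add: mult.commute)
      qed
      finally show "(\<integral>\<^sup>+r. k1 r \<partial>weight_measure ?q) \<le> ennreal (A / ((1 - a) * tail \<nu> a))" .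
    next
      have k2': "k2 \<in> borel_measurable (lebesgue_on {0..<1})" by (rule borel_measurable_lebesgue_on[OF k(2)])
      have om: "(\<lambda>r. ennreal (\<omega> r)) \<in> borel_measurable (lebesgue_on {0..<1})"
        by (rule measurable_compose[OF radial_weight_measurable[OF w'] measurable_ennreal])
      have "(\<integral>\<^sup>+r. k2 r \<partial>weight_measure ?q) = (\<integral>\<^sup>+r. ennreal (\<omega> r / tail \<nu> r) * k2 r \<partial>lebesgue_on {0..<1})"
        by (rule nn_integral_weight_measure[OF q k2'])
      also have "\<dots> \<le> (\<integral>\<^sup>+r. ennreal (1 / tail \<nu> a) * (ennreal (\<omega> r) * k2 r) \<partial>lebesgue_on {0..<1})"
      proof (rule nn_integral_mono)
        fix r assume "r \<in> space (lebesgue_on {0..<1::real})"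
        hence r: "0 \<le> r" "r < 1" by (auto simp: space_restrict_space)
        show "ennreal (\<omega> r / tail \<nu> r) * k2 r \<le> ennreal (1 / tail \<nu> a) * (ennreal (\<omega> r) * k2 r)"
        proof (cases "r < a")
          case True
          have "\<omega> r / tail \<nu> r \<le> 1 / tail \<nu> a * \<omega> r"
            using divide_left_mono[OF tail_antimono[OF v r(1) less_imp_le[OF True] a(2)] radial_weight_nonneg[OF w' r]]
              V tail_pos[OF v r] by simp
          hence "ennreal (\<omega> r / tail \<nu> r) \<le> ennreal (1 / tail \<nu> a) * ennreal (\<omega> r)"
            using radial_weight_nonneg[OF w' r] by (simp add: ennreal_mult''[symmetric] ennreal_leI)
          thus ?thesis unfolding mult.assoc[symmetric] by (rule mult_right_mono) simp
        qed (simp add: k2_def)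
      qed
      also have "\<dots> = ennreal (1 / tail \<nu> a) * (\<integral>\<^sup>+r. k2 r \<partial>weight_measure \<omega>)"
        unfolding nn_integral_weight_measure[OF w' k2']
        by (intro nn_integral_cmult borel_measurable_times_ennreal om k2')
      also have "\<dots> \<le> ennreal (1 / tail \<nu> a) * ennreal (B / (1 - a))"
        unfolding k2_def by (intro mult_left_mono B(2)[OF a T tT]) auto
      also have "\<dots> = ennreal (B / ((1 - a) * tail \<nu> a))"
        using B a V by (subst ennreal_mult''[symmetric]) (auto simp: mult.commute)
      finally show "(\<integral>\<^sup>+r. k2 r \<partial>weight_measure ?q) \<le> ennreal (B / ((1 - a) * tail \<nu> a))" .
    qed
    also have "\<dots> = ennreal ((A + B) / ((1 - a) * tail \<nu> a))"
      using A B a V by (subst ennreal_plus[symmetric]) (auto simp: add_divide_distrib)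
    finally show "(\<integral>\<^sup>+r. ennreal (1 / ((1 - a * r) * T (a * r))) \<partial>weight_measure ?q)
        \<le> ennreal ((A + B) / ((1 - a) * tail \<nu> a))" .
  qed
qed

section \<open>Sufficiency of the tail condition\<close>

lemma kernel_deriv_measurable:
  "(\<lambda>\<zeta>. kernel_deriv \<omega> (z * cnj \<zeta>)) \<in> borel_measurable (lebesgue_on S)"
proof -
  have 1: "(\<lambda>u. kernel_deriv \<omega> u) \<in> borel_measurable borel" unfolding kernel_deriv_def by measurable
  have 2: "(\<lambda>\<zeta>. z * cnj \<zeta>) \<in> borel_measurable borel"
    by (intro borel_measurable_continuous_onI continuous_intros)
  show ?thesis by (rule borel_measurable_lebesgue_on[OF measurable_compose[OF 2 1]])
qed

lemma ennreal_norm_integral_le: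
  fixes F :: "'a \<Rightarrow> complex"
  shows "ennreal (cmod (integral\<^sup>L M F)) \<le> (\<integral>\<^sup>+x. ennreal (cmod (F x)) \<partial>M)"
proof (cases "integrable M F")
  case True
  thus ?thesis by (rule integral_norm_bound_ennreal)
next
  case False
  thus ?thesis by (simp add: not_integrable_integral_eq)
qed

lemma Linf_space_bound:
  assumes "f \<in> Linf_space \<nu>"
  obtains M where "M \<ge> 0" "Linf_norm \<nu> f = ennreal M"
    "AE \<zeta> in lebesgue_on unit_disc. cmod (f \<zeta>) * tail \<nu> (cmod \<zeta>) \<le> M"
proof -
  have "Linf_norm \<nu> f < \<infinity>" using assms by (simp add: Linf_space_def)
  then obtain M where M: "M \<ge> 0" "Linf_norm \<nu> f = ennreal M" by (cases "Linf_norm \<nu> f") auto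
  have "AE \<zeta> in lebesgue_on unit_disc. ennreal (cmod (f \<zeta>) * tail \<nu> (cmod \<zeta>)) \<le> Linf_norm \<nu> f"
    unfolding Linf_norm_def by (rule esssup_AE)
  hence "AE \<zeta> in lebesgue_on unit_disc. cmod (f \<zeta>) * tail \<nu> (cmod \<zeta>) \<le> M"
    by eventually_elim (use M in \<open>simp add: ennreal_le_iff\<close>)
  thus ?thesis using that M by blast
qed

text \<open>Almost everywhere |f| \<omega> is at most the norm of f times \<sigma>. This makes the
  projection well defined and reduces its derivative to the integral of \<open>kernel_deriv\<close>
  against \<sigma>.\<close>

lemma tail_condition_imp_projection_bounded:
  assumes w: "\<omega> \<in> D_hat" and v: "radial_weight \<nu>" and tc: "tail_condition \<omega> \<nu>"
  shows "projection_bounded \<omega> \<nu>"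
proof -
  let ?q = "weight_quotient \<omega> \<nu>" and ?M = "lebesgue_on unit_disc"
  have w': "radial_weight \<omega>" using w by (rule D_hat_imp_radial_weight)
  have q: "radial_weight ?q" using tc by (simp add: tail_condition_def)
  obtain D where D: "D > 0" 
    "\<And>z T. cmod z < 1 \<Longrightarrow> T \<in> borel_measurable borel \<Longrightarrow> (\<And>r. 0 \<le> r \<Longrightarrow> r < 1 \<Longrightarrow> tail \<omega> r = T r) \<Longrightarrow>
      (\<integral>\<^sup>+\<zeta>. ennreal (cmod (kernel_deriv \<omega> (z * cnj \<zeta>)) * ?q (cmod \<zeta>)) \<partial>?M)
       \<le> ennreal D * (\<integral>\<^sup>+r. ennreal (1 / ((1 - cmod z * r) * T (cmod z * r))) \<partial>weight_measure ?q)"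
    using kernel_deriv_disc_integral[OF w q] by blast
  obtain C where C: "C > 0" "\<And>a T. 0 \<le> a \<Longrightarrow> a < 1 \<Longrightarrow> T \<in> borel_measurable borel \<Longrightarrow>
      (\<And>r. 0 \<le> r \<Longrightarrow> r < 1 \<Longrightarrow> tail \<omega> r = T r) \<Longrightarrow>
      (\<integral>\<^sup>+r. ennreal (1 / ((1 - a * r) * T (a * r))) \<partial>weight_measure ?q) \<le> ennreal (C / ((1 - a) * tail \<nu> a))"
    using nn_integral_quotient_kernel[OF w v tc] by blast
  obtain T where T: "T \<in> borel_measurable borel" "\<And>r. 0 \<le> r \<Longrightarrow> r < 1 \<Longrightarrow> tail \<omega> r = T r"
    using tail_borel[OF w'] by blast
  define A where "A = 1 / pi * (D * C)"
  have A: "A \<ge> 0" using C D by (simp add: A_def)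
  have K: "(\<integral>\<^sup>+\<zeta>. ennreal (cmod (kernel_deriv \<omega> (z * cnj \<zeta>)) * ?q (cmod \<zeta>)) \<partial>?M)
       \<le> ennreal (D * (C / ((1 - cmod z) * tail \<nu> (cmod z))))" if "cmod z < 1" for z
  proof -
    have "(\<integral>\<^sup>+\<zeta>. ennreal (cmod (kernel_deriv \<omega> (z * cnj \<zeta>)) * ?q (cmod \<zeta>)) \<partial>?M)
       \<le> ennreal D * (\<integral>\<^sup>+r. ennreal (1 / ((1 - cmod z * r) * T (cmod z * r))) \<partial>weight_measure ?q)"
      using D(2)[OF that T] .
    also have "\<dots> \<le> ennreal D * ennreal (C / ((1 - cmod z) * tail \<nu> (cmod z)))"
      using that T by (intro mult_left_mono C(2)) auto
    also have "\<dots> = ennreal (D * (C / ((1 - cmod z) * tail \<nu> (cmod z))))"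
      using D(1) by (simp only: ennreal_mult' less_imp_le)
    finally show ?thesis .
  qed
  have main: "(\<forall>z\<in>unit_disc. set_integrable lebesgue unit_disc (projection_integrand \<omega> f z)) \<and>
      bergman_projection \<omega> f holomorphic_on unit_disc \<and>
      Bloch_norm \<nu> (bergman_projection \<omega> f) \<le> ennreal A * Linf_norm \<nu> f \<and> Linf_norm \<nu> f < \<infinity>"
    if f: "f \<in> Linf_space \<nu>" for f
  proof -
    obtain N where N: "N \<ge> 0" "Linf_norm \<nu> f = ennreal N"
      "AE \<zeta> in ?M. cmod (f \<zeta>) * tail \<nu> (cmod \<zeta>) \<le> N"
      using Linf_space_bound[OF f] by blast
    have fm: "f \<in> borel_measurable ?M" using f by (simp add: Linf_space_def)
    have "AE \<zeta> in ?M. cmod \<zeta> < 1" by (rule AE_I2) (simp add: space_restrict_space)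
    with N(3) have fle: "AE \<zeta> in ?M. cmod (f \<zeta> * of_real (\<omega> (cmod \<zeta>))) \<le> N * ?q (cmod \<zeta>) \<and> cmod \<zeta> < 1"
    proof eventually_elim
      case (elim \<zeta>)
      have V: "0 < tail \<nu> (cmod \<zeta>)" using elim by (intro tail_pos[OF v]) auto
      have "cmod (f \<zeta>) \<le> N / tail \<nu> (cmod \<zeta>)" using elim V by (simp add: field_simps)
      hence "cmod (f \<zeta>) * \<omega> (cmod \<zeta>) \<le> N / tail \<nu> (cmod \<zeta>) * \<omega> (cmod \<zeta>)"
        using elim by (intro mult_right_mono radial_weight_nonneg[OF w']) auto
      thus ?case using radial_weight_nonneg[OF w', of "cmod \<zeta>"] elim by (simp add: norm_mult)
    qed
    have G: "integrable ?M (\<lambda>\<zeta>. f \<zeta> * of_real (\<omega> (cmod \<zeta>)))"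
    proof (rule Bochner_Integration.integrable_bound)
      show "integrable ?M (\<lambda>\<zeta>. N * ?q (cmod \<zeta>))"
        using integrable_disc_weight[OF q] by (rule integrable_mult_right)
      show "(\<lambda>\<zeta>. f \<zeta> * of_real (\<omega> (cmod \<zeta>))) \<in> borel_measurable ?M"
        using radial_weight_cmod_measurable[OF w'] by (intro borel_measurable_times[OF fm]) simp
      show "AE \<zeta> in ?M. norm (f \<zeta> * of_real (\<omega> (cmod \<zeta>))) \<le> norm (N * ?q (cmod \<zeta>))"
        using fle by eventually_elim (erule conjE, erule order_trans, simp only: real_norm_def abs_ge_self)
    qed
    have Bloch: "(1 - cmod z) * tail \<nu> (cmod z) * cmod (deriv (bergman_projection \<omega> f) z) \<le> A * N"
      if z: "cmod z < 1" for z
    proof -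
      define V where "V = (1 - cmod z) * tail \<nu> (cmod z)"
      have V: "V > 0" unfolding V_def using z by (intro mult_pos_pos tail_pos[OF v]) auto
      define Q where "Q \<zeta> = f \<zeta> * of_real (\<omega> (cmod \<zeta>)) * cnj \<zeta> * kernel_deriv \<omega> (z * cnj \<zeta>)" for \<zeta>
      have km: "(\<lambda>\<zeta>. ennreal (cmod (kernel_deriv \<omega> (z * cnj \<zeta>)) * ?q (cmod \<zeta>))) \<in> borel_measurable ?M"
        using kernel_deriv_measurable radial_weight_cmod_measurable[OF q]
        by (intro measurable_compose[OF _ measurable_ennreal] borel_measurable_times measurable_compose[OF _ borel_measurable_norm])
      have "ennreal (cmod (integral\<^sup>L ?M Q)) \<le> (\<integral>\<^sup>+\<zeta>. ennreal (cmod (Q \<zeta>)) \<partial>?M)"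
        by (rule ennreal_norm_integral_le)
      also have "\<dots> \<le> (\<integral>\<^sup>+\<zeta>. ennreal N * ennreal (cmod (kernel_deriv \<omega> (z * cnj \<zeta>)) * ?q (cmod \<zeta>)) \<partial>?M)"
      proof (rule nn_integral_mono_AE)
        show "AE \<zeta> in ?M. ennreal (cmod (Q \<zeta>)) \<le> ennreal N * ennreal (cmod (kernel_deriv \<omega> (z * cnj \<zeta>)) * ?q (cmod \<zeta>))"
          using fle
        proof eventually_elim
          case (elim \<zeta>)
          have "cmod (Q \<zeta>) = cmod (f \<zeta> * of_real (\<omega> (cmod \<zeta>))) * cmod \<zeta> * cmod (kernel_deriv \<omega> (z * cnj \<zeta>))"
            by (simp add: Q_def norm_mult)
          also have "\<dots> \<le> N * ?q (cmod \<zeta>) * 1 * cmod (kernel_deriv \<omega> (z * cnj \<zeta>))"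
            using elim weight_quotient_nonneg[OF w' v, of "cmod \<zeta>"] N(1)
            by (intro mult_right_mono mult_mono mult_nonneg_nonneg) auto
          finally have "cmod (Q \<zeta>) \<le> N * (cmod (kernel_deriv \<omega> (z * cnj \<zeta>)) * ?q (cmod \<zeta>))"
            by (simp only: mult_1_right mult.commute[of "cmod (kernel_deriv \<omega> (z * cnj \<zeta>))"] mult.assoc)
          thus ?case using N(1) by (simp only: ennreal_mult'[symmetric] ennreal_leI)
        qed
      qed
      also have "\<dots> = ennreal N * (\<integral>\<^sup>+\<zeta>. ennreal (cmod (kernel_deriv \<omega> (z * cnj \<zeta>)) * ?q (cmod \<zeta>)) \<partial>?M)"
        by (rule nn_integral_cmult[OF km])
      also have "\<dots> \<le> ennreal N * ennreal (D * (C / V))"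
        unfolding V_def by (intro mult_left_mono K z) auto
      also have "\<dots> = ennreal (N * (D * (C / V)))"
        using N(1) by (simp only: ennreal_mult')
      finally have I: "cmod (integral\<^sup>L ?M Q) \<le> N * (D * (C / V))"
        using N(1) D(1) C(1) V by (subst (asm) ennreal_le_iff) auto
      have eq: "cmod (deriv (bergman_projection \<omega> f) z) = 1 / pi * cmod (integral\<^sup>L ?M Q)"
        unfolding deriv_bergman_projection[OF w' G z] Q_def by (simp add: norm_mult norm_divide)
      have "cmod (deriv (bergman_projection \<omega> f) z) \<le> 1 / pi * (N * (D * (C / V)))"
        unfolding eq by (intro mult_left_mono I) simp
      hence "V * cmod (deriv (bergman_projection \<omega> f) z) \<le> V * (1 / pi * (N * (D * (C / V))))"
        using V by (intro mult_left_mono) auto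
      also have "\<dots> = A * N" using V by (simp add: A_def)
      finally show ?thesis by (simp add: V_def)
    qed
    have "Bloch_norm \<nu> (bergman_projection \<omega> f) \<le> ennreal (A * N)"
      unfolding Bloch_norm_def using Bloch by (intro SUP_least ennreal_leI) auto
    also have "\<dots> = ennreal A * Linf_norm \<nu> f" using A N by (simp add: ennreal_mult)
    finally show ?thesis
      using projection_integrand_integrable[OF w' G] bergman_projection_holomorphic[OF w' G] N(2) by auto
  qed
  show ?thesis
    unfolding projection_bounded_def
  proof (intro conjI ballI exI[of _ A])
    fix f assume f: "f \<in> Linf_space \<nu>"
    show "set_integrable lebesgue unit_disc (projection_integrand \<omega> f z)" if "z \<in> unit_disc" for z
      using main[OF f] that by blast
    have "Bloch_norm \<nu> (bergman_projection \<omega> f) < \<infinity>"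
      using main[OF f] by (elim conjE) (rule le_less_trans, assumption, simp add: ennreal_mult_less_top)
    thus "bergman_projection \<omega> f \<in> Bloch_space \<nu>" using main[OF f] by (simp add: Bloch_space_def)
    show "Bloch_norm \<nu> (bergman_projection \<omega> f) \<le> ennreal A * Linf_norm \<nu> f" using main[OF f] by blast
  qed (use A in simp)
qed

text \<open>The part of the moment below 1 / 2 is at most
  \<open>(1/2) powr x * tail \<omega> 0\<close>, a multiple of the part above 1 / 2, where r^3 >= 1
  / 8. This replaces doubling as long as \<omega> is an arbitrary radial weight.\<close>

lemma real_moment_shift:
  assumes w: "radial_weight \<omega>"
  obtains B where "B > 0" "\<And>x. x \<ge> 0 \<Longrightarrow> real_moment \<omega> x \<le> B * real_moment \<omega> (x + 3)"
proof -
  let ?N = "weight_measure \<omega>"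
  have T: "tail \<omega> (1/2) > 0" by (rule tail_pos[OF w]) auto
  define c where "c = tail \<omega> 0 / tail \<omega> (1/2)"
  have c: "c \<ge> 0" using T tail_pos[OF w, of 0] by (simp add: c_def)
  show ?thesis
  proof (rule that[of "8 * (1 + c)"])
    show "8 * (1 + c) > 0" using c by simp
    fix x :: real assume x: "x \<ge> 0"
    let ?I = "\<lambda>r. indicat_real {1/2..<1} r"
    have int: "integrable ?N (\<lambda>r. r powr x * ?I r)"
      using x by (intro integrable_weight_measure[OF w, where B=1]) (auto simp: indicator_def powr_le1)
    have intI: "integrable ?N ?I" by (rule integrable_indicator_Ico[OF w])
    have I: "(\<integral>r. ?I r \<partial>?N) = tail \<omega> (1/2)"
      using tail_eq_measure[OF w, of "1/2"] by (simp add: Int_absorb1)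
    define J where "J = (\<integral>r. r powr x * ?I r \<partial>?N)"
    have "(1/2) powr x * tail \<omega> (1/2) = (\<integral>r. (1/2) powr x * ?I r \<partial>?N)"
      by (simp only: integral_mult_right_zero I)
    also have "\<dots> \<le> J"
      unfolding J_def using x
      by (intro integral_mono int integrable_mult_right intI) (auto simp: indicator_def intro!: powr_mono2)
    finally have J: "(1/2) powr x * tail \<omega> (1/2) \<le> J" .
    have J3: "J \<le> 8 * real_moment \<omega> (x + 3)"
    proof -
      have "J \<le> (\<integral>r. 8 * r powr (x + 3) \<partial>?N)"
        unfolding J_def
      proof (intro integral_mono int integrable_mult_right integrable_powr[OF w])
        fix r assume "r \<in> space ?N"
        hence r: "0 \<le> r" "r < 1" by auto
        show "r powr x * ?I r \<le> 8 * r powr (x + 3)"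
        proof (cases "1/2 \<le> r")
          case True
          have "(1/2) ^ 3 \<le> r ^ 3" using True by (intro power_mono) auto
          hence "r powr x * 1 \<le> r powr x * (8 * r ^ 3)" by (intro mult_left_mono) (auto simp: power3_eq_cube)
          also have "r ^ 3 = r powr 3" using True powr_realpow[of r 3] by simp
          finally show ?thesis using True r by (simp add: powr_add mult_ac)
        qed simp
      qed (use x in auto)
      thus ?thesis by (simp add: real_moment_def)
    qed
    have "real_moment \<omega> x \<le> (\<integral>r. r powr x * ?I r + (1/2) powr x \<partial>?N)"
      unfolding real_moment_def
    proof (rule integral_mono)
      show "integrable ?N (\<lambda>r. r powr x)" using x by (rule integrable_powr[OF w])
      show "integrable ?N (\<lambda>r. r powr x * ?I r + (1/2) powr x)"
        by (intro Bochner_Integration.integrable_add int finite_measure.integrable_const finite_measure_weight_measure w)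
      fix r assume "r \<in> space ?N"
      thus "r powr x \<le> r powr x * ?I r + (1/2) powr x"
        using x by (auto simp: indicator_def intro!: powr_mono2)
    qed
    also have "\<dots> = J + (\<integral>r. (1/2) powr x \<partial>?N)"
      unfolding J_def
      by (intro Bochner_Integration.integral_add int finite_measure.integrable_const finite_measure_weight_measure w)
    also have "(\<integral>r. (1/2) powr x \<partial>?N) = (1/2) powr x * tail \<omega> 0"
      using tail_eq_measure[OF w, of 0] by (simp add: mult.commute)
    also have "\<dots> = c * ((1/2) powr x * tail \<omega> (1/2))" using T by (simp add: c_def)
    also have "\<dots> \<le> c * J" using c J by (intro mult_left_mono) auto
    also have "J + c * J \<le> (1 + c) * (8 * real_moment \<omega> (x + 3))"
      using mult_left_mono[OF J3, of "1 + c"] c by (simp add: algebra_simps)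
    finally show "real_moment \<omega> x \<le> 8 * (1 + c) * real_moment \<omega> (x + 3)"
      by (simp only: mult_ac)
  qed
qed

section \<open>Necessity of the moment condition\<close>

text \<open>The function \<open>sgn \<zeta> ^ n / tail \<nu> (cmod \<zeta>)\<close>; for \<open>n > 0\<close> its value at \<open>0\<close> is \<open>0\<close>, as division by zero gives \<open>0\<close>.\<close>

definition test_function :: "(real \<Rightarrow> real) \<Rightarrow> nat \<Rightarrow> complex \<Rightarrow> complex" where
  "test_function \<nu> n \<zeta> = \<zeta> ^ n * of_real (1 / (cmod \<zeta> ^ n * tail \<nu> (cmod \<zeta>)))"

lemma tail_cmod_measurable:
  assumes "radial_weight \<nu>"
  shows "(\<lambda>\<zeta>. tail \<nu> (cmod \<zeta>)) \<in> borel_measurable (lebesgue_on unit_disc)"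
  by (rule measurable_compose[OF cmod_measurable_lebesgue tail_measurable[OF assms]])

lemma test_function_measurable:
  assumes "radial_weight \<nu>"
  shows "test_function \<nu> n \<in> borel_measurable (lebesgue_on unit_disc)"
proof -
  have 1: "(\<lambda>\<zeta>. \<zeta> ^ n) \<in> borel_measurable (lebesgue_on unit_disc)"
    by (intro borel_measurable_lebesgue_on borel_measurable_continuous_onI continuous_intros)
  have 2: "(\<lambda>\<zeta>. cmod \<zeta> ^ n) \<in> borel_measurable (lebesgue_on unit_disc)"
    by (intro borel_measurable_lebesgue_on borel_measurable_continuous_onI continuous_intros)
  have "(\<lambda>\<zeta>. 1 / (cmod \<zeta> ^ n * tail \<nu> (cmod \<zeta>))) \<in> borel_measurable (lebesgue_on unit_disc)"
    by (intro borel_measurable_divide borel_measurable_times 2 tail_cmod_measurable[OF assms]) simp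
  hence "(\<lambda>\<zeta>. complex_of_real (1 / (cmod \<zeta> ^ n * tail \<nu> (cmod \<zeta>)))) \<in> borel_measurable (lebesgue_on unit_disc)"
    by (rule measurable_compose[OF _ borel_measurable_of_real])
  thus ?thesis
    unfolding test_function_def by (intro borel_measurable_times 1)
qed

lemma norm_test_function_le:
  assumes "radial_weight \<nu>" "cmod \<zeta> < 1"
  shows "cmod (test_function \<nu> n \<zeta>) * tail \<nu> (cmod \<zeta>) \<le> 1"
proof -
  have V: "0 < tail \<nu> (cmod \<zeta>)" using assms by (intro tail_pos) auto
  have "cmod (test_function \<nu> n \<zeta>) = cmod \<zeta> ^ n / (cmod \<zeta> ^ n * tail \<nu> (cmod \<zeta>))"
    using V by (simp add: test_function_def norm_mult norm_power norm_divide)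
  thus ?thesis using V by (cases "cmod \<zeta> ^ n = 0") auto
qed

lemma test_function_Linf:
  assumes "radial_weight \<nu>"
  shows "test_function \<nu> n \<in> Linf_space \<nu>" "Linf_norm \<nu> (test_function \<nu> n) \<le> 1"
proof -
  have m: "(\<lambda>\<zeta>. ennreal (cmod (test_function \<nu> n \<zeta>) * tail \<nu> (cmod \<zeta>))) \<in> borel_measurable (lebesgue_on unit_disc)"
    using test_function_measurable[OF assms] tail_cmod_measurable[OF assms]
    by (intro measurable_compose[OF _ measurable_ennreal] borel_measurable_times measurable_compose[OF _ borel_measurable_norm])
  have "ennreal (cmod (test_function \<nu> n \<zeta>) * tail \<nu> (cmod \<zeta>)) \<le> 1" if "\<zeta> \<in> space (lebesgue_on unit_disc)" for \<zeta>
  proof -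
    have "cmod \<zeta> < 1" using that by (simp add: space_restrict_space)
    from ennreal_leI[OF norm_test_function_le[OF assms this, of n]] show ?thesis by simp
  qed
  thus 1: "Linf_norm \<nu> (test_function \<nu> n) \<le> 1"
    unfolding Linf_norm_def by (intro esssup_I[OF m] AE_I2)
  show "test_function \<nu> n \<in> Linf_space \<nu>"
    using test_function_measurable[OF assms] le_less_trans[OF 1 ennreal_one_less_top]
    by (simp add: Linf_space_def)
qed

text \<open>At z = 0 the kernel is constant, so the integrand for the test function
  \<open>1 / tail \<nu> (cmod \<zeta>)\<close> is a multiple of \<sigma>, which is therefore
  integrable over the disc. The area factor r is at least 1 / 2 for r >= 1 / 2, and below 1 / 2 the
  quotient is at most \<open>\<omega> r / tail \<nu> (1 / 2)\<close>.\<close>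

lemma projection_bounded_imp_radial_weight_quotient:
  assumes w: "radial_weight \<omega>" and v: "radial_weight \<nu>" and pb: "projection_bounded \<omega> \<nu>"
  shows "radial_weight (weight_quotient \<omega> \<nu>)"
proof -
  let ?q = "weight_quotient \<omega> \<nu>" and ?M = "lebesgue_on unit_disc"
  let ?c = "complex_of_real (kernel_coeff \<omega> 0)"
  have "set_integrable lebesgue unit_disc (projection_integrand \<omega> (test_function \<nu> 0) 0)"
    using pb test_function_Linf(1)[OF v, of 0] unfolding projection_bounded_def by auto
  hence i: "integrable ?M (projection_integrand \<omega> (test_function \<nu> 0) 0)"
    by (simp only: set_integral_disc)
  have eq: "projection_integrand \<omega> (test_function \<nu> 0) 0 \<zeta> = ?c * of_real (?q (cmod \<zeta>))"
    if "\<zeta> \<in> space ?M" for \<zeta>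
  proof -
    have z: "cmod \<zeta> < 1" using that by (simp add: space_restrict_space)
    have "cnj (bergman_kernel \<omega> 0 \<zeta>) = (\<Sum>n. complex_of_real (kernel_coeff \<omega> n) * 0 ^ n)"
      using cnj_bergman_kernel[OF w _ z, of 0] by simp
    also have "\<dots> = ?c" by (rule powser_zero)
    finally show ?thesis by (simp add: projection_integrand_def test_function_def)
  qed
  have "integrable ?M (\<lambda>\<zeta>. ?c * of_real (?q (cmod \<zeta>)))"
    using i by (subst (asm) Bochner_Integration.integrable_cong[OF refl eq])
  hence "integrable ?M (\<lambda>\<zeta>. 1 / ?c * (?c * of_real (?q (cmod \<zeta>))))" by (rule integrable_mult_right)
  hence "integrable ?M (\<lambda>\<zeta>. complex_of_real (?q (cmod \<zeta>)))"
    using kernel_coeff_pos[OF w, of 0] by simp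
  hence "integrable ?M (\<lambda>\<zeta>. ?q (cmod \<zeta>))" by (simp only: complex_of_real_integrable_eq)
  hence fin: "(\<integral>\<^sup>+\<zeta>. ennreal (norm (?q (cmod \<zeta>))) \<partial>?M) < \<infinity>"
    by (simp only: integrable_iff_bounded)
  have qm: "(\<lambda>r. ennreal (?q r)) \<in> borel_measurable (lebesgue_on {0..<1})"
    by (rule measurable_compose[OF weight_quotient_measurable[OF w v] measurable_ennreal])
  have wm: "(\<lambda>r. ennreal (\<omega> r)) \<in> borel_measurable (lebesgue_on {0..<1})"
    by (rule measurable_compose[OF radial_weight_measurable[OF w] measurable_ennreal])
  have rm: "(\<lambda>r. ennreal (2 * pi * r)) \<in> borel_measurable (lebesgue_on {0..<1})"
    by (intro measurable_compose[OF _ measurable_ennreal] borel_measurable_lebesgue_on) simp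
  have "(\<integral>\<^sup>+\<zeta>. ennreal (?q (cmod \<zeta>)) \<partial>?M) \<le> (\<integral>\<^sup>+\<zeta>. ennreal (norm (?q (cmod \<zeta>))) \<partial>?M)"
    by (intro nn_integral_mono ennreal_leI) (simp only: real_norm_def abs_ge_self)
  hence "(\<integral>\<^sup>+\<zeta>. ennreal (?q (cmod \<zeta>)) \<partial>?M) < \<infinity>" using fin by (rule le_less_trans)
  hence fin1: "(\<integral>\<^sup>+r. ennreal (2 * pi * r) * ennreal (?q r) \<partial>lebesgue_on {0..<1}) < \<infinity>"
    using nn_integral_disc_radial[OF qm] by simp
  have "(\<integral>\<^sup>+r. ennreal (\<omega> r) * 1 \<partial>lebesgue_on {0..<1}) = emeasure (weight_measure \<omega>) {0..<1}"
    using nn_integral_weight_measure[OF w, of "\<lambda>_. 1"] by simp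
  hence fin2: "(\<integral>\<^sup>+r. ennreal (\<omega> r) \<partial>lebesgue_on {0..<1}) < \<infinity>"
    using emeasure_weight_measure_Ico[OF w, of 0] by simp
  define V where "V = tail \<nu> (1 / 2)"
  have V: "0 < V" unfolding V_def by (rule tail_pos[OF v]) auto
  have "(\<integral>\<^sup>+r. ennreal (?q r) \<partial>lebesgue_on {0..<1})
    \<le> (\<integral>\<^sup>+r. ennreal (1 / pi) * (ennreal (2 * pi * r) * ennreal (?q r)) + ennreal (1 / V) * ennreal (\<omega> r) \<partial>lebesgue_on {0..<1})"
  proof (rule nn_integral_mono)
    fix r assume "r \<in> space (lebesgue_on {0..<1::real})"
    hence r: "0 \<le> r" "r < 1" by (auto simp: space_restrict_space)
    have q0: "0 \<le> ?q r" using weight_quotient_nonneg[OF w v r] .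
    have w0: "0 \<le> \<omega> r" using radial_weight_nonneg[OF w r] .
    have "?q r \<le> 1 / pi * (2 * pi * r * ?q r) + 1 / V * \<omega> r"
    proof (cases "r \<ge> 1 / 2")
      case True
      have "1 * ?q r \<le> (2 * r) * ?q r" using True q0 by (intro mult_right_mono) auto
      moreover have "0 \<le> 1 / V * \<omega> r" using V w0 by simp
      ultimately show ?thesis by simp
    next
      case False
      have "?q r \<le> \<omega> r / V"
        unfolding V_def using False r w0 tail_pos[OF v r] V
        by (intro divide_left_mono tail_antimono[OF v]) (auto simp: V_def intro!: mult_pos_pos)
      moreover have "0 \<le> 1 / pi * (2 * pi * r * ?q r)" using r q0 by (intro mult_nonneg_nonneg) simp_all
      ultimately show ?thesis by simp
    qed
    hence "ennreal (?q r) \<le> ennreal (1 / pi * (2 * pi * r * ?q r) + 1 / V * \<omega> r)" by (rule ennreal_leI)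
    also have "\<dots> = ennreal (1 / pi * (2 * pi * r * ?q r)) + ennreal (1 / V * \<omega> r)"
      using r q0 w0 V by (intro ennreal_plus mult_nonneg_nonneg) simp_all
    also have "ennreal (1 / pi * (2 * pi * r * ?q r)) = ennreal (1 / pi) * (ennreal (2 * pi * r) * ennreal (?q r))"
    proof -
      have "0 \<le> 2 * pi * r * ?q r" using r q0 by (intro mult_nonneg_nonneg) simp_all
      thus ?thesis by (simp only: ennreal_mult''[OF q0] ennreal_mult''[of "2 * pi * r * ?q r"])
    qed
    also have "ennreal (1 / V * \<omega> r) = ennreal (1 / V) * ennreal (\<omega> r)" by (rule ennreal_mult''[OF w0])
    finally show "ennreal (?q r) \<le> ennreal (1 / pi) * (ennreal (2 * pi * r) * ennreal (?q r)) + ennreal (1 / V) * ennreal (\<omega> r)" .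
  qed
  also have "\<dots> = ennreal (1 / pi) * (\<integral>\<^sup>+r. ennreal (2 * pi * r) * ennreal (?q r) \<partial>lebesgue_on {0..<1})
      + ennreal (1 / V) * (\<integral>\<^sup>+r. ennreal (\<omega> r) \<partial>lebesgue_on {0..<1})"
    by (subst nn_integral_add)
       (simp_all only: nn_integral_cmult[OF wm] nn_integral_cmult[OF borel_measurable_times_ennreal[OF rm qm]]
          borel_measurable_times_ennreal borel_measurable_const qm wm rm)
  also have "\<dots> < \<infinity>" using fin1 fin2 by (simp add: ennreal_mult_less_top)
  finally have "(\<integral>\<^sup>+r. ennreal (?q r) \<partial>lebesgue_on {0..<1}) < \<infinity>" .
  thus ?thesis
    unfolding radial_weight_quotient_iff[OF w v] by (subst (asm) nn_integral_restrict_space) auto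
qed

context
  fixes \<omega> \<nu> :: "real \<Rightarrow> real"
  assumes w: "radial_weight \<omega>" and v: "radial_weight \<nu>" and q: "radial_weight (weight_quotient \<omega> \<nu>)"
begin

lemma test_function_weight_integrable:
  "integrable (lebesgue_on unit_disc) (\<lambda>\<zeta>. test_function \<nu> n \<zeta> * of_real (\<omega> (cmod \<zeta>)))"
proof (rule Bochner_Integration.integrable_bound[OF integrable_disc_weight[OF q]])
  show "(\<lambda>\<zeta>. test_function \<nu> n \<zeta> * of_real (\<omega> (cmod \<zeta>))) \<in> borel_measurable (lebesgue_on unit_disc)"
    using radial_weight_cmod_measurable[OF w] by (intro borel_measurable_times test_function_measurable[OF v]) simp
  show "AE \<zeta> in lebesgue_on unit_disc. norm (test_function \<nu> n \<zeta> * of_real (\<omega> (cmod \<zeta>))) \<le> norm (weight_quotient \<omega> \<nu> (cmod \<zeta>))"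
  proof (rule AE_I2)
    fix \<zeta> assume "\<zeta> \<in> space (lebesgue_on unit_disc)"
    hence z: "cmod \<zeta> < 1" by (simp add: space_restrict_space)
    have V: "0 < tail \<nu> (cmod \<zeta>)" using z by (intro tail_pos[OF v]) auto
    have w0: "0 \<le> \<omega> (cmod \<zeta>)" using z by (intro radial_weight_nonneg[OF w]) auto
    have "cmod (test_function \<nu> n \<zeta>) \<le> 1 / tail \<nu> (cmod \<zeta>)"
      using norm_test_function_le[OF v z, of n] V by (simp add: field_simps)
    hence "cmod (test_function \<nu> n \<zeta>) * \<omega> (cmod \<zeta>) \<le> 1 / tail \<nu> (cmod \<zeta>) * \<omega> (cmod \<zeta>)"
      using w0 by (intro mult_right_mono)
    thus "norm (test_function \<nu> n \<zeta> * of_real (\<omega> (cmod \<zeta>))) \<le> norm (weight_quotient \<omega> \<nu> (cmod \<zeta>))"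
      using w0 V by (simp add: norm_mult)
  qed
qed

text \<open>The area element contributes one more power of r, hence the order n + 1.\<close>

lemma integral_disc_power_quotient:
  "(\<integral>\<zeta>. cmod \<zeta> ^ n * weight_quotient \<omega> \<nu> (cmod \<zeta>) \<partial>lebesgue_on unit_disc)
     = 2 * pi * real_moment (weight_quotient \<omega> \<nu>) (real n + 1)"
proof -
  let ?q = "weight_quotient \<omega> \<nu>" and ?M = "lebesgue_on unit_disc"
  have sp: "0 \<le> cmod \<zeta>" "cmod \<zeta> < 1" if "\<zeta> \<in> space ?M" for \<zeta> using that by (auto simp: space_restrict_space)
  have i: "integrable ?M (\<lambda>\<zeta>. cmod \<zeta> ^ n * ?q (cmod \<zeta>))"
  proof (rule integrable_bounded_times[OF integrable_disc_weight[OF q], where B=1])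
    show "(\<lambda>\<zeta>. cmod \<zeta> ^ n) \<in> borel_measurable ?M" by (rule borel_cmod_measurable) simp
    show "norm (cmod \<zeta> ^ n) \<le> 1" if "\<zeta> \<in> space ?M" for \<zeta>
      using sp[OF that] by (simp add: power_le_one)
  qed
  have "ennreal (\<integral>\<zeta>. cmod \<zeta> ^ n * ?q (cmod \<zeta>) \<partial>?M) = (\<integral>\<^sup>+\<zeta>. ennreal (cmod \<zeta> ^ n * ?q (cmod \<zeta>)) \<partial>?M)"
    using sp radial_weight_nonneg[OF q]
    by (intro nn_integral_eq_integral[symmetric] i AE_I2 mult_nonneg_nonneg) auto
  also have "\<dots> = (\<integral>\<^sup>+\<zeta>. ennreal (?q (cmod \<zeta>)) * ennreal (cmod \<zeta> ^ n) \<partial>?M)"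
    by (intro nn_integral_cong, subst mult.commute, rule ennreal_mult'') simp
  also have "\<dots> = (\<integral>\<^sup>+r. ennreal (2 * pi * r) * ennreal (r ^ n) \<partial>weight_measure ?q)"
    by (rule nn_integral_disc_weight[OF q]) simp
  also have "\<dots> = (\<integral>\<^sup>+r. ennreal (2 * pi) * ennreal (r powr (real n + 1)) \<partial>weight_measure ?q)"
  proof (rule nn_integral_cong)
    fix r assume "r \<in> space (weight_measure ?q)"
    hence r: "0 \<le> r" by simp
    have "r * r ^ n = r powr (real n + 1)"
    proof (cases "r = 0")
      case False
      hence "0 < r" using r by simp
      thus ?thesis by (simp add: powr_add powr_realpow)
    qed simp
    hence "2 * pi * r * r ^ n = 2 * pi * r powr (real n + 1)" by (simp only: mult.assoc)
    thus "ennreal (2 * pi * r) * ennreal (r ^ n) = ennreal (2 * pi) * ennreal (r powr (real n + 1))"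
      using r by (simp only: ennreal_mult''[symmetric] zero_le_power powr_ge_zero)
  qed
  also have "\<dots> = ennreal (2 * pi) * moment ?q (real n + 1)"
    unfolding moment_eq_nn_integral[OF q] 
    by (intro nn_integral_cmult borel_measurable_weight_measure measurable_compose[OF _ measurable_ennreal]) simp
  also have "\<dots> = ennreal (2 * pi * real_moment ?q (real n + 1))"
  proof -
    have "moment ?q (real n + 1) = ennreal (real_moment ?q (real n + 1))"
      by (rule moment_eq_ennreal[OF q]) simp
    thus ?thesis by (simp only: ennreal_mult'' real_moment_nonneg)
  qed
  finally have "ennreal (\<integral>\<zeta>. cmod \<zeta> ^ n * ?q (cmod \<zeta>) \<partial>?M) = ennreal (2 * pi * real_moment ?q (real n + 1))" .
  moreover have "0 \<le> (\<integral>\<zeta>. cmod \<zeta> ^ n * ?q (cmod \<zeta>) \<partial>?M)"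
    by (intro integral_nonneg_AE AE_I2 mult_nonneg_nonneg zero_le_power norm_ge_zero radial_weight_nonneg[OF q] sp)
  moreover have "0 \<le> 2 * pi * real_moment ?q (real n + 1)"
    by (intro mult_nonneg_nonneg real_moment_nonneg) simp_all
  ultimately show ?thesis by (simp only: ennreal_inj)
qed

lemma projection_coeff_test_function:
  "projection_coeff \<omega> (test_function \<nu> n) m = (if m = n then
     of_real (real_moment (weight_quotient \<omega> \<nu>) (real n + 1) / real_moment \<omega> (2 * real n + 1)) else 0)"
proof -
  let ?q = "weight_quotient \<omega> \<nu>" and ?M = "lebesgue_on unit_disc"
  define g where "g r = ?q r / r ^ n" for r
  have eq: "test_function \<nu> n \<zeta> * of_real (\<omega> (cmod \<zeta>)) * cnj \<zeta> ^ m = \<zeta> ^ n * cnj \<zeta> ^ m * of_real (g (cmod \<zeta>))" for \<zeta> m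
    by (simp add: test_function_def g_def mult_ac)
  have gm: "(\<lambda>\<zeta>. g (cmod \<zeta>)) \<in> borel_measurable ?M"
    unfolding g_def by (intro borel_measurable_divide radial_weight_cmod_measurable[OF q] borel_cmod_measurable[of "\<lambda>r. r ^ n"]) simp
  show ?thesis
  proof (cases "m = n")
    case False
    thus ?thesis
      unfolding projection_coeff_def eq by (simp only: integral_disc_monomial_orthogonal[OF gm] if_False) simp
  next
    case True
    have "\<zeta> ^ n * cnj \<zeta> ^ n * of_real (g (cmod \<zeta>)) = complex_of_real (cmod \<zeta> ^ n * ?q (cmod \<zeta>))" for \<zeta>
    proof -
      have "\<zeta> ^ n * cnj \<zeta> ^ n = complex_of_real (cmod \<zeta> ^ n * cmod \<zeta> ^ n)"
        unfolding power_mult_distrib[symmetric] complex_norm_square[symmetric] power2_eq_square[symmetric]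
        by (simp add: power2_eq_square power_mult_distrib)
      \<comment> \<open>The power vanishes only at \<zeta> = 0 with n > 0, and there both sides are
        0.\<close>
      thus ?thesis by (cases "cmod \<zeta> ^ n = 0") (auto simp: g_def)
    qed
    hence "(\<integral>\<zeta>. test_function \<nu> n \<zeta> * of_real (\<omega> (cmod \<zeta>)) * cnj \<zeta> ^ n \<partial>?M)
       = (\<integral>\<zeta>. complex_of_real (cmod \<zeta> ^ n * ?q (cmod \<zeta>)) \<partial>?M)"
      by (simp only: eq)
    also have "\<dots> = complex_of_real (2 * pi * real_moment ?q (real n + 1))"
      by (simp only: integral_complex_of_real integral_disc_power_quotient)
    finally show ?thesis
      unfolding projection_coeff_def True kernel_coeff_def by simp
  qed
qed

lemma deriv_projection_test_function:
  assumes z: "cmod z < 1"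
  shows "deriv (bergman_projection \<omega> (test_function \<nu> (Suc n))) z =
    of_real (real (Suc n) * (real_moment (weight_quotient \<omega> \<nu>) (real (Suc n) + 1) / real_moment \<omega> (2 * real (Suc n) + 1))) * z ^ n"
proof -
  let ?a = "projection_coeff \<omega> (test_function \<nu> (Suc n))"
  have "deriv (bergman_projection \<omega> (test_function \<nu> (Suc n))) z = (\<Sum>k. diffs ?a k * z ^ k)"
    by (rule DERIV_imp_deriv[OF bergman_projection_has_derivative[OF w test_function_weight_integrable z]])
  also have "\<dots> = (\<Sum>k\<in>{n}. diffs ?a k * z ^ k)"
    by (rule suminf_finite) (auto simp: diffs_def projection_coeff_test_function)
  finally show ?thesis by (simp only: diffs_def projection_coeff_test_function) simp
qed

end

text \<open>The test functions give an estimate at integers with the orders n, n + 1 and 2 n + 1.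
  Monotonicity of the moments and \<open>real_moment_shift\<close> bring these to the orders x, x
  and 2 x.\<close>

lemma projection_bounded_imp_moment_condition:
  assumes w: "radial_weight \<omega>" and v: "\<nu> \<in> D_hat" and pb: "projection_bounded \<omega> \<nu>"
  shows "moment_condition \<omega> \<nu>"
proof -
  let ?q = "weight_quotient \<omega> \<nu>"
  have v': "radial_weight \<nu>" using v by (rule D_hat_imp_radial_weight)
  have q: "radial_weight ?q" by (rule projection_bounded_imp_radial_weight_quotient[OF w v' pb])
  obtain B where B: "B > 0" "\<And>x. x \<ge> 1 \<Longrightarrow> real_moment \<nu> x \<le> B * tail \<nu> (1 - 1 / x)"
    using D_hat_real_moment_le_tail[OF v] by blast
  obtain E where E: "E > 0" "\<And>x. x \<ge> 0 \<Longrightarrow> real_moment \<omega> x \<le> E * real_moment \<omega> (x + 3)"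
    using real_moment_shift[OF w] by blast
  from pb obtain C where C: "C \<ge> 0" "\<And>f. f \<in> Linf_space \<nu> \<Longrightarrow>
      Bloch_norm \<nu> (bergman_projection \<omega> f) \<le> ennreal C * Linf_norm \<nu> f"
    unfolding projection_bounded_def by blast
  have at_nat: "real_moment \<nu> (real n) * real_moment ?q (real n + 1) \<le> B * (exp 2 * C) * real_moment \<omega> (2 * real n + 1)"
    if n: "n \<ge> 2" for n
  proof -
    obtain k where k: "n = Suc k" using n by (cases n) auto
    define A where "A = real_moment ?q (real n + 1) / real_moment \<omega> (2 * real n + 1)"
    have W: "0 < real_moment \<omega> (2 * real n + 1)" by (rule real_moment_pos[OF w]) simp
    have A: "A \<ge> 0" using W by (simp add: A_def real_moment_nonneg)
    \<comment> \<open>At this radius 1 - r cancels the factor n of the derivative, and r^k, with k =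
      n - 1, is still at least exp (- 2) because n >= 2.\<close>
    define r where "r = 1 - 1 / real n"
    have r: "0 < r" "r < 1" using n by (auto simp: r_def)
    have V: "0 < tail \<nu> r" using r by (intro tail_pos[OF v']) auto
    have "ennreal ((1 - r) * tail \<nu> r * cmod (deriv (bergman_projection \<omega> (test_function \<nu> n)) (of_real r)))
       \<le> Bloch_norm \<nu> (bergman_projection \<omega> (test_function \<nu> n))"
      unfolding Bloch_norm_def by (rule SUP_upper2[of "of_real r"]) (use r in auto)
    also have "\<dots> \<le> ennreal C * Linf_norm \<nu> (test_function \<nu> n)"
      by (rule C(2)[OF test_function_Linf(1)[OF v']])
    also have "\<dots> \<le> ennreal C * 1" by (intro mult_left_mono test_function_Linf(2)[OF v']) auto
    finally have "ennreal ((1 - r) * tail \<nu> r * cmod (deriv (bergman_projection \<omega> (test_function \<nu> n)) (of_real r))) \<le> ennreal C"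
      by simp
    hence "(1 - r) * tail \<nu> r * cmod (deriv (bergman_projection \<omega> (test_function \<nu> n)) (of_real r)) \<le> C"
      using C(1) by (simp add: ennreal_le_iff)
    moreover have "deriv (bergman_projection \<omega> (test_function \<nu> n)) (of_real r) = of_real (real n * A) * of_real r ^ k"
      unfolding k A_def using r by (intro deriv_projection_test_function[OF w v' q]) simp
    hence "cmod (deriv (bergman_projection \<omega> (test_function \<nu> n)) (of_real r)) = \<bar>real n * A\<bar> * \<bar>r\<bar> ^ k"
      by (simp only: norm_mult norm_power norm_of_real)
    hence "cmod (deriv (bergman_projection \<omega> (test_function \<nu> n)) (of_real r)) = real n * A * r ^ k"
      using r A by simp
    moreover have "1 - r = 1 / real n" by (simp add: r_def)
    ultimately have "1 / real n * tail \<nu> r * (real n * A * r ^ k) \<le> C" by simp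
    moreover have "1 / real n * tail \<nu> r * (real n * A * r ^ k) = tail \<nu> r * A * r ^ k" using n by simp
    ultimately have le: "tail \<nu> r * A * r ^ k \<le> C" by simp
    have "exp (- 2) \<le> r powr real n" unfolding r_def using n by (intro exp_le_powr_one_minus) auto
    also have "\<dots> = r ^ n" by (rule powr_realpow[OF r(1)])
    also have "\<dots> \<le> r ^ k" using r by (simp add: k mult_left_le_one_le)
    finally have "tail \<nu> r * A * exp (- 2) \<le> tail \<nu> r * A * r ^ k" using V A by (intro mult_left_mono) auto
    hence "tail \<nu> r * A * exp (- 2) \<le> C" using le by simp
    hence "tail \<nu> r * A \<le> exp 2 * C" by (simp add: exp_minus field_simps)
    have "real_moment \<nu> (real n) * A \<le> B * tail \<nu> r * A"
      unfolding r_def using n A by (intro mult_right_mono B) auto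
    also have "\<dots> = B * (tail \<nu> r * A)" by simp
    also have "\<dots> \<le> B * (exp 2 * C)" using B \<open>tail \<nu> r * A \<le> exp 2 * C\<close> by (intro mult_left_mono) auto
    finally show ?thesis using W by (simp add: A_def field_simps)
  qed
  \<comment> \<open>The second entry handles x < 3, where the order 2 x stays below 6.\<close>
  define D where "D = max (B * (exp 2 * C) * E) (real_moment \<nu> 0 * real_moment ?q 0 / real_moment \<omega> 6)"
  have D0: "D \<ge> 0" using B C E by (auto simp: D_def le_max_iff_disj)
  have "real_moment \<nu> x * real_moment ?q x \<le> D * real_moment \<omega> (2 * x)" if x: "x \<ge> 0" for x
  proof (cases "x \<ge> 3")
    case True
    \<comment> \<open>One less than the integer part, so that both n and n + 1 are at most x. Then 2
      x <= 2 n + 4 = (2 n + 1) + 3, which explains the shift by 3 in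
      \<open>real_moment_shift\<close>.\<close>
    define n where "n = nat \<lfloor>x\<rfloor> - 1"
    have "nat \<lfloor>x\<rfloor> \<ge> 3" using True by (simp add: le_nat_floor)
    hence n: "n \<ge> 2" "real n + 1 = real (nat \<lfloor>x\<rfloor>)" by (auto simp: n_def of_nat_diff)
    have nx: "real n + 1 \<le> x" "x \<le> real n + 2"
      unfolding n(2) using x n(2) by (auto simp: of_nat_nat) linarith+
    have "real_moment \<nu> x * real_moment ?q x \<le> real_moment \<nu> (real n) * real_moment ?q (real n + 1)"
      using nx x by (intro mult_mono real_moment_antimono v' q) (auto simp: real_moment_nonneg)
    also have "\<dots> \<le> B * (exp 2 * C) * real_moment \<omega> (2 * real n + 1)" by (rule at_nat[OF n(1)])
    also have "\<dots> \<le> B * (exp 2 * C) * (E * real_moment \<omega> (2 * real n + 1 + 3))"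
      using B C by (intro mult_left_mono E) auto
    also have "\<dots> \<le> B * (exp 2 * C) * (E * real_moment \<omega> (2 * x))"
      using B C E nx x by (intro mult_left_mono real_moment_antimono[OF w]) auto
    also have "\<dots> = (B * (exp 2 * C) * E) * real_moment \<omega> (2 * x)" by (simp only: mult.assoc)
    also have "\<dots> \<le> D * real_moment \<omega> (2 * x)"
      by (intro mult_right_mono) (auto simp: D_def real_moment_nonneg)
    finally show ?thesis .
  next
    case False
    have "real_moment \<nu> x * real_moment ?q x \<le> real_moment \<nu> 0 * real_moment ?q 0"
      using x by (intro mult_mono real_moment_antimono v' q) (auto simp: real_moment_nonneg)
    also have "\<dots> = (real_moment \<nu> 0 * real_moment ?q 0 / real_moment \<omega> 6) * real_moment \<omega> 6"
      using real_moment_pos[OF w, of 6] by simp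
    also have "\<dots> \<le> D * real_moment \<omega> (2 * x)"
      using x False D0 by (intro mult_mono real_moment_antimono w) (auto simp: D_def real_moment_nonneg)
    finally show ?thesis .
  qed
  thus ?thesis unfolding moment_condition_def using q D0 by blast
qed

theorem theorem5:
  fixes \<omega> \<nu> :: "real \<Rightarrow> real"
  assumes "radial_weight \<omega>" and "\<nu> \<in> D_hat"
  shows "(projection_bounded \<omega> \<nu> \<longleftrightarrow>
            (SUP x\<in>{0..}. moment \<nu> x / moment \<omega> (2 * x) * moment (\<lambda>r. \<omega> r / tail \<nu> r) x) < \<infinity>)
       \<and> ((SUP x\<in>{0..}. moment \<nu> x / moment \<omega> (2 * x) * moment (\<lambda>r. \<omega> r / tail \<nu> r) x) < \<infinity> \<longleftrightarrow>
            \<omega> \<in> D_hat \<and>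
            (SUP r\<in>{0..<1}. ennreal (tail \<nu> r / tail \<omega> r)
                * (\<integral>\<^sup>+s\<in>{r..<1}. ennreal (\<omega> s / tail \<nu> s) \<partial>lebesgue)) < \<infinity>)"
proof -
  have v: "radial_weight \<nu>" using assms(2) by (rule D_hat_imp_radial_weight)
  show ?thesis
    unfolding moment_condition_iff[OF assms(1) v] tail_condition_iff[OF assms(1) v]
    using projection_bounded_imp_moment_condition[OF assms] moment_condition_imp_D_hat[OF assms]
      moment_condition_imp_tail_condition[OF assms] tail_condition_imp_moment_condition[OF _ assms(2)]
      tail_condition_imp_projection_bounded[OF _ v]
    by blast
qed

end
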